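(* Let $(M,\alpha,\mathcal X)$ be a complete pre-isotropic structure of the Reeb type, related to a proper submersion $\pi:M\to W$, with $\dim M=2n+1$, $\dim W=p$, $r=2n-p$, $s=n-r$, $\mathcal F=\ker\pi_*$. Let $W'\subset W$, $\dim W'=\dim W$, be a connected compact submanifold (with a smooth boundary) such that: (i) $\pi:M'\to W'$ is a trivial principal $\mathbb T^{r+1}$-bundle, where $M'=\pi^{-1}(W')$; (ii) there exist everywhere independent functions $\bar x_1,\dots,\bar x_{2s}$ defined in some neighborhood of $W'$ satisfying $$\langle dx_1,\dots,dx_{2s}\rangle\cap\mathcal E^0=0,$$ where $x_a=\bar x_a\circ\pi$, $\mathcal E=\mathcal F^\perp$ is the pseudo-orthogonal foliation of $\mathcal F$, and $\mathcal E^0\subset T^*M$ is its annihilator. Then there exist global action-angle variables $(\theta_0,\dots,\theta_r,y_0,\dots,y_r)$ and functions $\bar g_1,\dots,\bar g_{2s}:W'\to\mathbb R$ such that the contact form $\alpha$ on $M'$ reads $$\alpha_0=y_0\,d\theta_0+\dots+y_r\,d\theta_r+\pi^*(\bar g_1\,d\bar x_1+\dots+\bar g_{2s}\,d\bar x_{2s}).$$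
   Context: All objects are smooth. A contact form on a connected manifold $M^{2n+1}$ is a 1-form $\alpha$ with $\alpha\wedge(d\alpha)^n\ne0$; $\mathcal H=\ker\alpha$. The Reeb field $Z$ is given by $i_Z\alpha=1$, $i_Zd\alpha=0$. For a function $f$, $X_f$ is the unique vector field preserving $\mathcal H$ with $i_{X_f}\alpha=f$. Let $\pi:M\to W$ be a proper submersion onto a $p$-dimensional manifold, $p\ge n$, with connected fibers. $(M,\alpha,\mathcal X)$ is a complete pre-isotropic structure of the Reeb type if: $\mathcal F=\ker\pi_*$ is transversal to $\mathcal H$ and $\mathcal F\cap\mathcal H$ is an isotropic subbundle of $\mathcal H$ ($d\alpha$ vanishes on it); $\mathcal X$ is an Abelian Lie algebra of vector fields preserving $\alpha$ ($\mathcal L_Y\alpha=0$ for $Y\in\mathcal X$) which has the fibers of $\pi$ as orbits; and the Reeb field $Z$ is a section of $\mathcal F$. In this situation the fibers are $(r+1)$-dimensional tori and $\pi$ is a toric fibration, locally admitting coordinates $(\theta^i,y^i,x^i)$ ($\theta^i$ angles on the tori, $(y^i,x^i)$ functions from the base) in which $\alpha=\sum_{\nu=0}^r y^i_\nu d\theta^i_\nu+\sum_{a=1}^{2s} g^i_a(y^i,x^i)dx^i_a$, with $y^i_1,\dots,y^i_r$ the integrals of $\mathcal E$ and $y^i_0$ a function of them. "Principal $\mathbb T^{r+1}$-bundle" means that these local angle coordinates can be chosen so that on overlaps they differ by translations depending on the base point, the torus acting by translations of the angles. The pseudo-orthogonal distribution $\mathcal F^\perp$ is the distribution locally generated by $Z$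 and the fields $X_f$ with $f$ a first integral of $\mathcal F$ ($df|_{\mathcal F}=0$); for a structure of the Reeb type it is integrable. Global action-angle variables on $M'$: functions $\theta_\nu:M'\to\mathbb R/2\pi\mathbb Z$ such that $(\theta_0,\dots,\theta_r,\pi):M'\to\mathbb T^{r+1}\times W'$ is a diffeomorphism, and functions $y_0,\dots,y_r:M'\to\mathbb R$ which are integrals of $\mathcal E$ (in particular, constant on fibers of $\pi$; they are redundant since only $r$ of them are locally independent), in which $\alpha$ takes the stated form. *)

theory Defs
  imports "HOL-Analysis.Analysis"
begin

section \<open>Smooth manifolds\<close>

text \<open>
  A manifold is a (Hausdorff, second countable) topological space, given as a type, together with
  a smooth atlas of charts into a Euclidean space. A chart is a pair of its domain and its
  coordinate map; values of the coordinate map outside the domain are irrelevant.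
\<close>

type_synonym ('m, 'e) chart = "'m set \<times> ('m \<Rightarrow> 'e)"

definition chart_inv :: "('m, 'e) chart \<Rightarrow> 'e \<Rightarrow> 'm" where
  "chart_inv c = inv_into (fst c) (snd c)"

definition is_chart :: "('m::topological_space, 'e::euclidean_space) chart \<Rightarrow> bool" where
  "is_chart c \<longleftrightarrow> open (fst c) \<and> open (snd c ` fst c) \<and>
     homeomorphism (fst c) (snd c ` fst c) (snd c) (chart_inv c)"

text \<open>Functions of class \<open>C\<^sup>k\<close> on an open subset of a Euclidean space.\<close>

primrec Ck_on :: "nat \<Rightarrow> 'a::euclidean_space set \<Rightarrow> ('a \<Rightarrow> 'b::real_normed_vector) \<Rightarrow> bool" where
  "Ck_on 0 U f \<longleftrightarrow> continuous_on U f"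
| "Ck_on (Suc k) U f \<longleftrightarrow> f differentiable_on U \<and>
     (\<forall>v. Ck_on k U (\<lambda>x. frechet_derivative f (at x) v))"

definition smooth_on :: "'a::euclidean_space set \<Rightarrow> ('a \<Rightarrow> 'b::real_normed_vector) \<Rightarrow> bool" where
  "smooth_on U f \<longleftrightarrow> (\<forall>k. Ck_on k U f)"

definition smoothly_compatible ::
  "('m::topological_space, 'e::euclidean_space) chart \<Rightarrow> ('m, 'e) chart \<Rightarrow> bool" where
  "smoothly_compatible c d \<longleftrightarrow>
     smooth_on (snd c ` (fst c \<inter> fst d)) (snd d \<circ> chart_inv c) \<and>
     smooth_on (snd d ` (fst c \<inter> fst d)) (snd c \<circ> chart_inv d)"

definition smooth_atlas :: "('m::topological_space, 'e::euclidean_space) chart set \<Rightarrow> bool" where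
  "smooth_atlas A \<longleftrightarrow> (\<forall>c\<in>A. is_chart c) \<and> (\<Union>c\<in>A. fst c) = UNIV \<and>
     (\<forall>c\<in>A. \<forall>d\<in>A. smoothly_compatible c d)"

text \<open>The maximal atlas defined by \<open>A\<close>.\<close>

definition maximal_atlas ::
  "('m::topological_space, 'e::euclidean_space) chart set \<Rightarrow> ('m, 'e) chart set" where
  "maximal_atlas A = {c. is_chart c \<and> (\<forall>d\<in>A. smoothly_compatible c d)}"

definition euclidean_atlas :: "('e, 'e) chart set" where
  "euclidean_atlas = {(UNIV, id)}"

definition product_atlas ::
  "('m, 'e) chart set \<Rightarrow> ('w, 'f) chart set \<Rightarrow> ('m \<times> 'w, 'e \<times> 'f) chart set" where
  "product_atlas A B = (\<lambda>(c, d). (fst c \<times> fst d, map_prod (snd c) (snd d))) ` (A \<times> B)"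

text \<open>
  Smoothness on an arbitrary subset \<open>S\<close> means existence of local smooth extensions; in particular
  this covers manifolds with boundary and embedded submanifolds.
\<close>

definition smooth_fun_on :: "('m::topological_space, 'e::euclidean_space) chart set \<Rightarrow>
    'm set \<Rightarrow> ('m \<Rightarrow> 'b::real_normed_vector) \<Rightarrow> bool" where
  "smooth_fun_on A S f \<longleftrightarrow> (\<forall>x\<in>S. \<exists>U h. open U \<and> x \<in> U \<and> (\<forall>y\<in>U \<inter> S. h y = f y) \<and>
     (\<forall>c\<in>A. smooth_on (snd c ` (U \<inter> fst c)) (h \<circ> chart_inv c)))"

definition smooth_map_on :: "('m::topological_space, 'e::euclidean_space) chart set \<Rightarrow>
    ('w::topological_space, 'f::euclidean_space) chart set \<Rightarrow> 'm set \<Rightarrow> ('m \<Rightarrow> 'w) \<Rightarrow> bool" where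
  "smooth_map_on A B S f \<longleftrightarrow> continuous_on S f \<and>
     (\<forall>d\<in>B. smooth_fun_on A (S \<inter> f -` fst d) (snd d \<circ> f))"

definition diffeo_on :: "('m::topological_space, 'e::euclidean_space) chart set \<Rightarrow>
    ('w::topological_space, 'f::euclidean_space) chart set \<Rightarrow> 'm set \<Rightarrow> 'w set \<Rightarrow>
    ('m \<Rightarrow> 'w) \<Rightarrow> bool" where
  "diffeo_on A B S T f \<longleftrightarrow> bij_betw f S T \<and> smooth_map_on A B S f \<and>
     smooth_map_on B A T (inv_into S f)"

text \<open>A submanifold of full dimension with smooth (possibly empty) boundary. At an interior
  point one can take a chart whose image lies inside the half space.\<close>

definition regular_domain ::
  "('w::topological_space, 'f::euclidean_space) chart set \<Rightarrow> 'w set \<Rightarrow> bool" where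
  "regular_domain B S \<longleftrightarrow> (\<forall>x\<in>S. \<exists>c\<in>maximal_atlas B. x \<in> fst c \<and>
     (\<exists>b\<in>Basis. snd c ` (S \<inter> fst c) = snd c ` fst c \<inter> {u. 0 \<le> u \<bullet> b}))"


section \<open>Tangent vectors, vector fields and differential forms\<close>

text \<open>
  The tangent space at \<open>x\<close> is identified with the model space \<open>'e\<close> by means of a reference
  chart of \<open>A\<close> around \<open>x\<close>, chosen once and for all. So a vector field has type \<open>'m \<Rightarrow> 'e\<close>,
  a 1-form has type \<open>'m \<Rightarrow> 'e \<Rightarrow> real\<close>, and a 2-form has type \<open>'m \<Rightarrow> 'e \<Rightarrow> 'e \<Rightarrow> real\<close>.
  Since the reference charts may vary abruptly with \<open>x\<close>, smoothness refers to the components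
  with respect to the coordinate frames of the charts.
\<close>

definition ref_chart :: "('m, 'e) chart set \<Rightarrow> 'm \<Rightarrow> ('m, 'e) chart" where
  "ref_chart A x = (SOME c. c \<in> A \<and> x \<in> fst c)"

text \<open>
  The differential at \<open>x\<close> of a function given on \<open>S\<close>. It is used for \<open>S\<close> open and for open pieces
  of domains with smooth boundary; in both cases the derivative within \<open>S\<close> is unique.
\<close>

definition differential :: "('m, 'e::euclidean_space) chart set \<Rightarrow> 'm set \<Rightarrow>
    ('m \<Rightarrow> 'b::real_normed_vector) \<Rightarrow> 'm \<Rightarrow> 'e \<Rightarrow> 'b" where
  "differential A S f x = (let c = ref_chart A x in
     frechet_derivative (f \<circ> chart_inv c) (at (snd c x) within snd c ` (S \<inter> fst c)))"

definition tangent_map :: "('m, 'e::euclidean_space) chart set \<Rightarrow>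
    ('w, 'f::euclidean_space) chart set \<Rightarrow> ('m \<Rightarrow> 'w) \<Rightarrow> 'm \<Rightarrow> 'e \<Rightarrow> 'f" where
  "tangent_map A B f x = differential A UNIV (snd (ref_chart B (f x)) \<circ> f) x"

text \<open>The tangent vector at \<open>x\<close> whose components in the chart \<open>c\<close> are \<open>v\<close>.\<close>

definition coord_vector :: "('m, 'e::euclidean_space) chart set \<Rightarrow> ('m, 'e) chart \<Rightarrow>
    'e \<Rightarrow> 'm \<Rightarrow> 'e" where
  "coord_vector A c v x =
     frechet_derivative (snd (ref_chart A x) \<circ> chart_inv c) (at (snd c x)) v"

text \<open>The components of a vector field and of a 1-form in the chart \<open>c\<close>,
  as functions of the coordinates.\<close>

definition vf_comp :: "('m, 'e::euclidean_space) chart set \<Rightarrow> ('m, 'e) chart \<Rightarrow>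
    ('m \<Rightarrow> 'e) \<Rightarrow> 'e \<Rightarrow> 'e" where
  "vf_comp A c X u = (let x = chart_inv c u in differential A (fst c) (snd c) x (X x))"

definition form_comp :: "('m, 'e::euclidean_space) chart set \<Rightarrow> ('m, 'e) chart \<Rightarrow>
    ('m \<Rightarrow> 'e \<Rightarrow> real) \<Rightarrow> 'e \<Rightarrow> 'e \<Rightarrow> real" where
  "form_comp A c \<alpha> u v = (let x = chart_inv c u in \<alpha> x (coord_vector A c v x))"

definition smooth_vector_field_on :: "('m::topological_space, 'e::euclidean_space) chart set \<Rightarrow>
    'm set \<Rightarrow> ('m \<Rightarrow> 'e) \<Rightarrow> bool" where
  "smooth_vector_field_on A U X \<longleftrightarrow>
     (\<forall>c\<in>A. smooth_on (snd c ` (U \<inter> fst c)) (vf_comp A c X))"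

definition smooth_one_form :: "('m::topological_space, 'e::euclidean_space) chart set \<Rightarrow>
    ('m \<Rightarrow> 'e \<Rightarrow> real) \<Rightarrow> bool" where
  "smooth_one_form A \<alpha> \<longleftrightarrow> (\<forall>x. linear (\<alpha> x)) \<and>
     (\<forall>c\<in>A. \<forall>v. smooth_on (snd c ` fst c) (\<lambda>u. form_comp A c \<alpha> u v))"

text \<open>
  The next three notions are given by their usual coordinate expressions, evaluated in the reference
  chart at \<open>x\<close> (the results do not depend on the chart):
  \<open>d\<alpha>(u,v) = \<partial>\<^sub>u(\<alpha>(v)) - \<partial>\<^sub>v(\<alpha>(u))\<close>, \<open>[X,Y] = \<partial>\<^sub>X Y - \<partial>\<^sub>Y X\<close> and
  \<open>(L\<^sub>X \<alpha>)(v) = \<partial>\<^sub>X(\<alpha>(v)) + \<alpha>(\<partial>\<^sub>v X)\<close> for constant \<open>u\<close>, \<open>v\<close>.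
\<close>

definition ext_deriv :: "('m, 'e::euclidean_space) chart set \<Rightarrow> ('m \<Rightarrow> 'e \<Rightarrow> real) \<Rightarrow>
    'm \<Rightarrow> 'e \<Rightarrow> 'e \<Rightarrow> real" where
  "ext_deriv A \<alpha> x u v = (let c = ref_chart A x in
     frechet_derivative (\<lambda>z. form_comp A c \<alpha> z v) (at (snd c x)) u -
     frechet_derivative (\<lambda>z. form_comp A c \<alpha> z u) (at (snd c x)) v)"

definition lie_bracket :: "('m, 'e::euclidean_space) chart set \<Rightarrow> ('m \<Rightarrow> 'e) \<Rightarrow> ('m \<Rightarrow> 'e) \<Rightarrow>
    'm \<Rightarrow> 'e" where
  "lie_bracket A X Y x = (let c = ref_chart A x in
     frechet_derivative (vf_comp A c Y) (at (snd c x)) (X x) -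
     frechet_derivative (vf_comp A c X) (at (snd c x)) (Y x))"

definition lie_deriv :: "('m, 'e::euclidean_space) chart set \<Rightarrow> ('m \<Rightarrow> 'e) \<Rightarrow>
    ('m \<Rightarrow> 'e \<Rightarrow> real) \<Rightarrow> 'm \<Rightarrow> 'e \<Rightarrow> real" where
  "lie_deriv A X \<alpha> x v = (let c = ref_chart A x in
     frechet_derivative (\<lambda>z. form_comp A c \<alpha> z v) (at (snd c x)) (X x) +
     \<alpha> x (frechet_derivative (vf_comp A c X) (at (snd c x)) v))"

text \<open>Exterior algebra: a \<open>k\<close>-form is a function of the vectors \<open>w 0, \<dots>, w (k - 1)\<close>.\<close>

definition wedge :: "nat \<Rightarrow> nat \<Rightarrow> ((nat \<Rightarrow> 'v) \<Rightarrow> real) \<Rightarrow> ((nat \<Rightarrow> 'v) \<Rightarrow> real) \<Rightarrow>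
    (nat \<Rightarrow> 'v) \<Rightarrow> real" where
  "wedge k l \<phi> \<psi> w = (\<Sum>\<sigma> | \<sigma> permutes {..<k + l}.
     of_int (sign \<sigma>) * \<phi> (\<lambda>i. w (\<sigma> i)) * \<psi> (\<lambda>i. w (\<sigma> (k + i)))) / (fact k * fact l)"

primrec wedge_power :: "nat \<Rightarrow> ((nat \<Rightarrow> 'v) \<Rightarrow> real) \<Rightarrow> nat \<Rightarrow> (nat \<Rightarrow> 'v) \<Rightarrow> real" where
  "wedge_power k \<phi> 0 = (\<lambda>w. 1)"
| "wedge_power k \<phi> (Suc n) = wedge k (k * n) \<phi> (wedge_power k \<phi> n)"


section \<open>Contact forms\<close>

definition contact_form :: "('m::topological_space, 'e::euclidean_space) chart set \<Rightarrow> nat \<Rightarrow>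
    ('m \<Rightarrow> 'e \<Rightarrow> real) \<Rightarrow> bool" where
  "contact_form A n \<alpha> \<longleftrightarrow> smooth_one_form A \<alpha> \<and>
     (\<forall>x. \<exists>w. wedge 1 (2 * n) (\<lambda>w. \<alpha> x (w 0))
        (wedge_power 2 (\<lambda>w. ext_deriv A \<alpha> x (w 0) (w 1)) n) w \<noteq> 0)"

definition contact_distribution :: "('m \<Rightarrow> 'e \<Rightarrow> real) \<Rightarrow> 'm \<Rightarrow> 'e set" where
  "contact_distribution \<alpha> x = {v. \<alpha> x v = 0}"

definition reeb_field :: "('m, 'e::euclidean_space) chart set \<Rightarrow> ('m \<Rightarrow> 'e \<Rightarrow> real) \<Rightarrow>
    'm \<Rightarrow> 'e" where
  "reeb_field A \<alpha> x = (THE z. \<alpha> x z = 1 \<and> (\<forall>v. ext_deriv A \<alpha> x z v = 0))"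

text \<open>\<open>X = X\<^sub>f\<close> on the open set \<open>U\<close>: \<open>X\<close> preserves the contact distribution, that is,
  \<open>L\<^sub>X \<alpha>\<close> is a multiple of \<open>\<alpha>\<close>, and \<open>\<alpha>(X) = f\<close>.\<close>

definition contact_hamiltonian_field_on ::
  "('m::topological_space, 'e::euclidean_space) chart set \<Rightarrow> ('m \<Rightarrow> 'e \<Rightarrow> real) \<Rightarrow>
    'm set \<Rightarrow> ('m \<Rightarrow> real) \<Rightarrow> ('m \<Rightarrow> 'e) \<Rightarrow> bool" where
  "contact_hamiltonian_field_on A \<alpha> U f X \<longleftrightarrow> smooth_vector_field_on A U X \<and>
     (\<forall>x\<in>U. \<exists>h. \<forall>v. lie_deriv A X \<alpha> x v = h * \<alpha> x v) \<and>
     (\<forall>x\<in>U. \<alpha> x (X x) = f x)"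

text \<open>\<open>f\<close> is a smooth first integral of the distribution \<open>D\<close> on \<open>S\<close>.\<close>

definition first_integral_on :: "('m::topological_space, 'e::euclidean_space) chart set \<Rightarrow>
    ('m \<Rightarrow> 'e set) \<Rightarrow> 'm set \<Rightarrow> ('m \<Rightarrow> real) \<Rightarrow> bool" where
  "first_integral_on A D S f \<longleftrightarrow> smooth_fun_on A S f \<and>
     (\<forall>x\<in>S. \<forall>v\<in>D x. differential A S f x v = 0)"

definition pseudo_orthogonal :: "('m::topological_space, 'e::euclidean_space) chart set \<Rightarrow>
    ('m \<Rightarrow> 'e \<Rightarrow> real) \<Rightarrow> ('m \<Rightarrow> 'e set) \<Rightarrow> 'm \<Rightarrow> 'e set" where
  "pseudo_orthogonal A \<alpha> F x = span (insert (reeb_field A \<alpha> x)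
     {X x |U f X. open U \<and> x \<in> U \<and> first_integral_on A F U f \<and>
        contact_hamiltonian_field_on A \<alpha> U f X})"

definition annihilator :: "'e::euclidean_space set \<Rightarrow> ('e \<Rightarrow> real) set" where
  "annihilator E = {\<phi>. linear \<phi> \<and> (\<forall>v\<in>E. \<phi> v = 0)}"


section \<open>Complete pre-isotropic structures of the Reeb type\<close>

definition proper_submersion :: "('m::topological_space, 'e::euclidean_space) chart set \<Rightarrow>
    ('w::topological_space, 'f::euclidean_space) chart set \<Rightarrow> ('m \<Rightarrow> 'w) \<Rightarrow> bool" where
  "proper_submersion A B \<pi> \<longleftrightarrow> smooth_map_on A B UNIV \<pi> \<and> surj \<pi> \<and>
     (\<forall>x. surj (tangent_map A B \<pi> x)) \<and> (\<forall>K. compact K \<longrightarrow> compact (\<pi> -` K))"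

definition vertical :: "('m, 'e::euclidean_space) chart set \<Rightarrow>
    ('w, 'f::euclidean_space) chart set \<Rightarrow> ('m \<Rightarrow> 'w) \<Rightarrow> 'm \<Rightarrow> 'e set" where
  "vertical A B \<pi> x = {v. tangent_map A B \<pi> x v = 0}"

definition integral_curve_on :: "('m::topological_space, 'e::euclidean_space) chart set \<Rightarrow>
    ('m \<Rightarrow> 'e) \<Rightarrow> real \<Rightarrow> real \<Rightarrow> (real \<Rightarrow> 'm) \<Rightarrow> bool" where
  "integral_curve_on A X a b \<gamma> \<longleftrightarrow> continuous_on {a..b} \<gamma> \<and>
     (\<forall>t\<in>{a..b}. ((\<lambda>\<tau>. snd (ref_chart A (\<gamma> t)) (\<gamma> \<tau>)) has_vector_derivative X (\<gamma> t))
        (at t within {a..b}))"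

text \<open>The orbit of \<open>x\<close>: the points reached by finitely many successive flows of fields
  from \<open>\<X>\<close>.\<close>

definition orbit :: "('m::topological_space, 'e::euclidean_space) chart set \<Rightarrow>
    ('m \<Rightarrow> 'e) set \<Rightarrow> 'm \<Rightarrow> 'm set" where
  "orbit A \<X> x = {(\<gamma> a, \<gamma> b) |X a b \<gamma>. X \<in> \<X> \<and> a \<le> b \<and> integral_curve_on A X a b \<gamma>}\<^sup>* `` {x}"

definition abelian_lie_algebra :: "('m::topological_space, 'e::euclidean_space) chart set \<Rightarrow>
    ('m \<Rightarrow> 'e) set \<Rightarrow> bool" where
  "abelian_lie_algebra A \<X> \<longleftrightarrow> (\<forall>X\<in>\<X>. smooth_vector_field_on A UNIV X) \<and> (\<lambda>x. 0) \<in> \<X> \<and>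
     (\<forall>X\<in>\<X>. \<forall>Y\<in>\<X>. (\<lambda>x. X x + Y x) \<in> \<X>) \<and> (\<forall>X\<in>\<X>. \<forall>k::real. (\<lambda>x. k *\<^sub>R X x) \<in> \<X>) \<and>
     (\<forall>X\<in>\<X>. \<forall>Y\<in>\<X>. \<forall>x. lie_bracket A X Y x = 0)"

definition complete_preisotropic_Reeb ::
  "('m::topological_space, 'e::euclidean_space) chart set \<Rightarrow>
    ('w::topological_space, 'f::euclidean_space) chart set \<Rightarrow> ('m \<Rightarrow> 'w) \<Rightarrow>
    ('m \<Rightarrow> 'e \<Rightarrow> real) \<Rightarrow> ('m \<Rightarrow> 'e) set \<Rightarrow> bool" where
  "complete_preisotropic_Reeb A B \<pi> \<alpha> \<X> \<longleftrightarrow>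
     (\<forall>x. {u + v |u v. u \<in> vertical A B \<pi> x \<and> v \<in> contact_distribution \<alpha> x} = UNIV) \<and>
     (\<forall>x. \<forall>u\<in>vertical A B \<pi> x \<inter> contact_distribution \<alpha> x.
        \<forall>v\<in>vertical A B \<pi> x \<inter> contact_distribution \<alpha> x. ext_deriv A \<alpha> x u v = 0) \<and>
     abelian_lie_algebra A \<X> \<and>
     (\<forall>Y\<in>\<X>. \<forall>x v. lie_deriv A Y \<alpha> x v = 0) \<and>
     (\<forall>x. orbit A \<X> x = \<pi> -` {\<pi> x}) \<and>
     (\<forall>x. reeb_field A \<alpha> x \<in> vertical A B \<pi> x)"


section \<open>Angles, principal torus bundles and action-angle variables\<close>

text \<open>
  \<open>\<real>/2\<pi>\<int>\<close> is identified with the unit circle by \<open>t \<mapsto> cis t\<close>, so an angle function \<open>\<theta>\<close> appears as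
  \<open>z = exp(i\<theta>)\<close>, with \<open>d\<theta> = Im (cnj z dz)\<close>, and translation of angles is multiplication by a
  number of modulus 1 in each component. The angles are indexed by a type \<open>'k\<close> with \<open>r + 1\<close> elements.
\<close>

definition torus :: "(complex ^ 'k) set" where
  "torus = {z. \<forall>\<nu>. z $ \<nu> \<in> sphere 0 1}"

definition d_angle :: "('m, 'e::euclidean_space) chart set \<Rightarrow> 'm set \<Rightarrow> ('m \<Rightarrow> complex) \<Rightarrow>
    'm \<Rightarrow> 'e \<Rightarrow> real" where
  "d_angle A S z x v = Im (cnj (z x) * differential A S z x v)"

text \<open>Smooth angles on \<open>\<pi>\<^sup>-\<^sup>1(V)\<close> that identify it with the product of the torus and \<open>V\<close>.\<close>

definition angles_over :: "('m::topological_space, 'e::euclidean_space) chart set \<Rightarrow>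
    ('w::topological_space, 'f::euclidean_space) chart set \<Rightarrow> ('m \<Rightarrow> 'w) \<Rightarrow> 'w set \<Rightarrow>
    ('m \<Rightarrow> complex ^ 'k) \<Rightarrow> bool" where
  "angles_over A B \<pi> V \<Theta> \<longleftrightarrow>
     diffeo_on A (product_atlas euclidean_atlas B) (\<pi> -` V) (torus \<times> V) (\<lambda>m. (\<Theta> m, \<pi> m))"

text \<open>
  The angles \<open>\<Theta>\<close> over \<open>V\<close> belong to a local coordinate system \<open>(\<theta>, y, x)\<close> in which
  \<open>\<alpha> = \<Sum>\<^sub>\<nu> y\<^sub>\<nu> d\<theta>\<^sub>\<nu> + \<Sum>\<^sub>a g\<^sub>a dx\<^sub>a\<close>. The functions \<open>y\<^sub>\<nu>\<close> with \<open>\<nu> \<noteq> j\<close> and \<open>x\<^sub>1, \<dots>, x\<^sub>2\<^sub>s\<close> are exactly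
  the components of a chart of \<open>W\<close>; the remaining action \<open>y\<^sub>j\<close> is a function of the other ones.
\<close>

definition action_angle_chart :: "('m::topological_space, 'e::euclidean_space) chart set \<Rightarrow>
    ('w::topological_space, 'f::euclidean_space) chart set \<Rightarrow> ('m \<Rightarrow> 'w) \<Rightarrow>
    ('m \<Rightarrow> 'e \<Rightarrow> real) \<Rightarrow> nat \<Rightarrow> 'w set \<Rightarrow> ('m \<Rightarrow> complex ^ 'k) \<Rightarrow> bool" where
  "action_angle_chart A B \<pi> \<alpha> s V \<Theta> \<longleftrightarrow> angles_over A B \<pi> V \<Theta> \<and>
     (\<exists>(j :: 'k) (y :: 'k \<Rightarrow> 'w \<Rightarrow> real) (x :: nat \<Rightarrow> 'w \<Rightarrow> real) (g :: nat \<Rightarrow> 'w \<Rightarrow> real).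
        (\<exists>c\<in>maximal_atlas B. V \<subseteq> fst c \<and>
           (\<exists>b. bij_betw b ((UNIV - {j}) <+> {1..2 * s}) Basis \<and>
              (\<forall>w\<in>V. (\<forall>\<nu>\<in>UNIV - {j}. y \<nu> w = snd c w \<bullet> b (Inl \<nu>)) \<and>
                     (\<forall>a\<in>{1..2 * s}. x a w = snd c w \<bullet> b (Inr a))))) \<and>
        smooth_fun_on B V (y j) \<and>
        (\<exists>h. \<forall>w\<in>V. y j w = h (\<lambda>\<nu>. if \<nu> = j then 0 else y \<nu> w)) \<and>
        (\<forall>\<nu>. first_integral_on A (pseudo_orthogonal A \<alpha> (vertical A B \<pi>)) (\<pi> -` V) (y \<nu> \<circ> \<pi>)) \<and>
        (\<forall>a\<in>{1..2 * s}. smooth_fun_on B V (g a)) \<and>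
        (\<forall>m\<in>\<pi> -` V. \<forall>v. \<alpha> m v =
           (\<Sum>\<nu>\<in>UNIV. y \<nu> (\<pi> m) * d_angle A (\<pi> -` V) (\<lambda>m. \<Theta> m $ \<nu>) m v) +
           (\<Sum>a=1..2 * s. g a (\<pi> m) * differential A (\<pi> -` V) (x a \<circ> \<pi>) m v)))"

definition differ_by_translation ::
  "('m \<Rightarrow> 'w) \<Rightarrow> 'w set \<Rightarrow> ('m \<Rightarrow> complex ^ 'k) \<Rightarrow> ('m \<Rightarrow> complex ^ 'k) \<Rightarrow> bool" where
  "differ_by_translation \<pi> V \<Theta> \<Theta>' \<longleftrightarrow>
     (\<exists>\<tau>. \<forall>m\<in>\<pi> -` V. \<tau> (\<pi> m) \<in> torus \<and> (\<forall>\<nu>. \<Theta>' m $ \<nu> = \<tau> (\<pi> m) $ \<nu> * \<Theta> m $ \<nu>))"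

text \<open>\<open>\<C>\<close> is a family of local action-angle coordinates over relatively open pieces of \<open>S\<close> which
  makes \<open>\<pi>\<close> a principal torus bundle over \<open>S\<close>.\<close>

definition principal_torus_bundle :: "('m::topological_space, 'e::euclidean_space) chart set \<Rightarrow>
    ('w::topological_space, 'f::euclidean_space) chart set \<Rightarrow> ('m \<Rightarrow> 'w) \<Rightarrow>
    ('m \<Rightarrow> 'e \<Rightarrow> real) \<Rightarrow> nat \<Rightarrow> 'w set \<Rightarrow> ('w set \<times> ('m \<Rightarrow> complex ^ 'k)) set \<Rightarrow> bool" where
  "principal_torus_bundle A B \<pi> \<alpha> s S \<C> \<longleftrightarrow>
     (\<forall>(V, \<Theta>)\<in>\<C>. openin (top_of_set S) V \<and> action_angle_chart A B \<pi> \<alpha> s V \<Theta>) \<and>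
     (\<Union>(V, \<Theta>)\<in>\<C>. V) = S \<and>
     (\<forall>(V, \<Theta>)\<in>\<C>. \<forall>(V', \<Theta>')\<in>\<C>. differ_by_translation \<pi> (V \<inter> V') \<Theta> \<Theta>')"

text \<open>A trivialization \<open>(\<Phi>, \<pi>)\<close> is equivariant for the torus action iff \<open>\<Phi>\<close> differs from the
  local angles by translations depending on the base point.\<close>

definition trivial_torus_bundle :: "('m::topological_space, 'e::euclidean_space) chart set \<Rightarrow>
    ('w::topological_space, 'f::euclidean_space) chart set \<Rightarrow> ('m \<Rightarrow> 'w) \<Rightarrow>
    'w set \<Rightarrow> ('w set \<times> ('m \<Rightarrow> complex ^ 'k)) set \<Rightarrow> bool" where
  "trivial_torus_bundle A B \<pi> S \<C> \<longleftrightarrow>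
     (\<exists>\<Phi>. angles_over A B \<pi> S \<Phi> \<and> (\<forall>(V, \<Theta>)\<in>\<C>. differ_by_translation \<pi> V \<Theta> \<Phi>))"

end

theory Submission
  imports Defs
begin

text \<open>
  Let \<open>\<phi>\<close> be the angles of a trivialization and \<open>\<Theta>\<close> local angles over \<open>V\<close>, so that
  \<open>\<Theta> = T(\<pi>(m)) \<phi>\<close>. Evaluating \<open>\<alpha>\<close> on the generators of the torus action shows that the local
  actions \<open>y\<^sub>\<nu>\<close> fit together, and \<open>\<alpha> = \<Sum> y\<^sub>\<nu> d\<phi>\<^sub>\<nu> + \<pi>\<^sup>*\<beta>\<close> for a 1-form \<open>\<beta>\<close> on the base. At each
  point of the base the linear system
  \<open>\<Sum> y\<^sub>\<nu> f\<^sub>\<nu> = 0\<close>, \<open>\<Sum> g\<^sub>a dxbar\<^sub>a - \<Sum> f\<^sub>\<nu> dy\<^sub>\<nu> = \<beta>\<close> for \<open>(f, g)\<close> is square; it is regular, because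
  the \<open>dy\<^sub>\<nu>\<close> annihilate \<open>E\<close> while no nonzero combination of the \<open>dxbar\<^sub>a\<close> does, and because a vector
  \<open>f\<close> with \<open>\<Sum> y\<^sub>\<nu> f\<^sub>\<nu> = 0\<close> and \<open>\<Sum> f\<^sub>\<nu> dy\<^sub>\<nu> = 0\<close> gives a vertical vector in the kernel of both \<open>\<alpha>\<close> and
  \<open>d\<alpha>\<close>. Its unique solution is thus globally defined and smooth. Since \<open>\<Sum> y\<^sub>\<nu> f\<^sub>\<nu> = 0\<close> implies
  \<open>\<Sum> y\<^sub>\<nu> df\<^sub>\<nu> = - \<Sum> f\<^sub>\<nu> dy\<^sub>\<nu>\<close>, the angles \<open>\<phi>\<^sub>\<nu> + f\<^sub>\<nu>\<close> have the required property.
\<close>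

section \<open>Calculus of smooth functions\<close>

text \<open>Correcting the angles by functions f of the base changes \<alpha> through \<Sum> y df,
  which taken as it stands would be a differential equation for f. The normalization \<Sum> y f = 0
  trades \<Sum> y df for - \<Sum> f dy, so that f enters only algebraically; pointwise uniqueness
  then does all the gluing, with no partition of unity. There are r + 1 + 2 s unknowns and p + 1
  equations (the normalization and the components of a covector on the base), and the numbers agree
  because r = 2 n - p and s = n - r. The obstacle is the boundary of W'. Functions on W' and on its
  preimage are smooth only through local extensions, and differentials are derivatives within a set.
  They are unique because every point of the set is the start of rays in it with spanning
  directions. Elimination, which needs an open domain, is run on extensions of the data, and its
  result is restricted afterwards.\<close>

lemma Ck_on_cong:
  assumes "open U" "Ck_on k U f" "\<And>x. x \<in> U \<Longrightarrow> f x = g x"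
  shows "Ck_on k U g"
  using assms(2,3)
proof (induction k arbitrary: f g)
  case 0
  then show ?case by (simp cong: continuous_on_cong)
next
  case (Suc k)
  have d: "(f has_derivative frechet_derivative f (at x)) (at x)" if "x \<in> U" for x
    using Suc.prems(1) that assms(1)
    by (simp add: differentiable_on_eq_differentiable_at flip: frechet_derivative_works)
  have g: "(g has_derivative frechet_derivative f (at x)) (at x)" if "x \<in> U" for x
    using has_derivative_transform_within_open[OF d[OF that] assms(1) that] Suc.prems(2) by auto
  have "Ck_on k U (\<lambda>x. frechet_derivative g (at x) v)" for v
    using Suc.IH[of "\<lambda>x. frechet_derivative f (at x) v"] Suc.prems(1) frechet_derivative_at[OF g]
    by simp
  then show ?case
    using g assms(1) by (auto simp: differentiable_on_eq_differentiable_at differentiable_def)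
qed

text \<open>The closure properties below are inductions on k with an explicit derivative; this rule
  lets them use that derivative in place of the term \<open>frechet_derivative\<close>.\<close>

lemma Ck_onI:
  assumes "open U" "\<And>x. x \<in> U \<Longrightarrow> (f has_derivative f' x) (at x)"
    "\<And>v. Ck_on k U (\<lambda>x. f' x v)"
  shows "Ck_on (Suc k) U f"
proof -
  have "f differentiable_on U"
    using assms(1,2) by (auto simp: differentiable_on_eq_differentiable_at differentiable_def)
  moreover have "f' x v = frechet_derivative f (at x) v" if "x \<in> U" for x v
    using frechet_derivative_at[OF assms(2)[OF that]] by simp
  ultimately show ?thesis
    using Ck_on_cong[OF assms(1) assms(3)] by simp
qed

lemma Ck_on_derivative:
  assumes "open U" "Ck_on (Suc k) U f" "x \<in> U"
  shows "(f has_derivative frechet_derivative f (at x)) (at x)"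
  using assms by (simp add: differentiable_on_eq_differentiable_at flip: frechet_derivative_works)

lemma Ck_on_SucD:
  assumes "open U" "Ck_on (Suc k) U f"
  shows "Ck_on k U f"
  using assms(2)
proof (induction k arbitrary: f)
  case 0
  then show ?case by (simp add: differentiable_imp_continuous_on)
next
  case (Suc k)
  then show ?case by auto
qed

lemma Ck_on_subset:
  assumes "open U" "open V" "V \<subseteq> U" "Ck_on k U f"
  shows "Ck_on k V f"
  using assms(4)
proof (induction k arbitrary: f)
  case 0
  then show ?case using assms(3) continuous_on_subset by auto
next
  case (Suc k)
  then show ?case using assms(3) differentiable_on_subset by auto
qed

lemma Ck_on_const: "open U \<Longrightarrow> Ck_on k U (\<lambda>x. c)"
proof (induction k arbitrary: c)
  case (Suc k)
  then show ?case by (intro Ck_onI[where f' = "\<lambda>x v. 0"]) auto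
qed auto

lemma Ck_on_linear: "open U \<Longrightarrow> bounded_linear f \<Longrightarrow> Ck_on k U f"
proof (induction k)
  case 0
  then show ?case by (simp add: linear_continuous_on)
next
  case (Suc k)
  then show ?case
    by (intro Ck_onI[where f' = "\<lambda>x. f"]) (auto intro: bounded_linear_imp_has_derivative Ck_on_const)
qed

lemma Ck_on_add:
  assumes "open U" "Ck_on k U f" "Ck_on k U g"
  shows "Ck_on k U (\<lambda>x. f x + g x)"
  using assms(2,3)
proof (induction k arbitrary: f g)
  case 0
  then show ?case by (simp add: continuous_on_add)
next
  case (Suc k)
  show ?case
    by (rule Ck_onI[OF assms(1)
          has_derivative_add[OF Ck_on_derivative[OF assms(1) Suc.prems(1)]
            Ck_on_derivative[OF assms(1) Suc.prems(2)]]])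
      (use Suc assms(1) in auto)
qed

text \<open>By the product rule the derivative is a sum of terms of the same bilinear kind, each
  with one factor differentiated; the other factor is weakened from order \<open>Suc k\<close> to
  k.\<close>

lemma Ck_on_bilinear:
  assumes "open U" "bounded_bilinear p" "Ck_on k U f" "Ck_on k U g"
  shows "Ck_on k U (\<lambda>x. p (f x) (g x))"
  using assms(3,4)
proof (induction k arbitrary: f g)
  case 0
  then show ?case using bounded_bilinear.continuous_on[OF assms(2)] by simp
next
  case (Suc k)
  have "Ck_on k U f" "Ck_on k U g"
    using Suc.prems Ck_on_SucD assms(1) by auto
  then show ?case
    using Suc assms(1)
    by (intro Ck_onI[OF assms(1)
          bounded_bilinear.FDERIV[OF assms(2) Ck_on_derivative[OF assms(1) Suc.prems(1)]
            Ck_on_derivative[OF assms(1) Suc.prems(2)]]] Ck_on_add) auto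
qed

lemma Ck_on_sum:
  assumes "open U" "\<And>i. i \<in> I \<Longrightarrow> Ck_on k U (f i)"
  shows "Ck_on k U (\<lambda>x. \<Sum>i\<in>I. f i x)"
  using assms(2)
  by (induction I rule: infinite_finite_induct) (auto simp: Ck_on_const Ck_on_add assms(1))

text \<open>The direction \<open>?f' x v\<close> fed to the derivative of g moves with x, while the
  induction hypothesis speaks of a fixed direction. Expansion in the basis separates the two: fixed
  directions for g, scalar coefficients from f.\<close>

lemma Ck_on_compose:
  fixes f :: "'a::euclidean_space \<Rightarrow> 'b::euclidean_space" and g :: "'b \<Rightarrow> 'c::real_normed_vector"
  assumes "open U" "open V" "f ` U \<subseteq> V" "Ck_on k U f" "Ck_on k V g"
  shows "Ck_on k U (\<lambda>x. g (f x))"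
  using assms(4,5)
proof (induction k arbitrary: g)
  case 0
  then show ?case
    using assms(3) by (auto intro: continuous_on_compose2)
next
  case (Suc k)
  let ?f' = "\<lambda>x. frechet_derivative f (at x)" and ?g' = "\<lambda>x. frechet_derivative g (at x)"
  have der: "((\<lambda>x. g (f x)) has_derivative (\<lambda>v. ?g' (f x) (?f' x v))) (at x)" if "x \<in> U" for x
  proof -
    have "f x \<in> V" using assms(3) that by blast
    then show ?thesis
      by (rule has_derivative_compose[OF Ck_on_derivative[OF assms(1) Suc.prems(1) that]
            Ck_on_derivative[OF assms(2) Suc.prems(2)]])
  qed
  have "?g' (f x) (?f' x v) = (\<Sum>b\<in>Basis. (?f' x v \<bullet> b) *\<^sub>R ?g' (f x) b)" if "x \<in> U" for x v
  proof -
    have "linear (?g' (f x))"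
      using Ck_on_derivative[OF assms(2) Suc.prems(2)] assms(3) that has_derivative_linear by blast
    then show ?thesis
      using linear_sum[of "?g' (f x)" "\<lambda>b. (?f' x v \<bullet> b) *\<^sub>R b" Basis]
      by (simp add: linear_scale euclidean_representation)
  qed
  moreover have "Ck_on k U (\<lambda>x. \<Sum>b\<in>Basis. (?f' x v \<bullet> b) *\<^sub>R ?g' (f x) b)" for v
  proof (intro Ck_on_sum assms(1) Ck_on_bilinear[OF _ bounded_bilinear_scaleR])
    show "Ck_on k U (\<lambda>x. ?f' x v \<bullet> b)" for b
      using Suc.prems(1) Ck_on_bilinear[OF assms(1) bounded_bilinear_inner _ Ck_on_const[OF assms(1)]]
      by auto
    show "Ck_on k U (\<lambda>x. ?g' (f x) b)" for b
      using Suc.IH[OF Ck_on_SucD[OF assms(1) Suc.prems(1)]] Suc.prems(2) by auto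
  qed
  ultimately have "Ck_on k U (\<lambda>x. ?g' (f x) (?f' x v))" for v
    using Ck_on_cong[OF assms(1), of k "\<lambda>x. \<Sum>b\<in>Basis. (?f' x v \<bullet> b) *\<^sub>R ?g' (f x) b"
        "\<lambda>x. ?g' (f x) (?f' x v)"] by simp
  then show ?case using Ck_onI[OF assms(1) der] by blast
qed

text \<open>The derivative is a polynomial in \<open>inverse\<close> itself, so the order rises by
  induction.\<close>

lemma Ck_on_inverse: "Ck_on k (- {0}) (inverse :: real \<Rightarrow> real)"
proof (induction k)
  case 0
  then show ?case by (auto intro!: continuous_intros)
next
  case (Suc k)
  have "Ck_on k (- {0}) (\<lambda>x::real. - v * (inverse x * inverse x))" for v
    by (intro Ck_on_bilinear[OF _ bounded_bilinear_mult] Ck_on_const Suc) auto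
  then show ?case
    by (intro Ck_onI[where f' = "\<lambda>x v. - v * (inverse x * inverse x)"])
      (auto intro!: derivative_eq_intros)
qed

lemma has_derivative_cis: "(cis has_derivative (\<lambda>v. v *\<^sub>R (\<i> * cis t))) (at t)"
proof -
  have "((\<lambda>t. exp (\<i> * complex_of_real t)) has_derivative
      (\<lambda>v. v *\<^sub>R (\<i> * exp (\<i> * complex_of_real t)))) (at t)"
  proof (rule has_derivative_eq_rhs)
    show "((\<lambda>t. exp (\<i> * complex_of_real t)) has_derivative
      (\<lambda>v. exp (\<i> * complex_of_real t) * (\<i> * complex_of_real v))) (at t)"
      by (rule has_derivative_compose[OF _ DERIV_exp[unfolded has_field_derivative_def]])
        (auto intro!: derivative_eq_intros)
  qed (auto simp: scaleR_conv_of_real)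
  then show ?thesis by (simp add: cis_conv_exp[abs_def])
qed

lemma Ck_on_cis: "Ck_on k UNIV cis"
proof (induction k)
  case 0
  show ?case by (simp add: continuous_on_cis)
next
  case (Suc k)
  have "Ck_on k UNIV (\<lambda>t. v *\<^sub>R (\<i> * cis t))" for v
    by (intro Ck_on_bilinear[OF _ bounded_bilinear_mult] Ck_on_bilinear[OF _ bounded_bilinear_scaleR]
        Ck_on_const Suc) auto
  then show ?case
    by (intro Ck_onI[where f' = "\<lambda>t v. v *\<^sub>R (\<i> * cis t)"] has_derivative_cis) auto
qed

text \<open>Both mixed second derivatives are limits of the second difference quotient.\<close>

lemma second_difference:
  fixes f :: "'a::real_normed_vector \<Rightarrow> real"
  assumes f: "\<And>y. y \<in> ball x e \<Longrightarrow> (f has_derivative f' y) (at y)"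
    and f'': "\<And>y. y \<in> ball x e \<Longrightarrow> ((\<lambda>y. f' y u) has_derivative f'' y) (at y)"
    and h: "h > 0" "h * (norm u + norm v) < e"
  obtains y where "y \<in> ball x e"
    "f (x + h *\<^sub>R u + h *\<^sub>R v) - f (x + h *\<^sub>R u) - f (x + h *\<^sub>R v) + f x = h * h * f'' y v"
proof -
  have bound: "dist x (x + s *\<^sub>R u + t *\<^sub>R v) \<le> h * (norm u + norm v)"
    if "0 \<le> s" "s \<le> h" "0 \<le> t" "t \<le> h" for s t
  proof -
    have "dist x (x + s *\<^sub>R u + t *\<^sub>R v) = norm (s *\<^sub>R u + t *\<^sub>R v)"
      by (simp add: dist_norm norm_minus_commute algebra_simps flip: norm_minus_cancel[of "- _ - _"])
    also have "\<dots> \<le> s * norm u + t * norm v"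
      using that by (intro order_trans[OF norm_triangle_ineq]) auto
    also have "\<dots> \<le> h * norm u + h * norm v"
      using that by (intro add_mono mult_right_mono) auto
    finally show ?thesis by (simp add: algebra_simps)
  qed
  then have inb: "x + s *\<^sub>R u + t *\<^sub>R v \<in> ball x e"
    if "0 \<le> s" "s \<le> h" "0 \<le> t" "t \<le> h" for s t
    using that h(2) by (fastforce simp: mem_ball)
  \<comment> \<open>The mean value theorem is applied in direction u to this difference, then in
    direction v to the result. The summand \<open>0 *\<^sub>R v\<close> keeps both values in the
    form covered by \<open>D\<close>.\<close>
  let ?g = "\<lambda>s. f (x + s *\<^sub>R u + h *\<^sub>R v) - f (x + s *\<^sub>R u + 0 *\<^sub>R v)"
  let ?g' = "\<lambda>s. f' (x + s *\<^sub>R u + h *\<^sub>R v) u - f' (x + s *\<^sub>R u + 0 *\<^sub>R v) u"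
  have D: "((\<lambda>s. f (x + s *\<^sub>R u + t *\<^sub>R v)) has_real_derivative f' (x + s *\<^sub>R u + t *\<^sub>R v) u) (at s)"
    if st: "0 \<le> s" "s \<le> h" "0 \<le> t" "t \<le> h" for s t
  proof -
    have "((\<lambda>s. x + s *\<^sub>R u + t *\<^sub>R v) has_derivative (\<lambda>k. k *\<^sub>R u)) (at s)"
      by (auto intro!: derivative_eq_intros)
    from has_derivative_compose[OF this f[OF inb[OF st]]]
    show ?thesis
      using linear_scale[OF has_derivative_linear[OF f[OF inb[OF st]]]]
      by (simp add: has_field_derivative_def mult.commute[of _ "f' _ u"] mult_commute_abs)
  qed
  have "\<exists>s. 0 < s \<and> s < h \<and> ?g h - ?g 0 = (h - 0) * ?g' s"
    using h by (intro MVT2) (auto intro!: DERIV_diff D[of _ 0, simplified] D)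
  then obtain s where s: "0 < s" "s < h" "?g h - ?g 0 = h * ?g' s" by auto
  have D2: "((\<lambda>t. f' (x + s *\<^sub>R u + t *\<^sub>R v) u) has_real_derivative f'' (x + s *\<^sub>R u + t *\<^sub>R v) v) (at t)"
    if t: "0 \<le> t" "t \<le> h" for t
  proof -
    have st: "x + s *\<^sub>R u + t *\<^sub>R v \<in> ball x e" using inb[of s t] s t by auto
    have "((\<lambda>t. x + s *\<^sub>R u + t *\<^sub>R v) has_derivative (\<lambda>k. k *\<^sub>R v)) (at t)"
      by (auto intro!: derivative_eq_intros)
    from has_derivative_compose[OF this f''[OF st]]
    show ?thesis
      using linear_scale[OF has_derivative_linear[OF f''[OF st]]]
      by (simp add: has_field_derivative_def mult_commute_abs)
  qed
  have "\<exists>t. 0 < t \<and> t < h \<and> ?g' s = (h - 0) * f'' (x + s *\<^sub>R u + t *\<^sub>R v) v"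
    using h by (intro MVT2[where f = "\<lambda>t. f' (x + s *\<^sub>R u + t *\<^sub>R v) u"]) (auto intro!: D2)
  then obtain t where t: "0 < t" "t < h" "?g' s = h * f'' (x + s *\<^sub>R u + t *\<^sub>R v) v" by auto
  show thesis
    using that[of "x + s *\<^sub>R u + t *\<^sub>R v"] bound[of s t] inb[of s t] s t by auto
qed

lemma symmetric_second_derivative:
  fixes f :: "'a::real_normed_vector \<Rightarrow> real"
  assumes U: "open U" "x \<in> U"
    and f: "\<And>y. y \<in> U \<Longrightarrow> (f has_derivative f' y) (at y)"
    and fu: "\<And>y. y \<in> U \<Longrightarrow> ((\<lambda>y. f' y u) has_derivative fu y) (at y)"
    and fv: "\<And>y. y \<in> U \<Longrightarrow> ((\<lambda>y. f' y v) has_derivative fv y) (at y)"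
    and cont: "continuous_on U (\<lambda>y. fu y v)" "continuous_on U (\<lambda>y. fv y u)"
  shows "fu x v = fv x u"
proof (rule ccontr)
  assume neq: "fu x v \<noteq> fv x u"
  \<comment> \<open>Half the gap: the two second differences agree, so two values closer than
    \<open>d\<close> to their limits cannot be the same number.\<close>
  define d where "d = \<bar>fu x v - fv x u\<bar> / 2"
  have "d > 0" using neq by (simp add: d_def)
  have "isCont (\<lambda>y. fu y v) x" "isCont (\<lambda>y. fv y u) x"
    using cont U continuous_on_eq_continuous_at by auto
  then obtain e1 e2 where e1: "e1 > 0" "\<And>y. dist y x < e1 \<Longrightarrow> dist (fu y v) (fu x v) < d"
    and e2: "e2 > 0" "\<And>y. dist y x < e2 \<Longrightarrow> dist (fv y u) (fv x u) < d"
    using \<open>d > 0\<close> unfolding continuous_at_eps_delta by metis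
  obtain e0 where e0: "e0 > 0" "ball x e0 \<subseteq> U" using U open_contains_ball by blast
  define e where "e = min e0 (min e1 e2)"
  have e: "e > 0" "ball x e \<subseteq> U" using e0 e1 e2 by (auto simp: e_def)
  \<comment> \<open>The summand 1 keeps the divisor positive when u and v are both 0, and h * D = e
    / 2 leaves room inside the ball.\<close>
  define D where "D = norm u + norm v + 1"
  have D: "D > 0" unfolding D_def by (metis add_nonneg_pos add_nonneg_nonneg norm_ge_zero zero_less_one)
  define h where "h = e / (2 * D)"
  have h: "h > 0" using e(1) D by (simp add: h_def)
  have "h * (norm u + norm v) \<le> h * D" using h by (simp add: D_def)
  also have "\<dots> < e" using D e(1) by (simp add: h_def)
  finally have small: "h * (norm u + norm v) < e" .
  then have small': "h * (norm v + norm u) < e" by (simp add: add.commute)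
  obtain y where y: "y \<in> ball x e"
    "f (x + h *\<^sub>R u + h *\<^sub>R v) - f (x + h *\<^sub>R u) - f (x + h *\<^sub>R v) + f x = h * h * fu y v"
    by (rule second_difference[where x=x and e=e and f=f and f'=f' and u=u and v=v and f''=fu and h=h])
       (use e f fu h small in blast)+
  obtain z where z: "z \<in> ball x e"
    "f (x + h *\<^sub>R v + h *\<^sub>R u) - f (x + h *\<^sub>R v) - f (x + h *\<^sub>R u) + f x = h * h * fv z u"
    by (rule second_difference[where x=x and e=e and f=f and f'=f' and u=v and v=u and f''=fv and h=h])
      (use e f fv h small' in blast)+
  have "h * h * fu y v = h * h * fv z u"
    using y(2) z(2) by (simp add: algebra_simps)
  then have "fu y v = fv z u" using h by simp
  moreover have "dist y x < e1" "dist z x < e2"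
    using y(1) z(1) by (auto simp: e_def dist_commute)
  then have "dist (fu y v) (fu x v) < d" "dist (fv z u) (fv x u) < d"
    using e1(2) e2(2) by blast+
  ultimately show False unfolding d_def dist_real_def by (simp add: abs_if split: if_splits)
qed


section \<open>Smoothness of all orders on open subsets of a Euclidean space\<close>

lemma smooth_on_cong:
  "open U \<Longrightarrow> smooth_on U f \<Longrightarrow> (\<And>x. x \<in> U \<Longrightarrow> f x = g x) \<Longrightarrow> smooth_on U g"
  unfolding smooth_on_def using Ck_on_cong by blast

lemma smooth_on_subset: "open U \<Longrightarrow> open V \<Longrightarrow> V \<subseteq> U \<Longrightarrow> smooth_on U f \<Longrightarrow> smooth_on V f"
  unfolding smooth_on_def using Ck_on_subset by blast

lemma smooth_on_const: "open U \<Longrightarrow> smooth_on U (\<lambda>x. c)"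
  unfolding smooth_on_def using Ck_on_const by blast

lemma smooth_on_linear: "open U \<Longrightarrow> bounded_linear f \<Longrightarrow> smooth_on U f"
  unfolding smooth_on_def using Ck_on_linear by blast

lemma smooth_on_add: "open U \<Longrightarrow> smooth_on U f \<Longrightarrow> smooth_on U g \<Longrightarrow> smooth_on U (\<lambda>x. f x + g x)"
  unfolding smooth_on_def using Ck_on_add by blast

lemma smooth_on_sum:
  "open U \<Longrightarrow> (\<And>i. i \<in> I \<Longrightarrow> smooth_on U (f i)) \<Longrightarrow> smooth_on U (\<lambda>x. \<Sum>i\<in>I. f i x)"
  unfolding smooth_on_def by (intro allI Ck_on_sum) auto

lemma smooth_on_bilinear:
  "open U \<Longrightarrow> bounded_bilinear p \<Longrightarrow> smooth_on U f \<Longrightarrow> smooth_on U g \<Longrightarrow>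
    smooth_on U (\<lambda>x. p (f x) (g x))"
  unfolding smooth_on_def using Ck_on_bilinear by blast

lemma smooth_on_compose:
  fixes f :: "'a::euclidean_space \<Rightarrow> 'b::euclidean_space" and g :: "'b \<Rightarrow> 'c::real_normed_vector"
  assumes "open U" "open V" "f ` U \<subseteq> V" "smooth_on U f" "smooth_on V g"
  shows "smooth_on U (\<lambda>x. g (f x))"
  using assms unfolding smooth_on_def by (blast intro: Ck_on_compose[of U V])

lemma smooth_on_linear_compose:
  fixes f :: "'a::euclidean_space \<Rightarrow> 'b::euclidean_space" and g :: "'b \<Rightarrow> 'c::real_normed_vector"
  assumes "open U" "bounded_linear g" "smooth_on U f"
  shows "smooth_on U (\<lambda>x. g (f x))"
  by (rule smooth_on_compose[OF assms(1) open_UNIV _ assms(3) smooth_on_linear[OF open_UNIV assms(2)]]) auto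

lemma smooth_on_Pair:
  fixes f :: "'a::euclidean_space \<Rightarrow> 'b::euclidean_space" and g :: "'a \<Rightarrow> 'c::euclidean_space"
  assumes U: "open U" and f: "smooth_on U f" and g: "smooth_on U g"
  shows "smooth_on U (\<lambda>x. (f x, g x))"
proof -
  have "smooth_on U (\<lambda>x. (f x, 0 :: 'c))" "smooth_on U (\<lambda>x. (0 :: 'b, g x))"
    by (rule smooth_on_linear_compose[OF U _ f, of "\<lambda>y. (y, 0)"]
        smooth_on_linear_compose[OF U _ g, of "\<lambda>y. (0, y)"]; intro bounded_linear_intros)+
  from smooth_on_add[OF U this] show ?thesis by simp
qed

lemmas smooth_on_mult = smooth_on_bilinear[OF _ bounded_bilinear_mult]

lemma smooth_on_inverse:
  fixes f :: "'a::euclidean_space \<Rightarrow> real"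
  assumes "open U" "smooth_on U f" "\<And>x. x \<in> U \<Longrightarrow> f x \<noteq> 0"
  shows "smooth_on U (\<lambda>x. inverse (f x))"
  by (rule smooth_on_compose[OF assms(1) _ _ assms(2), of "- {0}"])
    (use assms(3) Ck_on_inverse in \<open>auto simp: smooth_on_def\<close>)

lemma smooth_on_has_derivative:
  "open U \<Longrightarrow> smooth_on U f \<Longrightarrow> x \<in> U \<Longrightarrow> (f has_derivative frechet_derivative f (at x)) (at x)"
  unfolding smooth_on_def using Ck_on_derivative by blast

lemma smooth_on_frechet_derivative:
  "smooth_on U f \<Longrightarrow> smooth_on U (\<lambda>x. frechet_derivative f (at x) v)"
  unfolding smooth_on_def by (metis Ck_on.simps(2))

lemma smooth_on_continuous: "smooth_on U f \<Longrightarrow> continuous_on U f"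
  unfolding smooth_on_def by (metis Ck_on.simps(1))

lemma smooth_on_symmetric_derivative:
  fixes f :: "'a::euclidean_space \<Rightarrow> real"
  assumes "open U" "x \<in> U" "smooth_on U f"
  shows "frechet_derivative (\<lambda>y. frechet_derivative f (at y) u) (at x) v =
    frechet_derivative (\<lambda>y. frechet_derivative f (at y) v) (at x) u"
  by (rule symmetric_second_derivative[OF assms(1,2), where f = f and f' = "\<lambda>y. frechet_derivative f (at y)"])
    (auto intro: smooth_on_has_derivative[OF assms(1)] smooth_on_frechet_derivative
      smooth_on_continuous assms(3))

text \<open>The Euclidean counterpart of \<open>smooth_fun_on\<close> at one point: an extension off
  P is demanded near u only. For P the coordinate image of a domain with boundary this is smoothness
  up to the boundary.\<close>

definition smooth_germ :: "'a::euclidean_space set \<Rightarrow> 'a \<Rightarrow> ('a \<Rightarrow> 'b::real_normed_vector) \<Rightarrow> bool" where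
  "smooth_germ P u f \<longleftrightarrow> (\<exists>Q h. open Q \<and> u \<in> Q \<and> smooth_on Q h \<and> (\<forall>z\<in>Q \<inter> P. h z = f z))"

lemma smooth_germI:
  "open Q \<Longrightarrow> u \<in> Q \<Longrightarrow> smooth_on Q h \<Longrightarrow> (\<And>z. z \<in> Q \<Longrightarrow> z \<in> P \<Longrightarrow> h z = f z) \<Longrightarrow> smooth_germ P u f"
  unfolding smooth_germ_def by blast

lemma smooth_germE:
  assumes "smooth_germ P u f"
  obtains Q h where "open Q" "u \<in> Q" "smooth_on Q h" "\<And>z. z \<in> Q \<Longrightarrow> z \<in> P \<Longrightarrow> h z = f z"
  using assms unfolding smooth_germ_def by blast

lemma smooth_germ_smooth_on: "open Q \<Longrightarrow> u \<in> Q \<Longrightarrow> smooth_on Q f \<Longrightarrow> smooth_germ P u f"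
  by (rule smooth_germI) auto

text \<open>Only the part of the new set near u has to lie in the old one, so a germ passes between
  a set and its relatively open pieces.\<close>

lemma smooth_germ_transform:
  assumes "smooth_germ P u f" "open Q" "u \<in> Q"
    "\<And>z. z \<in> P' \<Longrightarrow> z \<in> Q \<Longrightarrow> z \<in> P \<and> f z = g z"
  shows "smooth_germ P' u g"
proof -
  obtain Q' h where h: "open Q'" "u \<in> Q'" "smooth_on Q' h" "\<And>z. z \<in> Q' \<Longrightarrow> z \<in> P \<Longrightarrow> h z = f z"
    using assms(1) by (rule smooth_germE) blast
  show ?thesis
  proof (rule smooth_germI)
    show "smooth_on (Q \<inter> Q') h" using h assms smooth_on_subset by blast
  qed (use h assms in auto)
qed

lemma smooth_germ_cong: "smooth_germ P u f \<Longrightarrow> (\<And>z. z \<in> P \<Longrightarrow> f z = g z) \<Longrightarrow> smooth_germ P u g"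
  by (rule smooth_germ_transform[of P u f UNIV]) auto

text \<open>The extension h of f may leave the domain R of the extension of g at points off P; hence
  the cut with the preimage of R. The set N is a neighbourhood in which f is known to map P into
  P'.\<close>

lemma smooth_germ_compose:
  fixes f :: "'a::euclidean_space \<Rightarrow> 'b::euclidean_space" and g :: "'b \<Rightarrow> 'c::real_normed_vector"
  assumes f: "smooth_germ P u f" and g: "smooth_germ P' (f u) g" and u: "u \<in> P"
    and sub: "open N" "u \<in> N" "\<And>z. z \<in> P \<Longrightarrow> z \<in> N \<Longrightarrow> f z \<in> P'"
  shows "smooth_germ P u (\<lambda>z. g (f z))"
proof -
  obtain Q h where h: "open Q" "u \<in> Q" "smooth_on Q h" "\<And>z. z \<in> Q \<Longrightarrow> z \<in> P \<Longrightarrow> h z = f z"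
    using f by (rule smooth_germE) blast
  obtain R k where k: "open R" "f u \<in> R" "smooth_on R k" "\<And>z. z \<in> R \<Longrightarrow> z \<in> P' \<Longrightarrow> k z = g z"
    using g by (rule smooth_germE) blast
  let ?Q = "N \<inter> Q \<inter> (h -` R \<inter> Q)"
  have o: "open ?Q"
    using continuous_open_preimage[OF smooth_on_continuous[OF h(3)] h(1) k(1)] h(1) sub(1)
    by (auto simp: Int_commute)
  show ?thesis
  proof (rule smooth_germI[OF o])
    show "u \<in> ?Q" using h u k sub by auto
    show "smooth_on ?Q (\<lambda>z. k (h z))"
      by (rule smooth_on_compose[OF o k(1) _ smooth_on_subset[OF h(1) o _ h(3)] k(3)]) auto
    show "k (h z) = g (f z)" if "z \<in> ?Q" "z \<in> P" for z
      using that h(4)[of z] k(4) sub(3) by auto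
  qed
qed

lemma smooth_germ_smooth_compose:
  fixes f :: "'a::euclidean_space \<Rightarrow> 'b::euclidean_space" and g :: "'b \<Rightarrow> 'c::real_normed_vector"
  assumes "smooth_germ P u f" "u \<in> P" "smooth_on V g" "open V" "f u \<in> V"
  shows "smooth_germ P u (\<lambda>z. g (f z))"
  by (rule smooth_germ_compose[OF assms(1) smooth_germ_smooth_on[OF assms(4,5,3), of UNIV] assms(2) open_UNIV]) auto

lemma smooth_germ_linear:
  fixes f :: "'a::euclidean_space \<Rightarrow> 'b::euclidean_space" and g :: "'b \<Rightarrow> 'c::real_normed_vector"
  assumes "smooth_germ P u f" "u \<in> P" "bounded_linear g"
  shows "smooth_germ P u (\<lambda>z. g (f z))"
  by (rule smooth_germ_smooth_compose[OF assms(1,2) smooth_on_linear[OF open_UNIV assms(3)]]) auto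

text \<open>The two extensions live on different neighbourhoods; the operation is kept abstract so
  that bilinear maps and pairing share this argument.\<close>

lemma smooth_germ_combine:
  fixes f :: "'a::euclidean_space \<Rightarrow> 'b::real_normed_vector" and g :: "'a \<Rightarrow> 'c::real_normed_vector"
  assumes comb: "\<And>(Q :: 'a set) h k. open Q \<Longrightarrow> smooth_on Q h \<Longrightarrow> smooth_on Q k \<Longrightarrow> smooth_on Q (\<lambda>x. p (h x) (k x))"
    and f: "smooth_germ P u f" and g: "smooth_germ P u g"
  shows "smooth_germ P u (\<lambda>x. p (f x) (g x))"
proof -
  obtain Q h where h: "open Q" "u \<in> Q" "smooth_on Q h" "\<And>z. z \<in> Q \<Longrightarrow> z \<in> P \<Longrightarrow> h z = f z"
    using f by (rule smooth_germE) blast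
  obtain R k where k: "open R" "u \<in> R" "smooth_on R k" "\<And>z. z \<in> R \<Longrightarrow> z \<in> P \<Longrightarrow> k z = g z"
    using g by (rule smooth_germE) blast
  show ?thesis
  proof (rule smooth_germI)
    show o: "open (Q \<inter> R)" using h k by auto
    show "smooth_on (Q \<inter> R) (\<lambda>x. p (h x) (k x))"
      by (rule comb[OF o smooth_on_subset[OF h(1) o _ h(3)] smooth_on_subset[OF k(1) o _ k(3)]]) auto
  qed (use h k in auto)
qed

lemma smooth_germ_bilinear:
  "bounded_bilinear p \<Longrightarrow> smooth_germ P u f \<Longrightarrow> smooth_germ P u g \<Longrightarrow> smooth_germ P u (\<lambda>x. p (f x) (g x))"
  by (rule smooth_germ_combine[where p = p]) (rule smooth_on_bilinear)

lemma smooth_germ_Pair: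
  fixes f :: "'a::euclidean_space \<Rightarrow> 'b::euclidean_space" and g :: "'a \<Rightarrow> 'c::euclidean_space"
  shows "smooth_germ P u f \<Longrightarrow> smooth_germ P u g \<Longrightarrow> smooth_germ P u (\<lambda>x. (f x, g x))"
  by (rule smooth_germ_combine[where p = Pair]) (rule smooth_on_Pair)

lemma smooth_germ_has_derivative:
  assumes "smooth_germ P u f" "u \<in> P"
  obtains D where "(f has_derivative D) (at u within P)"
proof -
  obtain Q h where h: "open Q" "u \<in> Q" "smooth_on Q h" "\<And>z. z \<in> Q \<Longrightarrow> z \<in> P \<Longrightarrow> h z = f z"
    using assms(1) by (rule smooth_germE) blast
  obtain e where e: "e > 0" "ball u e \<subseteq> Q" using h(1,2) open_contains_ball by blast
  have "(h has_derivative frechet_derivative h (at u)) (at u within P)"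
    using smooth_on_has_derivative[OF h(1,3,2)] has_derivative_at_withinI by blast
  from has_derivative_transform_within[OF this e(1) assms(2), of f]
  show ?thesis using that h(4) e(2) by (auto simp: subset_iff dist_commute)
qed

section \<open>Charts and smooth maps\<close>

lemma chart_inv_left: "is_chart c \<Longrightarrow> x \<in> fst c \<Longrightarrow> chart_inv c (snd c x) = x"
  unfolding is_chart_def homeomorphism_def by blast

lemma chart_inv_in: "is_chart c \<Longrightarrow> u \<in> snd c ` fst c \<Longrightarrow> chart_inv c u \<in> fst c"
  by (auto simp: chart_inv_left)

lemma chart_open: "is_chart c \<Longrightarrow> open (fst c)"
  by (simp add: is_chart_def)

lemma chart_continuous: "is_chart c \<Longrightarrow> continuous_on (fst c) (snd c)"
  "is_chart c \<Longrightarrow> continuous_on (snd c ` fst c) (chart_inv c)"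
  by (simp_all add: is_chart_def homeomorphism_def)

lemma chart_image_eq:
  "is_chart c \<Longrightarrow> snd c ` (S \<inter> fst c) = {u \<in> snd c ` fst c. chart_inv c u \<in> S}"
  by (auto simp: chart_inv_left)

lemma chart_image_open:
  assumes "is_chart c" "open U"
  shows "open (snd c ` (U \<inter> fst c))"
proof -
  have "open (snd c ` fst c \<inter> chart_inv c -` U)"
    using assms by (intro continuous_open_preimage chart_continuous) (auto simp: is_chart_def)
  moreover have "snd c ` fst c \<inter> chart_inv c -` U = snd c ` (U \<inter> fst c)"
    using chart_image_eq[OF assms(1)] by auto
  ultimately show ?thesis by simp
qed

lemma chart_preimage_open:
  assumes "is_chart c" "open Q"
  shows "open (fst c \<inter> snd c -` Q)"
  using assms by (intro continuous_open_preimage chart_continuous chart_open)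

lemma atlas_chart: "smooth_atlas A \<Longrightarrow> c \<in> A \<Longrightarrow> is_chart c"
  by (simp add: smooth_atlas_def)

lemma ref_chart: 
  assumes "smooth_atlas A"
  shows "ref_chart A x \<in> A" "x \<in> fst (ref_chart A x)" "is_chart (ref_chart A x)"
proof -
  have "\<exists>c. c \<in> A \<and> x \<in> fst c" using assms unfolding smooth_atlas_def by blast
  from someI_ex[OF this] show "ref_chart A x \<in> A" "x \<in> fst (ref_chart A x)"
    unfolding ref_chart_def by auto
  then show "is_chart (ref_chart A x)" using assms atlas_chart by blast
qed

lemma transition_smooth:
  assumes "smoothly_compatible c d"
  shows "smooth_on (snd c ` (fst c \<inter> fst d)) (\<lambda>u. snd d (chart_inv c u))"
  using assms by (simp add: smoothly_compatible_def o_def)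

lemma transition_open:
  "is_chart c \<Longrightarrow> is_chart d \<Longrightarrow> open (snd c ` (fst c \<inter> fst d))"
  using chart_image_open[of c "fst d"] chart_open by (metis Int_commute)

lemma atlas_compatible:
  "smooth_atlas A \<Longrightarrow> c \<in> A \<Longrightarrow> d \<in> A \<Longrightarrow> smoothly_compatible c d"
  by (simp add: smooth_atlas_def)

abbreviation chart_germ :: "('m, 'e::euclidean_space) chart \<Rightarrow> 'm set \<Rightarrow> 'm \<Rightarrow>
    ('m \<Rightarrow> 'b::real_normed_vector) \<Rightarrow> bool" where
  "chart_germ c S x f \<equiv> smooth_germ (snd c ` (S \<inter> fst c)) (snd c x) (\<lambda>u. f (chart_inv c u))"

lemma smooth_fun_onD:
  assumes "smooth_atlas A" "smooth_fun_on A S f" "x \<in> S" "c \<in> A" "x \<in> fst c"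
  shows "chart_germ c S x f"
proof -
  have c: "is_chart c" using assms atlas_chart by blast
  obtain U h where U: "open U" "x \<in> U" "\<forall>y\<in>U \<inter> S. h y = f y"
    "smooth_on (snd c ` (U \<inter> fst c)) (h \<circ> chart_inv c)"
    using bspec[OF assms(2)[unfolded smooth_fun_on_def] assms(3)] assms(4) by blast
  show ?thesis
    by (rule smooth_germI[OF chart_image_open[OF c U(1)] _ U(4)])
      (use U assms(5) in \<open>auto simp: chart_image_eq[OF c] chart_inv_left[OF c]\<close>)
qed

text \<open>One chart suffices: the extension found there, composed with the coordinates, is smooth
  in all other charts by compatibility.\<close>

lemma smooth_fun_onI:
  assumes A: "smooth_atlas A"
    and germ: "\<And>x. x \<in> S \<Longrightarrow> \<exists>c\<in>A. x \<in> fst c \<and>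
      chart_germ c S x f"
  shows "smooth_fun_on A S f"
  unfolding smooth_fun_on_def
proof
  fix x assume "x \<in> S"
  then obtain c where c: "c \<in> A" "x \<in> fst c"
    "chart_germ c S x f"
    using germ by blast
  have ic: "is_chart c" using A c atlas_chart by blast
  obtain Q h where h: "open Q" "snd c x \<in> Q" "smooth_on Q h"
    "\<And>z. z \<in> Q \<Longrightarrow> z \<in> snd c ` (S \<inter> fst c) \<Longrightarrow> h z = f (chart_inv c z)"
    using c(3) by (rule smooth_germE) blast
  let ?U = "fst c \<inter> snd c -` Q"
  have U: "open ?U" using chart_preimage_open ic h(1) by blast
  show "\<exists>U h. open U \<and> x \<in> U \<and> (\<forall>y\<in>U \<inter> S. h y = f y) \<and>
    (\<forall>c\<in>A. smooth_on (snd c ` (U \<inter> fst c)) (h \<circ> chart_inv c))"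
  proof (intro exI conjI ballI)
    show "open ?U" "x \<in> ?U" using U c h by auto
    show "(h \<circ> snd c) y = f y" if "y \<in> ?U \<inter> S" for y
      using that h(4)[of "snd c y"] by (auto simp: chart_inv_left[OF ic])
    fix d assume d: "d \<in> A"
    have id: "is_chart d" using A d atlas_chart by blast
    have o: "open (snd d ` (?U \<inter> fst d))" by (rule chart_image_open[OF id U])
    have "smooth_on (snd d ` (?U \<inter> fst d)) (\<lambda>u. h (snd c (chart_inv d u)))"
    proof (rule smooth_on_compose[OF o h(1) _ _ h(3)])
      show "(\<lambda>x. snd c (chart_inv d x)) ` snd d ` (?U \<inter> fst d) \<subseteq> Q"
        by (auto simp: chart_inv_left[OF id])
      show "smooth_on (snd d ` (?U \<inter> fst d)) (\<lambda>x. snd c (chart_inv d x))"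
        by (rule smooth_on_subset[OF transition_open[OF id ic] o _
              transition_smooth[OF atlas_compatible[OF A d c(1)]]]) auto
    qed
    then show "smooth_on (snd d ` (?U \<inter> fst d)) (h \<circ> snd c \<circ> chart_inv d)"
      by (simp add: o_def)
  qed
qed

lemma smooth_fun_on_chartsI:
  assumes "smooth_atlas A" "\<And>x c. x \<in> S \<Longrightarrow> c \<in> A \<Longrightarrow> x \<in> fst c \<Longrightarrow>
    chart_germ c S x f"
  shows "smooth_fun_on A S f"
  by (rule smooth_fun_onI[OF assms(1)]) (use ref_chart[OF assms(1)] assms(2) in blast)

lemma smooth_fun_on_subset: "smooth_fun_on A S f \<Longrightarrow> T \<subseteq> S \<Longrightarrow> smooth_fun_on A T f"
  unfolding smooth_fun_on_def
  by (rule ballI, frule (1) subsetD, drule (1) bspec, elim exE conjE, rule exI, rule exI,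
      rule conjI, assumption, rule conjI, assumption, rule conjI[rotated], assumption, blast)

lemma smooth_fun_on_cong:
  "smooth_fun_on A S f \<Longrightarrow> (\<And>x. x \<in> S \<Longrightarrow> f x = g x) \<Longrightarrow> smooth_fun_on A S g"
  unfolding smooth_fun_on_def by (metis Int_iff)

text \<open>The gluing principle for the locally solved corrections: a relatively open piece has the
  same germ at its points as the whole set.\<close>

lemma smooth_fun_on_local:
  assumes A: "smooth_atlas A"
    and loc: "\<And>x. x \<in> S \<Longrightarrow> \<exists>T. openin (top_of_set S) T \<and> x \<in> T \<and> smooth_fun_on A T f"
  shows "smooth_fun_on A S f"
proof (rule smooth_fun_onI[OF A])
  fix x assume x: "x \<in> S"
  then obtain T V where T: "x \<in> T" "smooth_fun_on A T f" "open V" "T = S \<inter> V"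
    using loc openin_open by metis
  let ?c = "ref_chart A x"
  note c = ref_chart[OF A, of x]
  have "chart_germ ?c S x f"
    by (rule smooth_germ_transform[OF smooth_fun_onD[OF A T(2,1) c(1,2)]
          chart_image_open[OF c(3) T(3)]])
      (use T x c in \<open>auto simp: chart_image_eq[OF c(3)] chart_inv_left[OF c(3)]\<close>)
  then show "\<exists>c\<in>A. x \<in> fst c \<and>
      chart_germ c S x f"
    using c by blast
qed

lemma continuous_on_preimage_open:
  assumes "continuous_on S f" "open W"
  shows "\<exists>V. open V \<and> (\<forall>z\<in>S. f z \<in> W \<longleftrightarrow> z \<in> V)"
proof -
  obtain V where "open V" "S \<inter> f -` W = S \<inter> V"
    using continuous_openin_preimage_gen[OF assms] unfolding openin_open by blast
  then show ?thesis by (intro exI[of _ V]) auto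
qed

text \<open>The definition restricts the function to the preimage of \<open>fst d\<close>. By
  continuity that preimage is relatively open, so the restriction does not affect the germ.\<close>

lemma smooth_map_onD:
  assumes "smooth_atlas A" "smooth_atlas B" "smooth_map_on A B S f" "x \<in> S" "c \<in> A" "x \<in> fst c"
    "d \<in> B" "f x \<in> fst d"
  shows "chart_germ c S x (\<lambda>u. snd d (f u))"
proof -
  have c: "is_chart c" and d: "is_chart d" using assms atlas_chart by blast+
  have f: "continuous_on S f" "smooth_fun_on A (S \<inter> f -` fst d) (snd d \<circ> f)"
    using assms by (auto simp: smooth_map_on_def)
  obtain V where V: "open V" "\<forall>z\<in>S. f z \<in> fst d \<longleftrightarrow> z \<in> V"
    using continuous_on_preimage_open[OF f(1) chart_open[OF d]] by blast
  have "smooth_germ (snd c ` ((S \<inter> f -` fst d) \<inter> fst c)) (snd c x) (\<lambda>u. (snd d \<circ> f) (chart_inv c u))"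
    by (rule smooth_fun_onD[OF assms(1) f(2) _ assms(5,6)]) (use assms in auto)
  then show ?thesis
  proof (rule smooth_germ_transform)
    show "open (snd c ` (V \<inter> fst c))" using chart_image_open[OF c V(1)] .
  qed (use V assms in \<open>auto simp: chart_image_eq[OF c] chart_inv_left[OF c]\<close>)
qed

lemma smooth_map_onI:
  assumes "smooth_atlas A" "continuous_on S f"
    and "\<And>x d. x \<in> S \<Longrightarrow> d \<in> B \<Longrightarrow> f x \<in> fst d \<Longrightarrow> \<exists>c\<in>A. x \<in> fst c \<and>
      chart_germ c S x (\<lambda>u. snd d (f u))"
  shows "smooth_map_on A B S f"
  unfolding smooth_map_on_def
proof (intro conjI ballI smooth_fun_onI assms(1))
  fix d x assume "d \<in> B" "x \<in> S \<inter> f -` fst d"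
  then obtain c where c: "c \<in> A" "x \<in> fst c"
      "chart_germ c S x (\<lambda>u. snd d (f u))"
    using assms(3)[of x d] by blast
  moreover have "chart_germ c (S \<inter> f -` fst d) x (snd d \<circ> f)"
    by (rule smooth_germ_transform[OF c(3) open_UNIV]) auto
  ultimately show "\<exists>c\<in>A. x \<in> fst c \<and>
      chart_germ c (S \<inter> f -` fst d) x (snd d \<circ> f)"
    by blast
qed (fact assms(2))

text \<open>In coordinates this is the composite of two coordinate expressions, but the detour
  through \<open>chart_inv d\<close> is the identity only where f lands in the chart; V cuts out
  that region.\<close>

lemma smooth_germ_comp_map:
  assumes A: "smooth_atlas A" and B: "smooth_atlas B" and f: "smooth_map_on A B S f"
    and T: "f ` S \<subseteq> T" and x: "x \<in> S" "c \<in> A" "x \<in> fst c" "d \<in> B" "f x \<in> fst d"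
    and g: "chart_germ d T (f x) g"
  shows "chart_germ c S x (\<lambda>u. g (f u))"
proof -
  have c: "is_chart c" and d: "is_chart d" using A B x atlas_chart by blast+
  obtain V where V: "open V" "\<forall>z\<in>S. f z \<in> fst d \<longleftrightarrow> z \<in> V"
    using continuous_on_preimage_open[OF conjunct1[OF f[unfolded smooth_map_on_def]] chart_open[OF d]]
    by blast
  have "chart_germ c S x (\<lambda>u. g (chart_inv d (snd d (f u))))"
  proof (rule smooth_germ_compose[OF smooth_map_onD[OF A B f x]])
    show "smooth_germ (snd d ` (T \<inter> fst d)) (snd d (f (chart_inv c (snd c x)))) (\<lambda>z. g (chart_inv d z))"
      using g by (simp add: chart_inv_left[OF c x(3)])
    show "open (snd c ` (V \<inter> fst c))" by (rule chart_image_open[OF c V(1)])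
    show "snd d (f (chart_inv c z)) \<in> snd d ` (T \<inter> fst d)"
      if "z \<in> snd c ` (S \<inter> fst c)" "z \<in> snd c ` (V \<inter> fst c)" for z
    proof -
      have "chart_inv c z \<in> S" "chart_inv c z \<in> V" using that by (auto simp: chart_image_eq[OF c])
      then show ?thesis using V(2) T by blast
    qed
  qed (use x V in auto)
  then show ?thesis
  proof (rule smooth_germ_transform)
    show "open (snd c ` (V \<inter> fst c))" by (rule chart_image_open[OF c V(1)])
    show "z \<in> snd c ` (S \<inter> fst c) \<and> g (chart_inv d (snd d (f (chart_inv c z)))) = g (f (chart_inv c z))"
      if z: "z \<in> snd c ` (S \<inter> fst c)" "z \<in> snd c ` (V \<inter> fst c)" for z
    proof -
      have "f (chart_inv c z) \<in> fst d"
        using z V by (auto simp: chart_image_eq[OF c])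
      then show ?thesis using z by (simp add: chart_inv_left[OF d])
    qed
  qed (use x V in auto)
qed

lemma smooth_fun_on_compose:
  assumes A: "smooth_atlas A" and B: "smooth_atlas B" and f: "smooth_map_on A B S f"
    and g: "smooth_fun_on B T g" and T: "f ` S \<subseteq> T"
  shows "smooth_fun_on A S (\<lambda>x. g (f x))"
proof (rule smooth_fun_onI[OF A])
  fix x assume x: "x \<in> S"
  note c = ref_chart[OF A, of x] and d = ref_chart[OF B, of "f x"]
  show "\<exists>c\<in>A. x \<in> fst c \<and>
      chart_germ c S x (\<lambda>u. g (f u))"
    using smooth_germ_comp_map[OF A B f T x c(1,2) d(1,2) smooth_fun_onD[OF B g _ d(1,2)]] T x c
    by blast
qed

lemma smooth_map_on_compose:
  assumes A: "smooth_atlas A" and B: "smooth_atlas B" and C: "smooth_atlas C"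
    and f: "smooth_map_on A B S f"
    and g: "smooth_map_on B C T g" and T: "f ` S \<subseteq> T"
  shows "smooth_map_on A C S (\<lambda>x. g (f x))"
proof (rule smooth_map_onI[OF A])
  show "continuous_on S (\<lambda>x. g (f x))"
    using f g T unfolding smooth_map_on_def by (auto intro: continuous_on_compose2)
  fix x e assume x: "x \<in> S" and e: "e \<in> C" "g (f x) \<in> fst e"
  note c = ref_chart[OF A, of x] and d = ref_chart[OF B, of "f x"]
  have "f x \<in> T" using T x by blast
  then show "\<exists>c\<in>A. x \<in> fst c \<and>
      chart_germ c S x (\<lambda>u. snd e (g (f u)))"
    using smooth_germ_comp_map[OF A B f T x c(1,2) d(1,2) smooth_map_onD[OF B C g _ d(1,2) e]] c
    by blast
qed

lemma smooth_map_on_subset: "smooth_map_on A B S f \<Longrightarrow> T \<subseteq> S \<Longrightarrow> smooth_map_on A B T f"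
  unfolding smooth_map_on_def
  by (meson continuous_on_subset smooth_fun_on_subset Int_mono order_refl)

text \<open>\<open>chart_inv\<close> is built from \<open>inv_into\<close>, so the splitting of the
  inverse of a product chart into components has to be derived; it rests on injectivity of both
  factors on their domains.\<close>

lemma is_chart_product:
  assumes "is_chart c" "is_chart d"
  shows "is_chart (fst c \<times> fst d, map_prod (snd c) (snd d))"
    and "u \<in> snd c ` fst c \<Longrightarrow> v \<in> snd d ` fst d \<Longrightarrow>
      chart_inv (fst c \<times> fst d, map_prod (snd c) (snd d)) (u, v) = (chart_inv c u, chart_inv d v)"
proof -
  let ?p = "(fst c \<times> fst d, map_prod (snd c) (snd d))"
  have inj: "inj_on (snd c) (fst c)" "inj_on (snd d) (fst d)"
    by (metis inj_on_inverseI chart_inv_left assms)+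
  have inv: "chart_inv ?p (u, v) = (chart_inv c u, chart_inv d v)"
    if "u \<in> snd c ` fst c" "v \<in> snd d ` fst d" for u v
    unfolding chart_inv_def[of ?p]
    by (rule inv_into_f_eq)
      (use that inj in \<open>auto simp: map_prod_def inj_on_def chart_inv_left assms split: prod.splits\<close>)
  then show "u \<in> snd c ` fst c \<Longrightarrow> v \<in> snd d ` fst d \<Longrightarrow> chart_inv ?p (u, v) = (chart_inv c u, chart_inv d v)"
    by blast
  have im: "map_prod (snd c) (snd d) ` (fst c \<times> fst d) = snd c ` fst c \<times> snd d ` fst d"
    by auto
  have co: "continuous_on (snd c ` fst c \<times> snd d ` fst d) (chart_inv ?p)"
  proof (rule continuous_on_eq)
    show "continuous_on (snd c ` fst c \<times> snd d ` fst d) (\<lambda>z. (chart_inv c (fst z), chart_inv d (snd z)))"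
      by (intro continuous_on_Pair continuous_on_compose2[OF chart_continuous(2)[OF assms(1)]]
          continuous_on_compose2[OF chart_continuous(2)[OF assms(2)]] continuous_on_fst continuous_on_snd
          continuous_on_id) auto
  qed (auto simp: inv)
  have ci: "continuous_on (fst c \<times> fst d) (map_prod (snd c) (snd d))"
    unfolding map_prod_def split_beta
    by (intro continuous_on_Pair continuous_on_compose2[OF chart_continuous(1)[OF assms(1)]]
          continuous_on_compose2[OF chart_continuous(1)[OF assms(2)]] continuous_on_fst continuous_on_snd
          continuous_on_id) auto
  show "is_chart ?p"
    unfolding is_chart_def fst_conv snd_conv im homeomorphism_def
    using co ci assms
    by (auto intro!: open_Times chart_open simp: inv chart_inv_left image_iff)
      (auto simp: is_chart_def inv chart_inv_left intro!: exI)
qed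

lemma product_atlasE:
  assumes "e \<in> product_atlas A B"
  obtains c d where "e = (fst c \<times> fst d, map_prod (snd c) (snd d))" "c \<in> A" "d \<in> B"
proof -
  obtain q where "e = (case q of (c, d) \<Rightarrow> (fst c \<times> fst d, map_prod (snd c) (snd d)))" "q \<in> A \<times> B"
    using assms unfolding product_atlas_def by blast
  then show thesis using that[of "fst q" "snd q"] by (simp add: split_beta mem_Times_iff)
qed

lemma smooth_atlas_product:
  fixes A :: "('m::topological_space, 'e::euclidean_space) chart set"
    and B :: "('w::topological_space, 'f::euclidean_space) chart set"
  assumes A: "smooth_atlas A" and B: "smooth_atlas B"
  shows "smooth_atlas (product_atlas A B)"
proof -
  let ?p = "\<lambda>c d. (fst c \<times> fst d, map_prod (snd c) (snd d))"
  have comp: "smooth_on (snd (?p c d) ` (fst (?p c d) \<inter> fst (?p c' d'))) (snd (?p c' d') \<circ> chart_inv (?p c d))"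
    if c: "c \<in> A" "c' \<in> A" "d \<in> B" "d' \<in> B" for c c' d d'
  proof -
    have ch: "is_chart c" "is_chart c'" "is_chart d" "is_chart d'"
      using c A B atlas_chart by blast+
    let ?U = "snd c ` (fst c \<inter> fst c')" and ?V = "snd d ` (fst d \<inter> fst d')"
    have U: "open ?U" and V: "open ?V" using transition_open ch by blast+
    have UV: "open (?U \<times> ?V)" using U V open_Times by blast
    have im: "snd (?p c d) ` (fst (?p c d) \<inter> fst (?p c' d')) = ?U \<times> ?V"
      by auto
    have 1: "smooth_on (?U \<times> ?V) (\<lambda>z. snd c' (chart_inv c (fst z)))"
      by (rule smooth_on_compose[OF UV U _ smooth_on_linear[OF UV]
            transition_smooth[OF atlas_compatible[OF A c(1,2)]]])
        (auto intro: bounded_linear_fst)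
    have 2: "smooth_on (?U \<times> ?V) (\<lambda>z. snd d' (chart_inv d (snd z)))"
      by (rule smooth_on_compose[OF UV V _ smooth_on_linear[OF UV]
            transition_smooth[OF atlas_compatible[OF B c(3,4)]]])
        (auto intro: bounded_linear_snd)
    from smooth_on_Pair[OF UV 1 2] show ?thesis
      unfolding im
    proof (rule smooth_on_cong[OF UV])
      fix z assume "z \<in> ?U \<times> ?V"
      then obtain u v where z: "z = (u, v)" "u \<in> ?U" "v \<in> ?V" by auto
      show "(snd c' (chart_inv c (fst z)), snd d' (chart_inv d (snd z))) =
        (snd (?p c' d') \<circ> chart_inv (?p c d)) z"
        unfolding z o_def using z by (subst is_chart_product(2)[OF ch(1,3)]) auto
    qed
  qed
  have "\<Union> (fst ` product_atlas A B) = UNIV"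
  proof -
    have "(x, y) \<in> \<Union> (fst ` product_atlas A B)" for x y
      using ref_chart[OF A, of x] ref_chart[OF B, of y] unfolding product_atlas_def
      by (force intro!: bexI[of _ "ref_chart A x"] bexI[of _ "ref_chart B y"])
    then show ?thesis by auto
  qed
  moreover have "is_chart e" if "e \<in> product_atlas A B" for e
  proof -
    obtain c d where "e = ?p c d" "c \<in> A" "d \<in> B"
      by (rule product_atlasE[OF \<open>e \<in> product_atlas A B\<close>])
    then show ?thesis using is_chart_product(1)[OF atlas_chart[OF A] atlas_chart[OF B]] by simp
  qed
  moreover have "smoothly_compatible e e'" if "e \<in> product_atlas A B" "e' \<in> product_atlas A B" for e e'
  proof -
    obtain c d c' d' where e: "e = ?p c d" "e' = ?p c' d'" "c \<in> A" "c' \<in> A" "d \<in> B" "d' \<in> B"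
      using product_atlasE[OF \<open>e \<in> product_atlas A B\<close>] product_atlasE[OF \<open>e' \<in> product_atlas A B\<close>]
      by metis
    have "fst (?p c d) \<inter> fst (?p c' d') = fst (?p c' d') \<inter> fst (?p c d)" by blast
    then show ?thesis
      using comp[of c c' d d'] comp[of c' c d' d] e unfolding smoothly_compatible_def by simp
  qed
  ultimately show ?thesis unfolding smooth_atlas_def by blast
qed

lemma smooth_atlas_euclidean: "smooth_atlas (euclidean_atlas :: ('e::euclidean_space, 'e) chart set)"
proof -
  have "chart_inv (UNIV, id :: 'e \<Rightarrow> 'e) = id"
    unfolding chart_inv_def by (simp add: inv_id)
  then show ?thesis
    unfolding smooth_atlas_def euclidean_atlas_def is_chart_def smoothly_compatible_def
    by (auto simp: homeomorphism_def intro!: smooth_on_linear bounded_linear_ident[folded id_def] continuous_intros)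
qed

section \<open>Differentials on manifolds and on domains with boundary\<close>

text \<open>
  Derivatives within a set are unique at its thick points. This makes \<open>differential\<close> meaningful
  at boundary points of a regular domain and of its preimage under a submersion, in every chart.
\<close>

definition ray_thick :: "'a::real_normed_vector set \<Rightarrow> 'a \<Rightarrow> bool" where
  "ray_thick P u \<longleftrightarrow> u \<in> P \<and>
    (\<exists>C. span C = UNIV \<and> (\<forall>v\<in>C. \<exists>\<delta>>0. \<forall>t. 0 < t \<longrightarrow> t < \<delta> \<longrightarrow> u + t *\<^sub>R v \<in> P))"

lemma ray_thick_mono:
  assumes "ray_thick P u" "open Q" "u \<in> Q" "P \<inter> Q \<subseteq> P'"
  shows "ray_thick P' u"
proof -
  obtain C where C: "span C = UNIV" "u \<in> P"
    "\<And>v. v \<in> C \<Longrightarrow> \<exists>\<delta>>0. \<forall>t. 0 < t \<longrightarrow> t < \<delta> \<longrightarrow> u + t *\<^sub>R v \<in> P"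
    using assms(1) unfolding ray_thick_def by blast
  obtain e where e: "e > 0" "ball u e \<subseteq> Q" using assms open_contains_ball by blast
  have "\<exists>\<delta>>0. \<forall>t. 0 < t \<longrightarrow> t < \<delta> \<longrightarrow> u + t *\<^sub>R v \<in> P'" if "v \<in> C" for v
  proof -
    obtain \<delta> where \<delta>: "\<delta> > 0" "\<forall>t. 0 < t \<longrightarrow> t < \<delta> \<longrightarrow> u + t *\<^sub>R v \<in> P" using C(3)[OF \<open>v \<in> C\<close>] by blast
    \<comment> \<open>The bound \<open>e / (norm v + 1)\<close> on t keeps the segment in the ball
      around u; the summand 1 covers v = 0.\<close>
    have pos: "norm v + 1 > 0" using norm_ge_zero[of v] by linarith
    have "u + t *\<^sub>R v \<in> P'" if "0 < t" "t < min \<delta> (e / (norm v + 1))" for t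
    proof -
      have "t * norm v \<le> t * (norm v + 1)" using that by simp
      also have "\<dots> < e" using that pos by (simp add: pos_less_divide_eq)
      finally have "u + t *\<^sub>R v \<in> ball u e" using that by (simp add: dist_norm)
      then have "u + t *\<^sub>R v \<in> Q" using e(2) by blast
      moreover have "u + t *\<^sub>R v \<in> P" using \<delta>(2) that by simp
      ultimately show ?thesis using assms(4) by blast
    qed
    then show ?thesis using \<delta> e pos by (intro exI[of _ "min \<delta> (e / (norm v + 1))"]) auto
  qed
  moreover have "u \<in> P'" using C(2) assms by blast
  ultimately show ?thesis using C(1) unfolding ray_thick_def by blast
qed

text \<open>Along each admissible ray the derivative within P restricts to a one-sided derivative at
  0, which is unique; linear maps that agree on a spanning set are equal.\<close>

lemma has_derivative_unique_ray_thick: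
  fixes f :: "'a::real_normed_vector \<Rightarrow> 'b::real_normed_vector"
  assumes P: "ray_thick P u" and D: "(f has_derivative D) (at u within P)"
    and D': "(f has_derivative D') (at u within P)"
  shows "D = D'"
proof -
  obtain C where C: "span C = UNIV" "u \<in> P"
    "\<And>v. v \<in> C \<Longrightarrow> \<exists>\<delta>>0. \<forall>t. 0 < t \<longrightarrow> t < \<delta> \<longrightarrow> u + t *\<^sub>R v \<in> P"
    using P unfolding ray_thick_def by blast
  have eq: "D v = D' v" if "v \<in> C" for v
  proof -
    obtain \<delta> where \<delta>: "\<delta> > 0" "\<forall>t. 0 < t \<longrightarrow> t < \<delta> \<longrightarrow> u + t *\<^sub>R v \<in> P" using C(3)[OF \<open>v \<in> C\<close>] by blast
    have sub: "(\<lambda>t. u + t *\<^sub>R v) ` {0..<\<delta>} \<subseteq> P"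
    proof safe
      fix t assume "t \<in> {0..<\<delta>}"
      then show "u + t *\<^sub>R v \<in> P" using \<delta>(2) C(2) by (cases "t = 0") auto
    qed
    have line: "((\<lambda>t. u + t *\<^sub>R v) has_derivative (\<lambda>t. t *\<^sub>R v)) (at 0 within {0..<\<delta>})"
      by (auto intro!: derivative_eq_intros)
    have der: "((\<lambda>t. f (u + t *\<^sub>R v)) has_vector_derivative E v) (at 0 within {0..<\<delta>})"
      if E: "(f has_derivative E) (at u within P)" for E
    proof -
      have "((\<lambda>t. f (u + t *\<^sub>R v)) has_derivative (\<lambda>t. E (t *\<^sub>R v))) (at 0 within {0..<\<delta>})"
        by (rule has_derivative_in_compose[OF line]) (use has_derivative_subset[OF E sub] in simp)
      then show ?thesis
        by (simp add: has_vector_derivative_def linear_scale[OF has_derivative_linear[OF E]])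
    qed
    have "at (0::real) within {0..<\<delta>} \<noteq> bot"
      using \<delta>(1) by (intro islimpt_iff_eventually[THEN iffD1, THEN contrapos_nn] notI)
        (auto simp: trivial_limit_within islimpt_Ico)
    then show ?thesis
      using vector_derivative_unique_within der[OF D] der[OF D'] by blast
  qed
  show ?thesis
  proof
    fix v
    have "v \<in> span C" using C(1) by simp
    then show "D v = D' v"
      by (rule linear_eq_on_span[OF has_derivative_linear[OF D] has_derivative_linear[OF D'], rotated])
        (rule eq)
  qed
qed

text \<open>Rays whose direction raises \<rho> to first order stay in the set for a short time.
  These directions form an open half space, which spans: add a large multiple of \<open>v1\<close>
  to v to get into it, and take the multiple away again.\<close>

lemma ray_thick_half_space:
  fixes \<rho> :: "'a::real_normed_vector \<Rightarrow> real"
  assumes U: "open U" "u \<in> U" and \<rho>: "(\<rho> has_derivative \<rho>') (at u)" "\<rho>' v0 \<noteq> 0" "\<rho> u \<ge> 0"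
    and sub: "\<And>z. z \<in> U \<Longrightarrow> \<rho> z \<ge> 0 \<Longrightarrow> z \<in> P"
  shows "ray_thick P u"
proof -
  let ?C = "{v. \<rho>' v > 0}"
  have lin: "linear \<rho>'" using \<rho>(1) has_derivative_linear by blast
  define v1 where "v1 = sgn (\<rho>' v0) *\<^sub>R v0"
  have v1: "\<rho>' v1 > 0" using \<rho>(2) by (simp add: v1_def linear_scale[OF lin] sgn_if)
  have "v \<in> span ?C" for v
  proof -
    define s where "s = (\<bar>\<rho>' v\<bar> + 1) / \<rho>' v1"
    have "\<rho>' (v + s *\<^sub>R v1) = \<rho>' v + \<bar>\<rho>' v\<bar> + 1"
      using v1 by (simp add: s_def linear_add[OF lin] linear_scale[OF lin])
    then have "v + s *\<^sub>R v1 \<in> ?C" by simp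
    moreover have "v1 \<in> ?C" using v1 by simp
    ultimately have "(v + s *\<^sub>R v1) - s *\<^sub>R v1 \<in> span ?C"
      by (intro span_diff span_scale span_base)
    then show ?thesis by simp
  qed
  moreover have "\<exists>\<delta>>0. \<forall>t. 0 < t \<longrightarrow> t < \<delta> \<longrightarrow> u + t *\<^sub>R v \<in> P" if v: "v \<in> ?C" for v
  proof -
    have line: "((\<lambda>t. u + t *\<^sub>R v) has_derivative (\<lambda>t. t *\<^sub>R v)) (at 0)"
      by (auto intro!: derivative_eq_intros)
    have "((\<lambda>t. \<rho> (u + t *\<^sub>R v)) has_derivative (\<lambda>t. \<rho>' (t *\<^sub>R v))) (at 0)"
      by (rule has_derivative_compose[OF line]) (use \<rho>(1) in simp)
    then have "((\<lambda>t. \<rho> (u + t *\<^sub>R v)) has_real_derivative \<rho>' v) (at 0)"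
      by (simp add: has_field_derivative_def linear_scale[OF lin] mult_commute_abs)
    from DERIV_pos_inc_right[OF this] v obtain d where d: "d > 0"
        "\<forall>h>0. h < d \<longrightarrow> \<rho> u < \<rho> (u + h *\<^sub>R v)" by auto
    have "open ((\<lambda>t. u + t *\<^sub>R v) -` U)" by (intro open_vimage U continuous_intros)
    then obtain e where e: "e > 0" "ball 0 e \<subseteq> (\<lambda>t. u + t *\<^sub>R v) -` U"
      using U(2) open_contains_ball[of "(\<lambda>t. u + t *\<^sub>R v) -` U"] by force
    have "u + t *\<^sub>R v \<in> P" if "0 < t" "t < min d e" for t
    proof (rule sub)
      show "u + t *\<^sub>R v \<in> U" using that subsetD[OF e(2), of t] by simp
      show "0 \<le> \<rho> (u + t *\<^sub>R v)"
        using that d(2) \<rho>(3) by (metis less_eq_real_def min_less_iff_conj order_trans)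
    qed
    then show ?thesis using d e by (intro exI[of _ "min d e"]) auto
  qed
  ultimately show ?thesis
    unfolding ray_thick_def using U \<rho>(3) sub by (intro conjI exI[of _ ?C]) auto
qed

lemma transition_has_derivative:
  assumes "is_chart c" "is_chart d" "smoothly_compatible c d" "x \<in> fst c" "x \<in> fst d"
  shows "((\<lambda>u. snd d (chart_inv c u)) has_derivative
    frechet_derivative (\<lambda>u. snd d (chart_inv c u)) (at (snd c x))) (at (snd c x))"
  by (rule smooth_on_has_derivative[OF transition_open[OF assms(1,2)] transition_smooth[OF assms(3)]])
    (use assms in auto)

lemma smoothly_compatible_sym: "smoothly_compatible c d \<Longrightarrow> smoothly_compatible d c"
  by (auto simp: smoothly_compatible_def Int_commute)

text \<open>By the chain rule the derivative of the opposite transition map is a right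
  inverse.\<close>

lemma transition_surj:
  assumes "is_chart c" "is_chart d" "smoothly_compatible c d" "x \<in> fst c" "x \<in> fst d"
  shows "surj (frechet_derivative (\<lambda>u. snd d (chart_inv c u)) (at (snd c x)))"
proof -
  let ?K = "frechet_derivative (\<lambda>u. snd d (chart_inv c u)) (at (snd c x))"
  let ?L = "frechet_derivative (\<lambda>u. snd c (chart_inv d u)) (at (snd d x))"
  have "((\<lambda>u. snd d (chart_inv c (snd c (chart_inv d u)))) has_derivative (\<lambda>v. ?K (?L v))) (at (snd d x))"
    by (rule has_derivative_compose[OF
          transition_has_derivative[OF assms(2,1) smoothly_compatible_sym[OF assms(3)] assms(5,4)]])
      (use transition_has_derivative[OF assms] in \<open>simp add: chart_inv_left[OF assms(2,5)]\<close>)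
  then have "((\<lambda>u. u) has_derivative (\<lambda>v. ?K (?L v))) (at (snd d x))"
    by (rule has_derivative_transform_within_open[OF _ transition_open[OF assms(2,1)]])
      (use assms in \<open>auto simp: chart_inv_left\<close>)
  then have "(\<lambda>v. ?K (?L v)) = (\<lambda>v. v)"
    by (rule has_derivative_unique[OF _ has_derivative_ident])
  then show ?thesis by (metis surjI)
qed

lemma has_derivative_change_chart:
  assumes c: "is_chart c" and d: "is_chart d" and cd: "smoothly_compatible c d"
    and x: "x \<in> fst c" "x \<in> fst d" "x \<in> S"
    and D: "((\<lambda>u. F (chart_inv d u)) has_derivative D) (at (snd d x) within snd d ` (S \<inter> fst d))"
  shows "((\<lambda>u. F (chart_inv c u)) has_derivative
      (\<lambda>v. D (frechet_derivative (\<lambda>u. snd d (chart_inv c u)) (at (snd c x)) v)))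
    (at (snd c x) within snd c ` (S \<inter> fst c))"
proof -
  let ?P = "snd c ` (S \<inter> fst c)" and ?N = "snd c ` (fst c \<inter> fst d)"
  have N: "open ?N" "snd c x \<in> ?N" using transition_open[OF c d] x by auto
  \<comment> \<open>The chain rule runs on the overlap of the two charts only, so the filter is
    first localized there.\<close>
  have within: "at (snd c x) within ?P = at (snd c x) within (?P \<inter> ?N)"
    by (rule at_within_nhd[OF N(2,1)]) auto
  have sub: "(\<lambda>u. snd d (chart_inv c u)) ` (?P \<inter> ?N) \<subseteq> snd d ` (S \<inter> fst d)"
  proof (rule image_subsetI)
    fix z assume z: "z \<in> ?P \<inter> ?N"
    have "z \<in> ?P" "z \<in> ?N" using z by auto
    have "chart_inv c z \<in> S" using \<open>z \<in> ?P\<close> by (auto simp: chart_inv_left[OF c])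
    moreover have "chart_inv c z \<in> fst d" using \<open>z \<in> ?N\<close> by (auto simp: chart_inv_left[OF c])
    ultimately show "snd d (chart_inv c z) \<in> snd d ` (S \<inter> fst d)" by blast
  qed
  have "((\<lambda>u. F (chart_inv d (snd d (chart_inv c u)))) has_derivative
      (\<lambda>v. D (frechet_derivative (\<lambda>u. snd d (chart_inv c u)) (at (snd c x)) v)))
    (at (snd c x) within (?P \<inter> ?N))"
    by (rule has_derivative_in_compose[OF has_derivative_at_withinI[OF transition_has_derivative[OF c d cd x(1,2)]]])
      (use has_derivative_subset[OF D sub] in \<open>simp add: chart_inv_left[OF c x(1)]\<close>)
  then have "((\<lambda>u. F (chart_inv c u)) has_derivative
      (\<lambda>v. D (frechet_derivative (\<lambda>u. snd d (chart_inv c u)) (at (snd c x)) v)))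
    (at (snd c x) within (?P \<inter> ?N))"
    by (rule has_derivative_transform[rotated 2])
      (use N x in \<open>auto simp: chart_inv_left[OF c] chart_inv_left[OF d]\<close>)
  then show ?thesis unfolding within .
qed

text \<open>Relational form of \<open>differential\<close>, in the reference chart. The rules of
  calculus hold for it without any uniqueness; \<open>has_diff_differential\<close> turns them into
  equations at thick points.\<close>

definition has_diff :: "('m, 'e::euclidean_space) chart set \<Rightarrow> 'm set \<Rightarrow>
    ('m \<Rightarrow> 'b::real_normed_vector) \<Rightarrow> 'm \<Rightarrow> ('e \<Rightarrow> 'b) \<Rightarrow> bool" where
  "has_diff A S f m D \<longleftrightarrow> ((\<lambda>u. f (chart_inv (ref_chart A m) u)) has_derivative D)
     (at (snd (ref_chart A m) m) within snd (ref_chart A m) ` (S \<inter> fst (ref_chart A m)))"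

text \<open>All charts are quantified because the exterior derivative is computed in one chart at
  points that may have other reference charts.\<close>

definition thick_at :: "('m, 'e::euclidean_space) chart set \<Rightarrow> 'm set \<Rightarrow> 'm \<Rightarrow> bool" where
  "thick_at A S m \<longleftrightarrow> (\<forall>c\<in>A. m \<in> fst c \<longrightarrow> ray_thick (snd c ` (S \<inter> fst c)) (snd c m))"

lemma thick_at_mono:
  assumes "smooth_atlas A" "thick_at A S m" "open U" "m \<in> U" "S \<inter> U \<subseteq> T"
  shows "thick_at A T m"
  unfolding thick_at_def
proof (intro ballI impI)
  fix c assume c: "c \<in> A" "m \<in> fst c"
  have ic: "is_chart c" using assms c atlas_chart by blast
  show "ray_thick (snd c ` (T \<inter> fst c)) (snd c m)"
    by (rule ray_thick_mono[OF _ chart_image_open[OF ic assms(3)]])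
      (use assms c in \<open>auto simp: thick_at_def chart_image_eq[OF ic] chart_inv_left[OF ic]\<close>)
qed

lemma has_diff_differential:
  assumes "smooth_atlas A" "thick_at A S m" "has_diff A S f m D"
  shows "differential A S f m = D"
proof -
  have "ray_thick (snd (ref_chart A m) ` (S \<inter> fst (ref_chart A m))) (snd (ref_chart A m) m)"
    using assms ref_chart[OF assms(1)] unfolding thick_at_def by blast
  moreover have "has_diff A S f m (differential A S f m)"
    using assms(3) unfolding differential_def has_diff_def Let_def o_def
    by (metis differentiableI frechet_derivative_works)
  ultimately show ?thesis
    using assms(3) has_derivative_unique_ray_thick unfolding has_diff_def by blast
qed

lemma smooth_has_diff:
  assumes "smooth_atlas A" "smooth_fun_on A S f" "m \<in> S"
  shows "has_diff A S f m (differential A S f m)"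
proof -
  note c = ref_chart[OF assms(1), of m]
  obtain D where "has_diff A S f m D"
    using smooth_germ_has_derivative[OF smooth_fun_onD[OF assms c(1,2)]] assms(3) c(2)
    unfolding has_diff_def by blast
  then show ?thesis unfolding differential_def has_diff_def Let_def o_def
    by (metis differentiableI frechet_derivative_works)
qed

lemma has_diff_linear: "has_diff A S f m D \<Longrightarrow> linear D"
  unfolding has_diff_def using has_derivative_linear by blast

lemma has_diff_subset: "has_diff A S f m D \<Longrightarrow> T \<subseteq> S \<Longrightarrow> has_diff A T f m D"
  unfolding has_diff_def by (rule has_derivative_subset) auto

text \<open>Derivatives within a set only see the set near the point; this switches between the
  preimages of W' and of its relatively open pieces.\<close>

lemma differential_local:
  assumes A: "smooth_atlas A" and U: "open U" "m \<in> U" and T: "T \<inter> U = S \<inter> U"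
  shows "differential A T f m = differential A S f m"
proof -
  let ?c = "ref_chart A m"
  note c = ref_chart[OF A, of m]
  have eq: "z \<in> T \<longleftrightarrow> z \<in> S" if "z \<in> U" for z using T that by blast
  have "at (snd ?c m) within snd ?c ` (T \<inter> fst ?c) = at (snd ?c m) within snd ?c ` (S \<inter> fst ?c)"
    by (rule at_within_nhd[OF _ chart_image_open[OF c(3) U(1)]])
      (use U c eq in \<open>auto simp: chart_image_eq[OF c(3)] chart_inv_left[OF c(3)]\<close>)
  then show ?thesis unfolding differential_def Let_def by simp
qed

lemma has_diff_transform:
  assumes "smooth_atlas A" "has_diff A S f m D" "m \<in> S" "\<And>x. x \<in> S \<Longrightarrow> f x = g x"
  shows "has_diff A S g m D"
proof -
  note c = ref_chart[OF assms(1), of m]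
  show ?thesis
    using assms(2) unfolding has_diff_def
    by (rule has_derivative_transform[rotated 2])
      (use c assms in \<open>auto simp: chart_inv_left[OF c(3)]\<close>)
qed

text \<open>\<open>D\<close> takes components in the reference chart at m, and
  \<open>coord_vector\<close> converts components in c to those: the chain rule for the transition
  map.\<close>

lemma has_diff_chart:
  assumes A: "smooth_atlas A" and c: "c \<in> A" "m \<in> fst c" "m \<in> S" and f: "has_diff A S f m D"
  shows "((\<lambda>u. f (chart_inv c u)) has_derivative (\<lambda>v. D (coord_vector A c v m)))
    (at (snd c m) within snd c ` (S \<inter> fst c))"
proof -
  note d = ref_chart[OF A, of m]
  show ?thesis
    using has_derivative_change_chart[OF atlas_chart[OF A c(1)] d(3) atlas_compatible[OF A c(1) d(1)] c(2) d(2) c(3)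
        f[unfolded has_diff_def]]
    by (simp add: coord_vector_def o_def)
qed

lemma coord_vector_linear:
  assumes A: "smooth_atlas A" and c: "c \<in> A" "m \<in> fst c"
  shows "linear (\<lambda>v. coord_vector A c v m)"
proof -
  note d = ref_chart[OF A, of m]
  show ?thesis
    using has_derivative_linear[OF transition_has_derivative[OF atlas_chart[OF A c(1)] d(3)
          atlas_compatible[OF A c(1) d(1)] c(2) d(2)]]
    by (simp add: coord_vector_def o_def)
qed

lemma tangent_map_has_derivative:
  assumes A: "smooth_atlas A" and B: "smooth_atlas B" and f: "smooth_map_on A B UNIV f"
  shows "((\<lambda>u. snd (ref_chart B (f m)) (f (chart_inv (ref_chart A m) u))) has_derivative
    tangent_map A B f m) (at (snd (ref_chart A m) m))"
proof -
  let ?a = "ref_chart A m" and ?d = "ref_chart B (f m)"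
  note a = ref_chart[OF A, of m] and d = ref_chart[OF B, of "f m"]
  have o: "open (snd ?a ` (UNIV \<inter> fst ?a))" by (rule chart_image_open[OF a(3) open_UNIV])
  have within: "at (snd ?a m) within snd ?a ` (UNIV \<inter> fst ?a) = at (snd ?a m)"
    using a by (intro at_within_open o) auto
  obtain D where "((\<lambda>u. snd ?d (f (chart_inv ?a u))) has_derivative D) (at (snd ?a m))"
    using smooth_germ_has_derivative[OF smooth_map_onD[OF A B f UNIV_I a(1,2) d(1,2)]] a(2)
    unfolding within by blast
  then show ?thesis
    unfolding tangent_map_def differential_def Let_def within o_def
    by (metis differentiableI frechet_derivative_works)
qed

lemma has_diff_pullback:
  assumes A: "smooth_atlas A" and B: "smooth_atlas B" and f: "smooth_map_on A B UNIV f"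
    and m: "m \<in> f -` V" and g: "has_diff B V g (f m) D"
  shows "has_diff A (f -` V) (\<lambda>x. g (f x)) m (\<lambda>v. D (tangent_map A B f m v))"
proof -
  let ?a = "ref_chart A m" and ?d = "ref_chart B (f m)"
  note a = ref_chart[OF A, of m] and d = ref_chart[OF B, of "f m"]
  let ?P = "snd ?a ` (f -` V \<inter> fst ?a)" and ?N = "snd ?a ` (f -` fst ?d \<inter> fst ?a)"
  have "open (f -` fst ?d)"
    using f chart_open[OF d(3)] by (auto simp: smooth_map_on_def intro: open_vimage)
  then have N: "open ?N" "snd ?a m \<in> ?N" using chart_image_open[OF a(3)] a d by auto
  have within: "at (snd ?a m) within ?P = at (snd ?a m) within (?P \<inter> ?N)"
    by (rule at_within_nhd[OF N(2,1)]) auto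
  have sub: "(\<lambda>u. snd ?d (f (chart_inv ?a u))) ` (?P \<inter> ?N) \<subseteq> snd ?d ` (V \<inter> fst ?d)"
    using chart_image_eq[OF a(3)] by auto
  have "((\<lambda>u. g (chart_inv ?d (snd ?d (f (chart_inv ?a u))))) has_derivative
      (\<lambda>v. D (tangent_map A B f m v))) (at (snd ?a m) within (?P \<inter> ?N))"
    by (rule has_derivative_in_compose[OF has_derivative_at_withinI[OF tangent_map_has_derivative[OF A B f]]])
      (use has_derivative_subset[OF g[unfolded has_diff_def] sub] a in \<open>simp add: chart_inv_left[OF a(3)]\<close>)
  then have "((\<lambda>u. g (f (chart_inv ?a u))) has_derivative
      (\<lambda>v. D (tangent_map A B f m v))) (at (snd ?a m) within (?P \<inter> ?N))"
    by (rule has_derivative_transform[rotated 2])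
      (use N m a in \<open>auto simp: chart_inv_left[OF a(3)] chart_inv_left[OF d(3)] chart_image_eq[OF a(3)]\<close>)
  then show ?thesis unfolding within has_diff_def .
qed

text \<open>Near \<open>f m\<close> the domain is a half space in some chart. Its defining
  coordinate pulled back by f has nonzero derivative at m because f is submersive there, so the
  preimage is again cut out locally by one inequality.\<close>

lemma regular_domain_thick_at:
  assumes A: "smooth_atlas A" and B: "smooth_atlas B" and f: "smooth_map_on A B UNIV f"
    and surj: "surj (tangent_map A B f m)" and S: "regular_domain B S" and m: "m \<in> f -` S"
  shows "thick_at A (f -` S) m"
  unfolding thick_at_def
proof (intro ballI impI)
  fix a assume a: "a \<in> A" "m \<in> fst a"
  have ia: "is_chart a" using A a atlas_chart by blast
  let ?a = "ref_chart A m" and ?d = "ref_chart B (f m)"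
  note a' = ref_chart[OF A, of m] and d = ref_chart[OF B, of "f m"]
  obtain c b where c: "c \<in> maximal_atlas B" "f m \<in> fst c" and b: "b \<in> Basis"
    and eq: "snd c ` (S \<inter> fst c) = snd c ` fst c \<inter> {u. 0 \<le> u \<bullet> b}"
    using S m unfolding regular_domain_def by blast
  have ic: "is_chart c" and comp: "smoothly_compatible ?d c"
    using c d smoothly_compatible_sym[of c ?d] unfolding maximal_atlas_def by auto
  let ?L = "frechet_derivative (\<lambda>u. snd c (chart_inv ?d u)) (at (snd ?d (f m)))"
  let ?K = "frechet_derivative (\<lambda>u. snd ?a (chart_inv a u)) (at (snd a m))"
  have L: "((\<lambda>u. snd c (chart_inv ?d u)) has_derivative ?L) (at (snd ?d (f m)))" "surj ?L"
    using transition_has_derivative[OF d(3) ic comp d(2) c(2)] transition_surj[OF d(3) ic comp d(2) c(2)]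
    by auto
  note K = transition_has_derivative[OF ia a'(3) atlas_compatible[OF A a(1) a'(1)] a(2) a'(2)]
    transition_surj[OF ia a'(3) atlas_compatible[OF A a(1) a'(1)] a(2) a'(2)]
  note T = tangent_map_has_derivative[OF A B f, of m]
  let ?D = "\<lambda>v. ?L (tangent_map A B f m (?K v))"
  have comp_der: "((\<lambda>u. snd c (chart_inv ?d (snd ?d (f (chart_inv ?a (snd ?a (chart_inv a u))))))) has_derivative ?D)
    (at (snd a m))"
    by (rule has_derivative_compose[OF has_derivative_compose[OF K(1)]])
      (use T L in \<open>simp_all add: chart_inv_left[OF ia a(2)] chart_inv_left[OF a'(3) a'(2)]\<close>)
  have oc: "open (f -` fst c)" "open (f -` fst ?d)"
    using f chart_open[OF d(3)] chart_open[OF ic] by (auto simp: smooth_map_on_def intro: open_vimage)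
  have od: "open (snd a ` ((f -` fst ?d \<inter> fst ?a) \<inter> fst a))"
    using chart_image_open[OF ia] oc chart_open[OF a'(3)] by blast
  have D: "((\<lambda>u. snd c (f (chart_inv a u))) has_derivative ?D) (at (snd a m))"
    by (rule has_derivative_transform_within_open[OF comp_der od])
      (use a a' d in \<open>auto simp: chart_inv_left[OF ia] chart_inv_left[OF a'(3)] chart_inv_left[OF d(3)]\<close>)
  have "surj ?D" using comp_surj[OF comp_surj[OF K(2) surj] L(2)] by (simp add: o_def)
  \<comment> \<open>A direction whose image is the inner normal b gives the pulled back coordinate
    the slope \<open>b \<bullet> b\<close>, which is not 0.\<close>
  then obtain v0 where v0: "?D v0 = b" unfolding surj_def by metis
  show "ray_thick (snd a ` (f -` S \<inter> fst a)) (snd a m)"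
  proof (rule ray_thick_half_space[where \<rho> = "\<lambda>u. snd c (f (chart_inv a u)) \<bullet> b"])
    show "open (snd a ` (f -` fst c \<inter> fst a))" by (rule chart_image_open[OF ia oc(1)])
    show "snd a m \<in> snd a ` (f -` fst c \<inter> fst a)" using a c by auto
    show "((\<lambda>u. snd c (f (chart_inv a u)) \<bullet> b) has_derivative (\<lambda>v. ?D v \<bullet> b)) (at (snd a m))"
      by (rule has_derivative_inner_left[OF D])
    show "?D v0 \<bullet> b \<noteq> 0" using v0 b by simp
    have "snd c (f m) \<in> snd c ` (S \<inter> fst c)" using m c by auto
    then show "0 \<le> snd c (f (chart_inv a (snd a m))) \<bullet> b"
      unfolding eq by (simp add: chart_inv_left[OF ia a(2)])
    fix z assume z: "z \<in> snd a ` (f -` fst c \<inter> fst a)" "0 \<le> snd c (f (chart_inv a z)) \<bullet> b"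
    then obtain x where x: "z = snd a x" "x \<in> fst a" "f x \<in> fst c" by auto
    then have "snd c (f x) \<in> snd c ` (S \<inter> fst c)"
      unfolding eq using z(2) by (simp add: chart_inv_left[OF ia])
    then obtain w where "w \<in> S" "w \<in> fst c" "snd c w = snd c (f x)" by auto
    then have "f x \<in> S" using chart_inv_left[OF ic] x(3) by metis
    then show "z \<in> snd a ` (f -` S \<inter> fst a)" using x by auto
  qed
qed

text \<open>The curve remains in S on both sides of 0, so the derivative is two-sided even if m is a
  boundary point of S. Curves inside a fibre have this property.\<close>

lemma has_diff_along_curve:
  assumes A: "smooth_atlas A" and F: "has_diff A S F m D" and \<gamma>: "\<gamma> 0 = m" "\<epsilon> > 0"
    "\<And>t. \<bar>t\<bar> < \<epsilon> \<Longrightarrow> \<gamma> t \<in> S \<inter> fst (ref_chart A m)"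
    and \<xi>: "((\<lambda>t. snd (ref_chart A m) (\<gamma> t)) has_vector_derivative \<xi>) (at 0)"
  shows "((\<lambda>t. F (\<gamma> t)) has_vector_derivative D \<xi>) (at 0)"
proof -
  let ?c = "ref_chart A m" and ?B = "ball (0::real) \<epsilon>"
  note c = ref_chart[OF A, of m]
  have sub: "(\<lambda>t. snd ?c (\<gamma> t)) ` ?B \<subseteq> snd ?c ` (S \<inter> fst ?c)"
    using \<gamma>(3) by (auto simp: dist_real_def)
  have "((\<lambda>t. F (chart_inv ?c (snd ?c (\<gamma> t)))) has_derivative (\<lambda>t. D (t *\<^sub>R \<xi>))) (at 0 within ?B)"
    by (rule has_derivative_in_compose[OF has_derivative_at_withinI[OF \<xi>[unfolded has_vector_derivative_def]]])
      (use has_derivative_subset[OF F[unfolded has_diff_def] sub] in \<open>simp add: \<gamma>\<close>)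
  then have "((\<lambda>t. F (\<gamma> t)) has_derivative (\<lambda>t. D (t *\<^sub>R \<xi>))) (at 0 within ?B)"
    by (rule has_derivative_transform[rotated 2]) (use \<gamma> in \<open>auto simp: chart_inv_left[OF c(3)] dist_real_def\<close>)
  then show ?thesis
    using \<gamma>(2) at_within_open[of "0::real" ?B]
    by (simp add: has_vector_derivative_def linear_scale[OF has_diff_linear[OF F]])
qed

section \<open>Linearity of forms in components, and the exterior derivative of a sum of terms F
  dG\<close>

lemma form_comp_linear:
  assumes "smooth_atlas A" "smooth_one_form A \<alpha>" "c \<in> A" "z \<in> snd c ` fst c"
  shows "linear (form_comp A c \<alpha> z)"
proof -
  have "linear (\<lambda>v. coord_vector A c v (chart_inv c z))"
    using coord_vector_linear assms chart_inv_in atlas_chart by blast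
  moreover have "linear (\<alpha> (chart_inv c z))" using assms(2) by (simp add: smooth_one_form_def)
  moreover have "form_comp A c \<alpha> z = \<alpha> (chart_inv c z) \<circ> (\<lambda>v. coord_vector A c v (chart_inv c z))"
    by (auto simp: form_comp_def Let_def)
  ultimately show ?thesis by (simp add: linear_compose)
qed

lemma form_comp_has_derivative:
  assumes "smooth_atlas A" "smooth_one_form A \<alpha>" "c \<in> A" "x \<in> fst c"
  shows "((\<lambda>z. form_comp A c \<alpha> z v) has_derivative
    frechet_derivative (\<lambda>z. form_comp A c \<alpha> z v) (at (snd c x))) (at (snd c x))"
  by (rule smooth_on_has_derivative[of "snd c ` fst c"])
    (use assms atlas_chart[OF assms(1,3), unfolded is_chart_def] in \<open>auto simp: smooth_one_form_def\<close>)

text \<open>Linearity in the slot under the derivative holds because the form is linear at every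
  nearby point and derivatives are unique; in the other slot it is linearity of a
  derivative.\<close>

lemma ext_deriv_bilinear:
  assumes A: "smooth_atlas A" and \<alpha>: "smooth_one_form A \<alpha>"
  shows "linear (\<lambda>u. ext_deriv A \<alpha> x u v)" "linear (\<lambda>v. ext_deriv A \<alpha> x u v)"
proof -
  let ?c = "ref_chart A x"
  note c = ref_chart[OF A, of x]
  let ?D = "\<lambda>v. frechet_derivative (\<lambda>z. form_comp A ?c \<alpha> z v) (at (snd ?c x))"
  note der = form_comp_has_derivative[OF A \<alpha> c(1,2)]
  have 1: "linear (?D v)" for v using der has_derivative_linear by blast
  have o: "open (snd ?c ` fst ?c)" "snd ?c x \<in> snd ?c ` fst ?c" using c by (auto simp: is_chart_def)
  note lin = form_comp_linear[OF A \<alpha> c(1)]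
  have 2: "linear (\<lambda>v. ?D v u)" for u
  proof
    fix v w and r :: real
    have "((\<lambda>z. form_comp A ?c \<alpha> z (v + w)) has_derivative (\<lambda>u. ?D v u + ?D w u)) (at (snd ?c x))"
      by (rule has_derivative_transform_within_open[OF has_derivative_add[OF der der] o])
        (simp add: linear_add[OF lin])
    from has_derivative_unique[OF der this] show "?D (v + w) u = ?D v u + ?D w u"
      by (rule fun_cong)
    have "((\<lambda>z. form_comp A ?c \<alpha> z (r *\<^sub>R v)) has_derivative (\<lambda>u. r *\<^sub>R ?D v u)) (at (snd ?c x))"
      by (rule has_derivative_transform_within_open[OF has_derivative_scaleR_right[OF der] o])
        (simp add: linear_scale[OF lin])
    from has_derivative_unique[OF der this] show "?D (r *\<^sub>R v) u = r *\<^sub>R ?D v u"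
      by (rule fun_cong)
  qed
  show "linear (\<lambda>u. ext_deriv A \<alpha> x u v)" "linear (\<lambda>v. ext_deriv A \<alpha> x u v)"
    unfolding ext_deriv_def Let_def using 1 2 linear_compose_sub by blast+
qed

lemma smooth_germ_common:
  assumes "finite I" "\<And>i. i \<in> I \<Longrightarrow> smooth_germ P u (f i)"
  obtains Q h where "open Q" "u \<in> Q" "\<And>i. i \<in> I \<Longrightarrow> smooth_on Q (h i)"
    "\<And>i z. i \<in> I \<Longrightarrow> z \<in> Q \<Longrightarrow> z \<in> P \<Longrightarrow> h i z = f i z"
proof -
  have "\<exists>Q h. open Q \<and> u \<in> Q \<and> smooth_on Q h \<and> (\<forall>z\<in>Q \<inter> P. h z = f i z)" if "i \<in> I" for i
    using assms(2)[OF that] by (simp add: smooth_germ_def)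
  then obtain Q h where Q: "\<And>i. i \<in> I \<Longrightarrow> open (Q i) \<and> u \<in> Q i \<and> smooth_on (Q i) (h i) \<and>
      (\<forall>z\<in>Q i \<inter> P. h i z = f i z)" by metis
  let ?Q = "\<Inter>i\<in>I. Q i"
  have o: "open ?Q" using assms(1) Q by blast
  show thesis
  proof (rule that[OF o])
    show "smooth_on ?Q (h i)" if "i \<in> I" for i
    proof (rule smooth_on_subset[OF _ o])
      show "open (Q i)" "smooth_on (Q i) (h i)" using Q[OF that] by auto
    qed (use that in blast)
  qed (use Q in auto)
qed

text \<open>At a thick point every smooth extension of the coordinate expression has the same
  derivative. Extensions live on open sets, so second derivatives become available.\<close>

lemma differential_extension:
  assumes A: "smooth_atlas A" and S: "thick_at A S m" and c: "c \<in> A" "m \<in> fst c" "m \<in> S"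
    and G: "smooth_fun_on A S G"
    and g: "open Q" "snd c m \<in> Q" "smooth_on Q g"
      "\<And>z. z \<in> Q \<Longrightarrow> z \<in> snd c ` (S \<inter> fst c) \<Longrightarrow> g z = G (chart_inv c z)"
  shows "differential A S G m (coord_vector A c v m) = frechet_derivative g (at (snd c m)) v"
proof -
  obtain e where e: "e > 0" "ball (snd c m) e \<subseteq> Q" using g(1,2) open_contains_ball by blast
  have "((\<lambda>u. G (chart_inv c u)) has_derivative frechet_derivative g (at (snd c m)))
      (at (snd c m) within snd c ` (S \<inter> fst c))"
    by (rule has_derivative_transform_within[OF
          has_derivative_at_withinI[OF smooth_on_has_derivative[OF g(1,3,2)]] e(1)])
      (use c g(4) e(2) in \<open>auto simp: subset_iff dist_commute\<close>)
  moreover have "ray_thick (snd c ` (S \<inter> fst c)) (snd c m)"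
    using S c by (simp add: thick_at_def)
  ultimately have "(\<lambda>v. differential A S G m (coord_vector A c v m)) = frechet_derivative g (at (snd c m))"
    using has_derivative_unique_ray_thick has_diff_chart[OF A c smooth_has_diff[OF A G c(3)]] by blast
  then show ?thesis by metis
qed

lemma coord_vector_ref_chart:
  assumes A: "smooth_atlas A"
  shows "coord_vector A (ref_chart A x) v x = v"
proof -
  let ?c = "ref_chart A x"
  note c = ref_chart[OF A, of x]
  have "((\<lambda>u. snd ?c (chart_inv ?c u)) has_derivative (\<lambda>v. v)) (at (snd ?c x))"
    by (rule has_derivative_transform_within_open[OF has_derivative_ident, of "snd ?c ` fst ?c"])
      (use c in \<open>auto simp: is_chart_def chart_inv_left[OF c(3)]\<close>)
  then show ?thesis
    using frechet_derivative_at[of "\<lambda>u. snd ?c (chart_inv ?c u)"] unfolding coord_vector_def o_def by metis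
qed

text \<open>The formula d(\<Sum> F dG) = \<Sum> dF \<and> dG, valid up to the boundary. All F and G
  are extended in coordinates near the point; the second derivatives of the extensions of G cancel
  by symmetry.\<close>

lemma ext_deriv_local_sum:
  fixes \<alpha> :: "'m::topological_space \<Rightarrow> 'e::euclidean_space \<Rightarrow> real"
  assumes A: "smooth_atlas A" and \<alpha>: "smooth_one_form A \<alpha>"
    and S: "\<And>m. m \<in> S \<Longrightarrow> thick_at A S m" and I: "finite I"
    and F: "\<And>i. i \<in> I \<Longrightarrow> smooth_fun_on A S (F i)" and G: "\<And>i. i \<in> I \<Longrightarrow> smooth_fun_on A S (G i)"
    and eq: "\<And>m v. m \<in> S \<Longrightarrow> \<alpha> m v = (\<Sum>i\<in>I. F i m * differential A S (G i) m v)"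
    and x: "x \<in> S"
  shows "ext_deriv A \<alpha> x u v = (\<Sum>i\<in>I.
    differential A S (F i) x u * differential A S (G i) x v -
    differential A S (F i) x v * differential A S (G i) x u)"
proof -
  let ?c = "ref_chart A x" and ?z = "snd (ref_chart A x) x"
  note c = ref_chart[OF A, of x]
  let ?P = "snd ?c ` (S \<inter> fst ?c)"
  obtain Q f where f: "open Q" "?z \<in> Q" "\<And>i. i \<in> I \<Longrightarrow> smooth_on Q (f i)"
    "\<And>i z. i \<in> I \<Longrightarrow> z \<in> Q \<Longrightarrow> z \<in> ?P \<Longrightarrow> f i z = F i (chart_inv ?c z)"
    by (rule smooth_germ_common[OF I, of ?P ?z "\<lambda>i u. F i (chart_inv ?c u)"])
      (rule smooth_fun_onD[OF A F x c(1,2)], assumption, rule that, assumption+)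
  obtain R g where g: "open R" "?z \<in> R" "\<And>i. i \<in> I \<Longrightarrow> smooth_on R (g i)"
    "\<And>i z. i \<in> I \<Longrightarrow> z \<in> R \<Longrightarrow> z \<in> ?P \<Longrightarrow> g i z = G i (chart_inv ?c z)"
    by (rule smooth_germ_common[OF I, of ?P ?z "\<lambda>i u. G i (chart_inv ?c u)"])
      (rule smooth_fun_onD[OF A G x c(1,2)], assumption, rule that, assumption+)
  let ?g' = "\<lambda>i z. frechet_derivative (g i) (at z)" and ?f' = "\<lambda>i z. frechet_derivative (f i) (at z)"
  have comp: "form_comp A ?c \<alpha> z v = (\<Sum>i\<in>I. f i z * ?g' i z v)" if z: "z \<in> Q \<inter> R" "z \<in> ?P" for z v
  proof -
    have m: "chart_inv ?c z \<in> S" "chart_inv ?c z \<in> fst ?c" "snd ?c (chart_inv ?c z) = z"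
      using z(2) by (auto simp: chart_inv_left[OF c(3)])
    have "differential A S (G i) (chart_inv ?c z) (coord_vector A ?c v (chart_inv ?c z)) = ?g' i z v"
      if "i \<in> I" for i
      using differential_extension[OF A S[OF m(1)] c(1) m(2,1) G[OF that] g(1) _ g(3)[OF that] g(4)[OF that]]
        z by (simp add: m(3))
    then show ?thesis
      unfolding form_comp_def Let_def eq[OF m(1)] using f(4) z by (intro sum.cong) auto
  qed
  have der: "frechet_derivative (\<lambda>z. form_comp A ?c \<alpha> z v) (at ?z) u =
    (\<Sum>i\<in>I. f i ?z * frechet_derivative (\<lambda>z. ?g' i z v) (at ?z) u + ?f' i ?z u * ?g' i ?z v)" for u v
  proof -
    have zP: "?z \<in> ?P" using x c by auto
    obtain e where e: "e > 0" "ball ?z e \<subseteq> Q \<inter> R"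
      using f(1,2) g(1,2) open_contains_ball[of "Q \<inter> R"] by blast
    have "((\<lambda>z. \<Sum>i\<in>I. f i z * ?g' i z v) has_derivative
      (\<lambda>u. \<Sum>i\<in>I. f i ?z * frechet_derivative (\<lambda>z. ?g' i z v) (at ?z) u + ?f' i ?z u * ?g' i ?z v)) (at ?z)"
      by (intro has_derivative_sum has_derivative_mult
          smooth_on_has_derivative[OF f(1) f(3) f(2)] smooth_on_has_derivative[OF g(1) _ g(2)]
          smooth_on_frechet_derivative g(3))
    \<comment> \<open>The formula for the components of \<alpha> is known on \<open>?P\<close> only,
      whereas \<open>ext_deriv\<close> uses the full derivative. Both are derivatives within
      \<open>?P\<close>, and \<open>?z\<close> is a thick point of it.\<close>
    then have "((\<lambda>z. form_comp A ?c \<alpha> z v) has_derivative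
      (\<lambda>u. \<Sum>i\<in>I. f i ?z * frechet_derivative (\<lambda>z. ?g' i z v) (at ?z) u + ?f' i ?z u * ?g' i ?z v))
      (at ?z within ?P)"
      by (rule has_derivative_transform_within[OF has_derivative_at_withinI e(1) zP])
        (use comp e(2) in \<open>auto simp: subset_iff dist_commute\<close>)
    moreover have "ray_thick ?P ?z" using S[OF x] c unfolding thick_at_def by blast
    ultimately show ?thesis
      using has_derivative_unique_ray_thick[OF _ has_derivative_at_withinI[OF
          form_comp_has_derivative[OF A \<alpha> c(1,2)]], THEN fun_cong] by blast
  qed
  have sym: "frechet_derivative (\<lambda>z. ?g' i z v) (at ?z) u = frechet_derivative (\<lambda>z. ?g' i z u) (at ?z) v"
    if "i \<in> I" for i
    using smooth_on_symmetric_derivative[OF g(1,2) g(3)[OF that]] by metis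
  have g': "differential A S (G i) x w = ?g' i ?z w" if "i \<in> I" for i w
    using differential_extension[OF A S[OF x] c(1,2) x G[OF that] g(1,2) g(3)[OF that] g(4)[OF that], of w]
    by (simp add: coord_vector_ref_chart[OF A])
  have f': "differential A S (F i) x w = ?f' i ?z w" if "i \<in> I" for i w
    using differential_extension[OF A S[OF x] c(1,2) x F[OF that] f(1,2) f(3)[OF that] f(4)[OF that], of w]
    by (simp add: coord_vector_ref_chart[OF A])
  show ?thesis
    unfolding ext_deriv_def Let_def der sum_subtractf[symmetric]
    by (intro sum.cong) (auto simp: g' f' sym)
qed

section \<open>Contact forms have no kernel\<close>

text \<open>Phrased for families, not sets, as the vectors fed to a form may repeat; a repetition
  gives the relation with coefficients 1 and -1.\<close>

lemma finite_family_dependent: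
  fixes v :: "'i \<Rightarrow> 'a::euclidean_space"
  assumes "finite I" "card I > DIM('a)"
  obtains c where "\<exists>i\<in>I. c i \<noteq> 0" "(\<Sum>i\<in>I. c i *\<^sub>R v i) = 0"
proof (cases "inj_on v I")
  case True
  have "dependent (v ` I)"
    using assms True by (intro dependent_biggerset) (auto simp: card_image)
  then obtain u where u: "\<exists>x\<in>v ` I. u x \<noteq> 0" "(\<Sum>x\<in>v ` I. u x *\<^sub>R x) = 0"
    using dependent_finite[of "v ` I"] assms(1) by auto
  show ?thesis
    by (rule that[of "\<lambda>i. u (v i)"]) (use u True in \<open>auto simp: sum.reindex\<close>)
next
  case False
  then obtain i j where ij: "i \<in> I" "j \<in> I" "i \<noteq> j" "v i = v j" by (auto simp: inj_on_def)
  show ?thesis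
  proof (rule that[of "\<lambda>k. if k = i then 1 else if k = j then - 1 else 0"])
    have "(\<Sum>k\<in>I. (if k = i then 1 else if k = j then - 1 else 0) *\<^sub>R v k) =
      (\<Sum>k\<in>I. (if k = i then v k else 0) - (if k = j then v k else 0))"
      using ij by (intro sum.cong) auto
    also have "\<dots> = 0" using ij assms(1) by (simp add: sum_subtractf)
    finally show "(\<Sum>k\<in>I. (if k = i then 1 else if k = j then - 1 else 0) *\<^sub>R v k) = 0" .
  qed (use ij in auto)
qed

text \<open>A k-form takes an infinite sequence of vectors; the second clause says that the entries
  from k on are ignored.\<close>

definition multilinear_form :: "nat \<Rightarrow> ((nat \<Rightarrow> 'v::real_vector) \<Rightarrow> real) \<Rightarrow> bool" where
  "multilinear_form k \<phi> \<longleftrightarrow> (\<forall>w. \<forall>i<k. linear (\<lambda>v. \<phi> (w(i := v)))) \<and>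
     (\<forall>w w'. (\<forall>i<k. w i = w' i) \<longrightarrow> \<phi> w = \<phi> w')"

definition form_kernel :: "nat \<Rightarrow> ((nat \<Rightarrow> 'v) \<Rightarrow> real) \<Rightarrow> 'v set" where
  "form_kernel k \<phi> = {z. \<forall>w. \<forall>i<k. \<phi> (w(i := z)) = 0}"

lemma multilinear_formD:
  assumes "multilinear_form k \<phi>"
  shows "i < k \<Longrightarrow> linear (\<lambda>v. \<phi> (w(i := v)))" "(\<And>i. i < k \<Longrightarrow> w i = w' i) \<Longrightarrow> \<phi> w = \<phi> w'"
  using assms unfolding multilinear_form_def by blast+

text \<open>Slot i of w moves to position \<open>inv \<sigma> i\<close> of the permuted sequence,
  hence into \<phi> if that is below k, and otherwise into \<psi>, shifted by k. So each summand of
  the wedge depends on \<open>w i\<close> through one factor only.\<close>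

lemma wedge_update:
  assumes \<sigma>: "\<sigma> permutes {..<k + l}" and \<phi>: "multilinear_form k \<phi>"
  shows "inv \<sigma> i < k \<Longrightarrow>
      \<phi> (\<lambda>j. (w(i := v)) (\<sigma> j)) * \<psi> (\<lambda>j. (w(i := v)) (\<sigma> (k + j))) =
      \<phi> ((\<lambda>j. w (\<sigma> j))(inv \<sigma> i := v)) * \<psi> (\<lambda>j. w (\<sigma> (k + j)))"
    and "\<not> inv \<sigma> i < k \<Longrightarrow>
      \<phi> (\<lambda>j. (w(i := v)) (\<sigma> j)) * \<psi> (\<lambda>j. (w(i := v)) (\<sigma> (k + j))) =
      \<phi> (\<lambda>j. w (\<sigma> j)) * \<psi> ((\<lambda>j. w (\<sigma> (k + j)))(inv \<sigma> i - k := v))"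
proof -
  have eq: "\<sigma> j = i \<longleftrightarrow> j = inv \<sigma> i" for j
    using permutes_inverses[OF \<sigma>] by metis
  have 1: "(\<lambda>j. (w(i := v)) (\<sigma> j)) = (\<lambda>j. w (\<sigma> j))(inv \<sigma> i := v)"
    by (auto simp: eq)
  show "\<phi> (\<lambda>j. (w(i := v)) (\<sigma> j)) * \<psi> (\<lambda>j. (w(i := v)) (\<sigma> (k + j))) =
      \<phi> ((\<lambda>j. w (\<sigma> j))(inv \<sigma> i := v)) * \<psi> (\<lambda>j. w (\<sigma> (k + j)))" if "inv \<sigma> i < k"
  proof -
    have "(\<lambda>j. (w(i := v)) (\<sigma> (k + j))) = (\<lambda>j. w (\<sigma> (k + j)))" using that by (auto simp: eq)
    then show ?thesis unfolding 1 by simp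
  qed
  show "\<phi> (\<lambda>j. (w(i := v)) (\<sigma> j)) * \<psi> (\<lambda>j. (w(i := v)) (\<sigma> (k + j))) =
      \<phi> (\<lambda>j. w (\<sigma> j)) * \<psi> ((\<lambda>j. w (\<sigma> (k + j)))(inv \<sigma> i - k := v))" if "\<not> inv \<sigma> i < k"
  proof -
    have "(\<lambda>j. (w(i := v)) (\<sigma> (k + j))) = (\<lambda>j. w (\<sigma> (k + j)))(inv \<sigma> i - k := v)"
      using that by (auto simp: eq fun_eq_iff)
    moreover have "\<phi> ((\<lambda>j. w (\<sigma> j))(inv \<sigma> i := v)) = \<phi> (\<lambda>j. w (\<sigma> j))"
      by (rule multilinear_formD(2)[OF \<phi>]) (use that in auto)
    ultimately show ?thesis unfolding 1 by simp
  qed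
qed

lemma linear_real_scale:
  fixes f :: "'a::real_vector \<Rightarrow> real"
  assumes "linear f"
  shows "linear (\<lambda>v. r * (f v * s))" "linear (\<lambda>v. r * (s * f v))" "linear (\<lambda>v. f v * s)"
  using linear_add[OF assms] linear_scale[OF assms] by (auto intro!: linearI simp: algebra_simps)

lemma linear_real_scale_left:
  fixes f :: "'a::real_vector \<Rightarrow> real"
  assumes "linear f"
  shows "linear (\<lambda>v. r * f v)"
  using linear_real_scale(2)[OF assms, of 1] by simp

lemma multilinear_form_wedge:
  assumes \<phi>: "multilinear_form k \<phi>" and \<psi>: "multilinear_form l \<psi>"
  shows "multilinear_form (k + l) (wedge k l \<phi> \<psi>)"
  unfolding multilinear_form_def
proof (intro conjI allI impI)
  fix w and i assume i: "i < k + l"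
  have lin: "linear (\<lambda>v. of_int (sign \<sigma>) * \<phi> (\<lambda>j. (w(i := v)) (\<sigma> j)) * \<psi> (\<lambda>j. (w(i := v)) (\<sigma> (k + j))))"
    if \<sigma>: "\<sigma> permutes {..<k + l}" for \<sigma>
  proof (cases "inv \<sigma> i < k")
    case True
    show ?thesis
      unfolding mult.assoc wedge_update(1)[OF \<sigma> \<phi> True]
      by (rule linear_real_scale[OF multilinear_formD(1)[OF \<phi> True]])
  next
    case False
    then have "inv \<sigma> i - k < l"
      using permutes_in_image[OF permutes_inv[OF \<sigma>], of i] i by auto
    then have "linear (\<lambda>v. \<psi> ((\<lambda>j. w (\<sigma> (k + j)))(inv \<sigma> i - k := v)))"
      by (rule multilinear_formD(1)[OF \<psi>])
    then show ?thesis
      unfolding mult.assoc wedge_update(2)[OF \<sigma> \<phi> False] by (rule linear_real_scale)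
  qed
  show "linear (\<lambda>v. wedge k l \<phi> \<psi> (w(i := v)))"
    unfolding wedge_def divide_inverse
    by (intro linear_real_scale(3) linear_compose_sum ballI lin) simp
next
  fix w w' :: "nat \<Rightarrow> 'a" assume eq: "\<forall>i<k + l. w i = w' i"
  have "\<phi> (\<lambda>j. w (\<sigma> j)) = \<phi> (\<lambda>j. w' (\<sigma> j))" "\<psi> (\<lambda>j. w (\<sigma> (k + j))) = \<psi> (\<lambda>j. w' (\<sigma> (k + j)))"
    if \<sigma>: "\<sigma> permutes {..<k + l}" for \<sigma>
  proof -
    have "w (\<sigma> j) = w' (\<sigma> j)" if "j < k + l" for j
      using eq permutes_in_image[OF \<sigma>, of j] that by auto
    then show "\<phi> (\<lambda>j. w (\<sigma> j)) = \<phi> (\<lambda>j. w' (\<sigma> j))" "\<psi> (\<lambda>j. w (\<sigma> (k + j))) = \<psi> (\<lambda>j. w' (\<sigma> (k + j)))"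
      by (auto intro!: multilinear_formD(2)[OF \<phi>] multilinear_formD(2)[OF \<psi>])
  qed
  then show "wedge k l \<phi> \<psi> w = wedge k l \<phi> \<psi> w'"
    unfolding wedge_def by (intro arg_cong2[where f = "(/)"] sum.cong) auto
qed

text \<open>In every summand z sits in a slot of one of the two factors and annuls that
  factor.\<close>

lemma form_kernel_wedge:
  assumes \<phi>: "multilinear_form k \<phi>" and z: "z \<in> form_kernel k \<phi>" "z \<in> form_kernel l \<psi>"
  shows "z \<in> form_kernel (k + l) (wedge k l \<phi> \<psi>)"
  unfolding form_kernel_def
proof (intro CollectI allI impI)
  fix w and i assume i: "i < k + l"
  have "of_int (sign \<sigma>) * \<phi> (\<lambda>j. (w(i := z)) (\<sigma> j)) * \<psi> (\<lambda>j. (w(i := z)) (\<sigma> (k + j))) = 0"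
    if \<sigma>: "\<sigma> permutes {..<k + l}" for \<sigma>
  proof (cases "inv \<sigma> i < k")
    case True
    then show ?thesis
      unfolding mult.assoc wedge_update(1)[OF \<sigma> \<phi> True] using z(1) by (simp add: form_kernel_def)
  next
    case False
    then have "inv \<sigma> i - k < l"
      using permutes_in_image[OF permutes_inv[OF \<sigma>], of i] i by auto
    then show ?thesis
      unfolding mult.assoc wedge_update(2)[OF \<sigma> \<phi> False] using z(2) by (simp add: form_kernel_def)
  qed
  then show "wedge k l \<phi> \<psi> (w(i := z)) = 0"
    unfolding wedge_def by (simp add: sum.neutral)
qed

text \<open>The sum over all permutations antisymmetrizes any \<phi> and \<psi>: composing with the
  transposition of i and j permutes the summands, changes every sign and leaves the arguments
  alone.\<close>

lemma wedge_alternating: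
  assumes ij: "i < k + l" "j < k + l" "i \<noteq> j" "w i = w j"
  shows "wedge k l \<phi> \<psi> w = 0"
proof -
  let ?t = "Transposition.transpose i j"
  let ?f = "\<lambda>\<sigma>. of_int (sign \<sigma>) * \<phi> (\<lambda>i. w (\<sigma> i)) * \<psi> (\<lambda>i. w (\<sigma> (k + i))) :: real"
  have t: "?t permutes {..<k + l}" using ij by (intro permutes_swap_id) auto
  have w: "w (?t x) = w x" for x using ij by (auto simp: Transposition.transpose_def)
  have "sum ?f {\<sigma>. \<sigma> permutes {..<k + l}} = (\<Sum>\<sigma> | \<sigma> permutes {..<k + l}. ?f (?t \<circ> \<sigma>))"
    by (rule setum_permutations_compose_left[OF t])
  also have "\<dots> = (\<Sum>\<sigma> | \<sigma> permutes {..<k + l}. - ?f \<sigma>)"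
  proof (rule sum.cong[OF refl])
    fix \<sigma> assume "\<sigma> \<in> {\<sigma>. \<sigma> permutes {..<k + l}}"
    then have "permutation \<sigma>" using permutation_permutes by blast
    then have "sign (?t \<circ> \<sigma>) = - sign \<sigma>"
      using ij by (simp add: sign_compose permutation_swap_id sign_swap_id)
    then show "?f (?t \<circ> \<sigma>) = - ?f \<sigma>" by (simp add: w)
  qed
  finally have "sum ?f {\<sigma>. \<sigma> permutes {..<k + l}} = 0"
    by (simp add: sum_negf)
  then show ?thesis by (simp add: wedge_def)
qed

lemma wedge_power_properties:
  assumes "multilinear_form k \<phi>" "z \<in> form_kernel k \<phi>"
  shows "multilinear_form (k * n) (wedge_power k \<phi> n) \<and> z \<in> form_kernel (k * n) (wedge_power k \<phi> n)"
proof (induction n)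
  case 0
  then show ?case by (simp add: multilinear_form_def form_kernel_def)
next
  case (Suc n)
  then show ?case
    using multilinear_form_wedge[OF assms(1), of "k * n"] form_kernel_wedge[OF assms, of "k * n"] by simp
qed

text \<open>The N arguments and z are N + 1 vectors, hence related. If the relation involves some
  \<open>w k\<close>, put it, being 0, into slot k: terms with another \<open>w i\<close> vanish by
  alternation, the term with z because z is in the kernel. Otherwise the relation forces z =
  0.\<close>

lemma top_form_kernel:
  fixes \<omega> :: "(nat \<Rightarrow> 'v::euclidean_space) \<Rightarrow> real"
  assumes \<omega>: "multilinear_form N \<omega>" and N: "N = DIM('v)"
    and alt: "\<And>w i j. i < N \<Longrightarrow> j < N \<Longrightarrow> i \<noteq> j \<Longrightarrow> w i = w j \<Longrightarrow> \<omega> w = 0"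
    and z: "z \<in> form_kernel N \<omega>" "z \<noteq> 0"
  shows "\<omega> w = 0"
proof -
  \<comment> \<open>The form reads the slots below N only; slot N is free to hold z.\<close>
  let ?v = "w(N := z)"
  obtain c where c: "\<exists>i\<in>{..N}. c i \<noteq> 0" "(\<Sum>i\<in>{..N}. c i *\<^sub>R ?v i) = 0"
    by (rule finite_family_dependent[of "{..N}" ?v]) (simp_all add: N)
  have split: "(\<Sum>i<N. c i *\<^sub>R w i) + c N *\<^sub>R z = 0"
    using c(2) by (simp add: lessThan_Suc_atMost[symmetric])
  show ?thesis
  proof (cases "\<exists>k<N. c k \<noteq> 0")
    case True
    then obtain k where k: "k < N" "c k \<noteq> 0" by blast
    have lin: "linear (\<lambda>v. \<omega> (w(k := v)))" by (rule multilinear_formD(1)[OF \<omega> k(1)])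
    have "0 = \<omega> (w(k := (\<Sum>i<N. c i *\<^sub>R w i) + c N *\<^sub>R z))"
      using linear_0[OF lin] split by simp
    also have "\<dots> = (\<Sum>i<N. c i * \<omega> (w(k := w i))) + c N * \<omega> (w(k := z))"
      unfolding linear_add[OF lin] linear_sum[OF lin] linear_scale[OF lin] by simp
    also have "\<omega> (w(k := z)) = 0" using z(1) k(1) by (simp add: form_kernel_def)
    also have "(\<Sum>i<N. c i * \<omega> (w(k := w i))) = (\<Sum>i<N. if i = k then c k * \<omega> w else 0)"
    proof (rule sum.cong[OF refl])
      fix i assume i: "i \<in> {..<N}"
      show "c i * \<omega> (w(k := w i)) = (if i = k then c k * \<omega> w else 0)"
        using alt[of i k "w(k := w i)"] i k by (cases "i = k") auto
    qed
    finally show ?thesis using k by simp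
  next
    case False
    then have "c N *\<^sub>R z = 0" using split by simp
    moreover have "c N \<noteq> 0" using False c(1) by (metis atMost_iff le_neq_implies_less)
    ultimately show ?thesis using z(2) by simp
  qed
qed

text \<open>A nonzero vector in the kernel of both \<alpha> and d\<alpha> would lie in the kernel of
  \<alpha> \<and> (d\<alpha>)^n, and an alternating form of top degree with such a kernel vector is
  zero.\<close>

lemma contact_form_no_kernel:
  fixes \<alpha> :: "'m::topological_space \<Rightarrow> 'e::euclidean_space \<Rightarrow> real"
  assumes A: "smooth_atlas A" and \<alpha>: "contact_form A n \<alpha>" and dim: "DIM('e) = 2 * n + 1"
    and z: "\<alpha> x z = 0" "\<And>v. ext_deriv A \<alpha> x z v = 0"
  shows "z = 0"
proof (rule ccontr)
  assume "z \<noteq> 0"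
  have sm: "smooth_one_form A \<alpha>" using \<alpha> by (simp add: contact_form_def)
  let ?\<alpha> = "\<lambda>w :: nat \<Rightarrow> 'e. \<alpha> x (w 0)" and ?d = "\<lambda>w :: nat \<Rightarrow> 'e. ext_deriv A \<alpha> x (w 0) (w 1)"
  let ?\<omega> = "wedge 1 (2 * n) ?\<alpha> (wedge_power 2 ?d n)"
  have 1: "multilinear_form 1 ?\<alpha>" "z \<in> form_kernel 1 ?\<alpha>"
    using sm z by (auto simp: multilinear_form_def form_kernel_def smooth_one_form_def)
  have anti: "ext_deriv A \<alpha> x u v = - ext_deriv A \<alpha> x v u" for u v
    by (simp add: ext_deriv_def Let_def)
  have "multilinear_form 2 ?d"
    using ext_deriv_bilinear[OF A sm, of x]
    by (auto simp: multilinear_form_def less_2_cases_iff)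
  moreover have "z \<in> form_kernel 2 ?d"
    using z(2) anti[of _ z] by (auto simp: form_kernel_def less_2_cases_iff)
  ultimately have 2: "multilinear_form (2 * n) (wedge_power 2 ?d n)" "z \<in> form_kernel (2 * n) (wedge_power 2 ?d n)"
    using wedge_power_properties by blast+
  have "?\<omega> w = 0" for w
  proof (rule top_form_kernel[OF multilinear_form_wedge[OF 1(1) 2(1)] _ _ form_kernel_wedge[OF 1 2(2)] \<open>z \<noteq> 0\<close>])
    show "1 + 2 * n = DIM('e)" using dim by simp
  qed (rule wedge_alternating)
  then show False using \<alpha> unfolding contact_form_def by blast
qed

section \<open>Linear systems with smooth coefficients\<close>

text \<open>Gaussian elimination; the pivot stays nonzero near \<open>u\<close>.\<close>

lemma smooth_linear_solve:
  fixes a :: "'j \<Rightarrow> 'i \<Rightarrow> 'a::euclidean_space \<Rightarrow> real"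
  assumes "finite I" "finite J" "card J = card I" "open U" "u \<in> U"
    and "\<And>j i. j \<in> J \<Longrightarrow> i \<in> I \<Longrightarrow> smooth_on U (a j i)" "\<And>j. j \<in> J \<Longrightarrow> smooth_on U (b j)"
    and "\<And>c. (\<And>j. j \<in> J \<Longrightarrow> (\<Sum>i\<in>I. a j i u * c i) = 0) \<Longrightarrow> (\<forall>i\<in>I. c i = 0)"
  shows "\<exists>V x. open V \<and> u \<in> V \<and> V \<subseteq> U \<and> (\<forall>i\<in>I. smooth_on V (x i)) \<and>
    (\<forall>z\<in>V. \<forall>j\<in>J. (\<Sum>i\<in>I. a j i z * x i z) = b j z)"
  using assms
proof (induction I arbitrary: J U a b rule: finite_induct)
  case empty
  then have "J = {}" by simp
  with empty show ?case by auto
next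
  case (insert k I)
  \<comment> \<open>If the column of the unknown k vanished at u, the k-th unit vector would solve
    the homogeneous system.\<close>
  have "\<exists>j\<in>J. a j k u \<noteq> 0"
  proof (rule ccontr)
    assume "\<not> (\<exists>j\<in>J. a j k u \<noteq> 0)"
    then have "(\<Sum>i\<in>insert k I. a j i u * (if i = k then 1 else 0)) = 0" if "j \<in> J" for j
      using that by (intro sum.neutral) auto
    then have "\<forall>i\<in>insert k I. (if i = k then 1 else 0) = (0::real)" by (rule insert.prems(7))
    then show False by simp
  qed
  then obtain j0 where j0: "j0 \<in> J" "a j0 k u \<noteq> 0" by blast
  let ?p = "a j0 k"
  let ?V = "U \<inter> ?p -` (- {0})"
  have V: "open ?V"
    by (rule continuous_open_preimage[OF smooth_on_continuous])
      (use insert.prems j0 in auto)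
  have uV: "u \<in> ?V" using insert.prems(4) j0 by auto
  have sa: "smooth_on ?V (a j i)" if "j \<in> J" "i \<in> insert k I" for j i
    by (rule smooth_on_subset[OF insert.prems(3) V _ insert.prems(5)[OF that]]) auto
  have sb: "smooth_on ?V (b j)" if "j \<in> J" for j
    by (rule smooth_on_subset[OF insert.prems(3) V _ insert.prems(6)[OF that]]) auto
  have sp: "smooth_on ?V (\<lambda>z. inverse (?p z))"
    by (rule smooth_on_inverse[OF V sa]) (use j0 in auto)
  \<comment> \<open>Subtraction of the multiple of row \<open>j0\<close> that removes the unknown k
    from row j. The factor \<open>(- 1)\<close> stands for a minus sign, so that the rules for sums
    and products give smoothness.\<close>
  define a' where "a' j i z = a j i z + (- 1) * (a j k z * (inverse (?p z) * a j0 i z))" for j i z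
  define b' where "b' j z = b j z + (- 1) * (a j k z * (inverse (?p z) * b j0 z))" for j z
  have "\<exists>W x. open W \<and> u \<in> W \<and> W \<subseteq> ?V \<and> (\<forall>i\<in>I. smooth_on W (x i)) \<and>
    (\<forall>z\<in>W. \<forall>j\<in>J - {j0}. (\<Sum>i\<in>I. a' j i z * x i z) = b' j z)"
  proof (rule insert.IH[OF _ _ V uV])
    show "card (J - {j0}) = card I" "finite (J - {j0})" using insert j0 by auto
    show "smooth_on ?V (a' j i)" if "j \<in> J - {j0}" "i \<in> I" for j i
      unfolding a'_def using that sa sp j0 V
      by (intro smooth_on_add smooth_on_mult smooth_on_const) auto
    show "smooth_on ?V (b' j)" if "j \<in> J - {j0}" for j
      unfolding b'_def using that sa sb sp j0 V
      by (intro smooth_on_add smooth_on_mult smooth_on_const) auto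
    fix c assume c: "\<And>j. j \<in> J - {j0} \<Longrightarrow> (\<Sum>i\<in>I. a' j i u * c i) = 0"
    let ?s = "\<lambda>j. \<Sum>i\<in>I. a j i u * c i"
    \<comment> \<open>A homogeneous solution of the reduced system lifts to one of the full system
      by solving row \<open>j0\<close> for the unknown k.\<close>
    let ?c = "c(k := - inverse (?p u) * ?s j0)"
    have sum_c: "(\<Sum>i\<in>insert k I. a j i u * ?c i) = ?s j - a j k u * (inverse (?p u) * ?s j0)" for j
    proof -
      have "(\<Sum>i\<in>I. a j i u * ?c i) = ?s j"
        using insert.hyps(2) by (intro sum.cong) auto
      then show ?thesis using insert.hyps by simp
    qed
    have "(\<Sum>i\<in>insert k I. a j i u * ?c i) = 0" if "j \<in> J" for j
    proof (cases "j = j0")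
      case True
      then show ?thesis unfolding sum_c using j0 by simp
    next
      case False
      have "0 = (\<Sum>i\<in>I. a' j i u * c i)" using c False that by simp
      also have "\<dots> = ?s j - a j k u * (inverse (?p u) * ?s j0)"
        by (simp add: a'_def sum_distrib_left sum_subtractf algebra_simps)
      finally show ?thesis unfolding sum_c by simp
    qed
    then have "\<forall>i\<in>insert k I. ?c i = 0" by (rule insert.prems(7))
    then have "?c i = 0" if "i \<in> I" for i using that by blast
    moreover have "?c i = c i" if "i \<in> I" for i using that insert.hyps(2) by (intro fun_upd_other) auto
    ultimately show "\<forall>i\<in>I. c i = 0" by simp
  qed
  then obtain W x where W: "open W" "u \<in> W" "W \<subseteq> ?V" "\<forall>i\<in>I. smooth_on W (x i)"
    "\<forall>z\<in>W. \<forall>j\<in>J - {j0}. (\<Sum>i\<in>I. a' j i z * x i z) = b' j z" by blast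
  let ?s = "\<lambda>j z. \<Sum>i\<in>I. a j i z * x i z"
  \<comment> \<open>Back substitution in row \<open>j0\<close>, on all of \<open>W\<close>, where
    the pivot is nonzero.\<close>
  define y where "y = x(k := \<lambda>z. inverse (?p z) * (b j0 z + (- 1) * ?s j0 z))"
  have res: "smooth_on W f" if "smooth_on ?V f" for f :: "'a \<Rightarrow> real"
    by (rule smooth_on_subset[OF V W(1,3) that])
  have sumy: "(\<Sum>i\<in>insert k I. a j i z * y i z) = ?s j z + a j k z * (inverse (?p z) * (b j0 z - ?s j0 z))" for j z
  proof -
    have "(\<Sum>i\<in>I. a j i z * y i z) = ?s j z"
      using insert.hyps(2) by (intro sum.cong) (auto simp: y_def)
    then show ?thesis using insert.hyps by (simp add: y_def)
  qed
  show ?case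
  proof (intro exI conjI ballI)
    show "open W" "u \<in> W" "W \<subseteq> U" using W by auto
    have "smooth_on W (y k)"
      unfolding y_def fun_upd_same
    proof (intro smooth_on_mult[OF W(1) res[OF sp]] smooth_on_add[OF W(1) res[OF sb[OF j0(1)]]]
        smooth_on_mult[OF W(1) smooth_on_const[OF W(1)]] smooth_on_sum[OF W(1)])
      show "smooth_on W (\<lambda>z. a j0 i z * x i z)" if "i \<in> I" for i
        by (rule smooth_on_mult[OF W(1) res[OF sa] bspec[OF W(4)]]) (use that j0 in auto)
    qed
    then show "smooth_on W (y i)" if "i \<in> insert k I" for i
      using that W(4) by (cases "i = k") (auto simp: y_def)
    fix z j assume z: "z \<in> W" and j: "j \<in> J"
    have p: "?p z \<noteq> 0" using z W(3) by auto
    show "(\<Sum>i\<in>insert k I. a j i z * y i z) = b j z"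
    proof (cases "j = j0")
      case True
      then show ?thesis unfolding sumy using p by (simp flip: mult.assoc)
    next
      case False
      have "b' j z = (\<Sum>i\<in>I. a' j i z * x i z)" using W(5) z j False by simp
      also have "\<dots> = ?s j z - a j k z * (inverse (?p z) * ?s j0 z)"
        by (simp add: a'_def sum_distrib_left sum_subtractf algebra_simps)
      finally show ?thesis unfolding sumy b'_def by (simp add: algebra_simps)
    qed
  qed
qed

section \<open>Operations on smooth functions and maps\<close>

lemma smooth_germ_const: "smooth_germ P u (\<lambda>x. c)"
  by (rule smooth_germ_smooth_on[OF open_UNIV UNIV_I smooth_on_const[OF open_UNIV]])

lemma smooth_germ_sum:
  assumes "finite I" "\<And>i. i \<in> I \<Longrightarrow> smooth_germ P u (f i)"
  shows "smooth_germ P u (\<lambda>x. \<Sum>i\<in>I. f i x)"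
proof -
  obtain Q h where Q: "open Q" "u \<in> Q" "\<And>i. i \<in> I \<Longrightarrow> smooth_on Q (h i)"
    "\<And>i z. i \<in> I \<Longrightarrow> z \<in> Q \<Longrightarrow> z \<in> P \<Longrightarrow> h i z = f i z"
    by (rule smooth_germ_common[OF assms(1), of P u f]) (rule assms(2), assumption, rule that, assumption+)
  show ?thesis
    by (rule smooth_germI[OF Q(1,2) smooth_on_sum[OF Q(1,3)]]) (use Q(4) in \<open>auto intro: sum.cong\<close>)
qed

lemma smooth_germ_vec:
  fixes f :: "'a::euclidean_space \<Rightarrow> 'b::euclidean_space ^ 'k"
  assumes "u \<in> P" "\<And>\<mu>. smooth_germ P u (\<lambda>x. f x $ \<mu>)"
  shows "smooth_germ P u f"
proof -
  have lin: "bounded_linear (axis \<mu> :: 'b \<Rightarrow> 'b ^ 'k)" for \<mu>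
    by (intro linear_conv_bounded_linear[THEN iffD1] linearI) (auto simp: vec_eq_iff axis_def)
  have "smooth_germ P u (\<lambda>x. \<Sum>\<mu>\<in>UNIV. axis \<mu> (f x $ \<mu>))"
    by (intro smooth_germ_sum smooth_germ_linear[OF assms(2,1) lin]) auto
  moreover have "(\<Sum>\<mu>\<in>UNIV. axis \<mu> (f x $ \<mu>)) = f x" for x
    by (simp add: vec_eq_iff axis_def)
  ultimately show ?thesis by simp
qed

lemma smooth_fun_on_smooth_compose:
  fixes f :: "'m::topological_space \<Rightarrow> 'b::euclidean_space" and g :: "'b \<Rightarrow> 'c::real_normed_vector"
  assumes A: "smooth_atlas A" and f: "smooth_fun_on A S f" and g: "smooth_on UNIV g"
  shows "smooth_fun_on A S (\<lambda>x. g (f x))"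
  by (rule smooth_fun_on_chartsI[OF A], rule smooth_germ_smooth_compose[OF smooth_fun_onD[OF A f] _ g]) auto

lemma smooth_fun_on_linear:
  fixes f :: "'m::topological_space \<Rightarrow> 'b::euclidean_space" and g :: "'b \<Rightarrow> 'c::real_normed_vector"
  assumes "smooth_atlas A" "smooth_fun_on A S f" "bounded_linear g"
  shows "smooth_fun_on A S (\<lambda>x. g (f x))"
  using smooth_fun_on_smooth_compose[OF assms(1,2) smooth_on_linear[OF open_UNIV assms(3)]] .

lemma smooth_fun_on_bilinear:
  assumes A: "smooth_atlas A" and p: "bounded_bilinear p"
    and f: "smooth_fun_on A S f" and g: "smooth_fun_on A S g"
  shows "smooth_fun_on A S (\<lambda>x. p (f x) (g x))"
  by (rule smooth_fun_on_chartsI[OF A], rule smooth_germ_bilinear[OF p smooth_fun_onD[OF A f] smooth_fun_onD[OF A g]])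

lemmas smooth_fun_on_mult = smooth_fun_on_bilinear[OF _ bounded_bilinear_mult]

lemma smooth_fun_on_cis:
  fixes f :: "'m::topological_space \<Rightarrow> real"
  assumes "smooth_atlas A" "smooth_fun_on A S f"
  shows "smooth_fun_on A S (\<lambda>x. cis (f x))"
  by (rule smooth_fun_on_smooth_compose[OF assms]) (simp add: smooth_on_def Ck_on_cis)

lemma smooth_fun_on_vec:
  fixes f :: "'m::topological_space \<Rightarrow> 'b::euclidean_space ^ 'k"
  assumes A: "smooth_atlas A" and f: "\<And>\<mu>. smooth_fun_on A S (\<lambda>x. f x $ \<mu>)"
  shows "smooth_fun_on A S f"
  by (rule smooth_fun_on_chartsI[OF A], rule smooth_germ_vec) (use smooth_fun_onD[OF A f] in auto)

lemma smooth_fun_on_vec_nth: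
  fixes f :: "'m::topological_space \<Rightarrow> 'b::euclidean_space ^ 'k"
  assumes "smooth_atlas A" "smooth_fun_on A S f"
  shows "smooth_fun_on A S (\<lambda>x. f x $ \<mu>)"
  by (rule smooth_fun_on_linear[OF assms bounded_linear_vec_nth])

lemma smooth_fun_on_const: "smooth_fun_on A S (\<lambda>x. c)" if "smooth_atlas A"
  by (rule smooth_fun_on_chartsI[OF that smooth_germ_const])

lemma smooth_map_on_cong:
  "smooth_map_on A B S f \<Longrightarrow> (\<And>x. x \<in> S \<Longrightarrow> f x = g x) \<Longrightarrow> smooth_map_on A B S g"
proof -
  assume f: "smooth_map_on A B S f" and eq: "\<And>x. x \<in> S \<Longrightarrow> f x = g x"
  have "S \<inter> f -` X = S \<inter> g -` X" for X using eq by auto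
  then show "smooth_map_on A B S g"
    using f eq unfolding smooth_map_on_def
    by (auto cong: continuous_on_cong intro: smooth_fun_on_cong[where f = "_ \<circ> f"])
qed

lemma smooth_map_on_id:
  assumes A: "smooth_atlas A"
  shows "smooth_map_on A A S (\<lambda>x. x)"
proof (rule smooth_map_onI[OF A continuous_on_id])
  fix x d assume x: "x \<in> S" "d \<in> A" "x \<in> fst d"
  note d = atlas_chart[OF A x(2)]
  have "smooth_on (snd d ` fst d) (\<lambda>u. snd d (chart_inv d u))"
    using transition_smooth[OF atlas_compatible[OF A x(2,2)]] by simp
  then have "chart_germ d S x (snd d)"
    by (rule smooth_germ_smooth_on[rotated 2]) (use d x in \<open>auto simp: is_chart_def\<close>)
  then show "\<exists>c\<in>A. x \<in> fst c \<and> chart_germ c S x (snd d)"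
    using x by blast
qed

lemma smooth_map_on_const: "smooth_atlas A \<Longrightarrow> smooth_map_on A B S (\<lambda>x. w)"
  by (rule smooth_map_onI) (use ref_chart smooth_germ_const in \<open>auto intro!: bexI\<close>)

lemma euclidean_product_chart:
  assumes "d \<in> B"
  shows "(UNIV \<times> fst d, map_prod id (snd d)) \<in> product_atlas euclidean_atlas B"
  unfolding product_atlas_def euclidean_atlas_def using assms by (force intro!: image_eqI[of _ _ "((UNIV, id), d)"])

lemma smooth_map_on_productD:
  fixes F :: "'m::topological_space \<Rightarrow> 'b::euclidean_space"
  assumes A: "smooth_atlas A" and B: "smooth_atlas B"
    and f: "smooth_map_on A (product_atlas euclidean_atlas B) S (\<lambda>m. (F m, p m))"
  shows "smooth_fun_on A S F"
proof (rule smooth_fun_onI[OF A])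
  fix x assume x: "x \<in> S"
  note c = ref_chart[OF A, of x] and d = ref_chart[OF B, of "p x"]
  let ?e = "(UNIV \<times> fst (ref_chart B (p x)), map_prod (id :: 'b \<Rightarrow> 'b) (snd (ref_chart B (p x))))"
  have "chart_germ (ref_chart A x) S x (\<lambda>u. snd ?e (F u, p u))"
    using smooth_map_onD[OF A smooth_atlas_product[OF smooth_atlas_euclidean B] f x c(1,2)
          euclidean_product_chart[OF d(1)]] d(2) by simp
  from smooth_germ_linear[OF this _ bounded_linear_fst] x c
  show "\<exists>c\<in>A. x \<in> fst c \<and> chart_germ c S x F"
    by auto
qed

lemma smooth_map_on_productI:
  fixes F :: "'m::topological_space \<Rightarrow> 'b::euclidean_space"
    and A :: "('m, 'e::euclidean_space) chart set" and B :: "('w::topological_space, 'f::euclidean_space) chart set"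
  assumes A: "smooth_atlas A" and B: "smooth_atlas B" and F: "smooth_fun_on A S F" "continuous_on S F"
    and p: "smooth_map_on A B S p"
  shows "smooth_map_on A (product_atlas euclidean_atlas B) S (\<lambda>m. (F m, p m))"
proof (rule smooth_map_onI[OF A])
  show "continuous_on S (\<lambda>m. (F m, p m))"
    using F(2) p by (intro continuous_on_Pair) (auto simp: smooth_map_on_def)
  fix x and e :: "(('b \<times> 'w), ('b \<times> 'f)) chart"
  assume x: "x \<in> S" and e: "e \<in> product_atlas euclidean_atlas B" "(F x, p x) \<in> fst e"
  obtain d where d: "e = (UNIV \<times> fst d, map_prod id (snd d))" "d \<in> B"
    using e(1) by (auto elim!: product_atlasE simp: euclidean_atlas_def)
  note c = ref_chart[OF A, of x]
  have "chart_germ (ref_chart A x) S x (\<lambda>u. (F u, snd d (p u)))"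
    by (rule smooth_germ_Pair[OF smooth_fun_onD[OF A F(1) x c(1,2)] smooth_map_onD[OF A B p x c(1,2) d(2)]])
      (use d e in auto)
  then show "\<exists>c\<in>A. x \<in> fst c \<and> chart_germ c S x (\<lambda>u. snd e (F u, p u))"
    using c d by auto
qed

lemma smooth_fun_on_continuous:
  fixes A :: "('m::topological_space, 'e::euclidean_space) chart set"
  assumes A: "smooth_atlas A" and f: "smooth_fun_on A S f"
  shows "continuous_on S f"
  unfolding continuous_on_def
proof
  fix x assume x: "x \<in> S"
  note c = ref_chart[OF A, of x]
  let ?c = "ref_chart A x"
  obtain U h where U: "open U" "x \<in> U" "\<forall>y\<in>U \<inter> S. h y = f y"
    "smooth_on (snd ?c ` (U \<inter> fst ?c)) (h \<circ> chart_inv ?c)"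
    using bspec[OF f[unfolded smooth_fun_on_def] x] c(1) by blast
  have o: "open (U \<inter> fst ?c)" using U chart_open[OF c(3)] by blast
  have "continuous_on (U \<inter> fst ?c) (\<lambda>y. (h \<circ> chart_inv ?c) (snd ?c y))"
    by (rule continuous_on_compose2[OF smooth_on_continuous[OF U(4)]
          continuous_on_subset[OF chart_continuous(1)[OF c(3)]]]) auto
  then have "continuous_on (U \<inter> fst ?c) h"
    by (rule continuous_on_cong[THEN iffD1, rotated -1]) (auto simp: chart_inv_left[OF c(3)])
  then have "(h \<longlongrightarrow> h x) (at x within (U \<inter> fst ?c))"
    using U(2) c(2) unfolding continuous_on_def by blast
  then have "(h \<longlongrightarrow> h x) (at x)" using at_within_open[OF _ o] U(2) c(2) by simp
  then have t: "(h \<longlongrightarrow> h x) (at x within S)" by (rule tendsto_within_subset) simp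
  have "\<forall>\<^sub>F y in at x within S. h y = f y"
    unfolding eventually_at_topological using U by blast
  then have "(f \<longlongrightarrow> h x) (at x within S)" using t tendsto_cong by blast
  then show "(f \<longlongrightarrow> f x) (at x within S)" using U x by simp
qed

lemma smooth_map_on_product_fst:
  fixes B :: "('w::topological_space, 'f::euclidean_space) chart set"
  assumes B: "smooth_atlas B"
  shows "smooth_fun_on (product_atlas euclidean_atlas B) T (fst :: 'b::euclidean_space \<times> 'w \<Rightarrow> 'b)"
    and "smooth_map_on (product_atlas euclidean_atlas B) B T (snd :: 'b \<times> 'w \<Rightarrow> 'w)"
proof -
  let ?PB = "product_atlas euclidean_atlas B :: ('b \<times> 'w, 'b \<times> 'f) chart set"
  have PB: "smooth_atlas ?PB" by (rule smooth_atlas_product[OF smooth_atlas_euclidean B])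
  have inv: "chart_inv (UNIV \<times> fst d, map_prod (id :: 'b \<Rightarrow> 'b) (snd d)) (a, b) = (a, chart_inv d b)"
    if "d \<in> B" "b \<in> snd d ` fst d" for d a b
  proof -
    have "is_chart (UNIV, id :: 'b \<Rightarrow> 'b)"
      using atlas_chart[OF smooth_atlas_euclidean] by (auto simp: euclidean_atlas_def)
    from is_chart_product(2)[OF this atlas_chart[OF B that(1)], of a b] that(2)
    show ?thesis by (simp add: chart_inv_def[of "(UNIV, id)"] inv_id)
  qed
  have ch: "is_chart (UNIV \<times> fst d, map_prod (id :: 'b \<Rightarrow> 'b) (snd d))" if "d \<in> B" for d
    using atlas_chart[OF PB euclidean_product_chart[OF that]] .
  show "smooth_fun_on ?PB T fst"
  proof (rule smooth_fun_onI[OF PB])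
    fix x :: "'b \<times> 'w" assume x: "x \<in> T"
    let ?d = "ref_chart B (snd x)"
    note d = ref_chart[OF B, of "snd x"]
    let ?e = "(UNIV \<times> fst ?d, map_prod (id :: 'b \<Rightarrow> 'b) (snd ?d))"
    have "smooth_germ (snd ?e ` (T \<inter> fst ?e)) (snd ?e x) fst"
      by (rule smooth_germ_smooth_on[OF open_UNIV UNIV_I smooth_on_linear[OF open_UNIV bounded_linear_fst]])
    then have "chart_germ ?e T x fst"
      by (rule smooth_germ_cong) (use inv d(1) in auto)
    moreover have "x \<in> fst ?e" using d by (auto simp: mem_Times_iff)
    ultimately show "\<exists>c\<in>?PB. x \<in> fst c \<and> chart_germ c T x fst"
      using euclidean_product_chart[OF d(1)] by blast
  qed
  show "smooth_map_on ?PB B T snd"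
  proof (rule smooth_map_onI[OF PB continuous_on_snd[OF continuous_on_id]])
    fix x :: "'b \<times> 'w" and d assume x: "x \<in> T" and d: "d \<in> B" "snd x \<in> fst d"
    let ?e = "(UNIV \<times> fst d, map_prod (id :: 'b \<Rightarrow> 'b) (snd d))"
    have "smooth_germ (snd ?e ` (T \<inter> fst ?e)) (snd ?e x) snd"
      by (rule smooth_germ_smooth_on[OF open_UNIV UNIV_I smooth_on_linear[OF open_UNIV bounded_linear_snd]])
    then have "chart_germ ?e T x (\<lambda>u. snd d (snd u))"
      by (rule smooth_germ_cong) (use inv d(1) chart_inv_left[OF atlas_chart[OF B d(1)]] in auto)
    moreover have "x \<in> fst ?e" using d by (auto simp: mem_Times_iff)
    ultimately show "\<exists>c\<in>?PB. x \<in> fst c \<and> chart_germ c T x (\<lambda>u. snd d (snd u))"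
      using euclidean_product_chart[OF d(1)] by blast
  qed
qed

lemma smooth_fun_on_euclidean:
  assumes "smooth_on UNIV f"
  shows "smooth_fun_on euclidean_atlas S f"
  by (rule smooth_fun_onI[OF smooth_atlas_euclidean])
    (use smooth_germ_smooth_on[OF open_UNIV UNIV_I assms] in
      \<open>auto simp: euclidean_atlas_def chart_inv_def inv_id id_def[symmetric]\<close>)

text \<open>The independent local actions and the coordinates x are components of a chart of the
  maximal atlas, which need not lie in B; compatibility makes these components smooth.\<close>

lemma maximal_chart_smooth:
  assumes B: "smooth_atlas B" and c: "c \<in> maximal_atlas B"
  shows "smooth_fun_on B (fst c) (snd c)"
proof (rule smooth_fun_onI[OF B])
  fix x assume x: "x \<in> fst c"
  let ?d = "ref_chart B x"
  note d = ref_chart[OF B, of x]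
  have ic: "is_chart c" "smoothly_compatible ?d c"
    using c d smoothly_compatible_sym[of c ?d] unfolding maximal_atlas_def by auto
  have "chart_germ ?d (fst c) x (snd c)"
    by (rule smooth_germ_smooth_on[OF transition_open[OF d(3) ic(1)] _ transition_smooth[OF ic(2)]])
      (use d x in auto)
  then show "\<exists>d\<in>B. x \<in> fst d \<and> chart_germ d (fst c) x (snd c)"
    using d by blast
qed

text \<open>The chart d of the base is fixed here, instead of the reference chart of
  \<open>f m\<close>. The inner derivative is the same linear map for every F, so linear relations
  between differentials of extensions on the base pull back to the total space.\<close>

lemma pullback_differential:
  assumes A: "smooth_atlas A" and B: "smooth_atlas B" and f: "smooth_map_on A B UNIV f"
    and m: "f m \<in> V" "thick_at A (f -` V) m" and d: "d \<in> B" "f m \<in> fst d"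
    and h: "open Q" "snd d (f m) \<in> Q" "smooth_on Q h"
      "\<And>z. z \<in> Q \<Longrightarrow> z \<in> snd d ` (V \<inter> fst d) \<Longrightarrow> h z = F (chart_inv d z)"
  shows "differential A (f -` V) (\<lambda>x. F (f x)) m v = frechet_derivative h (at (snd d (f m)))
    (frechet_derivative (\<lambda>u. snd d (f (chart_inv (ref_chart A m) u))) (at (snd (ref_chart A m) m)) v)"
proof -
  let ?a = "ref_chart A m" and ?k = "\<lambda>u. snd d (f (chart_inv (ref_chart A m) u))"
  note a = ref_chart[OF A, of m]
  have id: "is_chart d" using B d atlas_chart by blast
  have o: "open (snd ?a ` (UNIV \<inter> fst ?a))" by (rule chart_image_open[OF a(3) open_UNIV])
  have within: "at (snd ?a m) within snd ?a ` (UNIV \<inter> fst ?a) = at (snd ?a m)"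
    using a by (intro at_within_open o) auto
  obtain D where "(?k has_derivative D) (at (snd ?a m))"
    using smooth_germ_has_derivative[OF smooth_map_onD[OF A B f UNIV_I a(1,2) d]] a(2)
    unfolding within by blast
  then have k: "(?k has_derivative frechet_derivative ?k (at (snd ?a m))) (at (snd ?a m))"
    by (metis differentiableI frechet_derivative_works)
  have hd: "((\<lambda>u. h (?k u)) has_derivative
      (\<lambda>v. frechet_derivative h (at (snd d (f m))) (frechet_derivative ?k (at (snd ?a m)) v))) (at (snd ?a m))"
    by (rule has_derivative_compose[OF k])
      (use smooth_on_has_derivative[OF h(1,3,2)] in \<open>simp add: chart_inv_left[OF a(3,2)]\<close>)
  let ?P = "snd ?a ` (f -` V \<inter> fst ?a)"
  have of: "open (f -` (fst d \<inter> snd d -` Q))"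
    using open_vimage[OF chart_preimage_open[OF id h(1)]] f unfolding smooth_map_on_def by blast
  let ?N = "snd ?a ` (f -` (fst d \<inter> snd d -` Q) \<inter> fst ?a)"
  have N: "open ?N" "snd ?a m \<in> ?N" using chart_image_open[OF a(3) of] a d h by auto
  obtain e where e: "e > 0" "ball (snd ?a m) e \<subseteq> ?N" using N open_contains_ball by blast
  have "((\<lambda>u. F (f (chart_inv ?a u))) has_derivative
      (\<lambda>v. frechet_derivative h (at (snd d (f m))) (frechet_derivative ?k (at (snd ?a m)) v)))
    (at (snd ?a m) within ?P)"
  proof (rule has_derivative_transform_within[OF has_derivative_at_withinI[OF hd] e(1)])
    show "snd ?a m \<in> ?P" using m a by auto
    fix z assume z: "z \<in> ?P" "dist z (snd ?a m) < e"
    then have "z \<in> ?N" using e(2) by (auto simp: dist_commute)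
    with z(1) obtain x where x: "x = chart_inv ?a z" "f x \<in> V" "f x \<in> fst d" "snd d (f x) \<in> Q"
      by (auto simp: chart_image_eq[OF a(3)])
    then show "h (?k z) = F (f (chart_inv ?a z))"
      using h(4)[of "snd d (f x)"] by (simp add: chart_inv_left[OF id])
  qed
  then have "has_diff A (f -` V) (\<lambda>x. F (f x)) m
    (\<lambda>v. frechet_derivative h (at (snd d (f m))) (frechet_derivative ?k (at (snd ?a m)) v))"
    unfolding has_diff_def .
  from has_diff_differential[OF A m(2) this] show ?thesis by simp
qed

section \<open>Rules of calculus for \<open>has_diff\<close>, and families of extensions\<close>

lemma has_diff_bilinear:
  assumes A: "smooth_atlas A" and p: "bounded_bilinear p" and f: "has_diff A S f m D" and g: "has_diff A S g m D'"
  shows "has_diff A S (\<lambda>x. p (f x) (g x)) m (\<lambda>v. p (f m) (D' v) + p (D v) (g m))"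
  using bounded_bilinear.FDERIV[OF p f[unfolded has_diff_def] g[unfolded has_diff_def]] ref_chart[OF A, of m]
  by (simp add: has_diff_def chart_inv_left)

lemma has_diff_bounded_linear:
  assumes L: "bounded_linear L" and f: "has_diff A S f m D"
  shows "has_diff A S (\<lambda>x. L (f x)) m (\<lambda>v. L (D v))"
  using bounded_linear.has_derivative[OF L f[unfolded has_diff_def]] by (simp add: has_diff_def)

lemma has_diff_sum:
  assumes "\<And>i. i \<in> I \<Longrightarrow> has_diff A S (f i) m (D i)"
  shows "has_diff A S (\<lambda>x. \<Sum>i\<in>I. f i x) m (\<lambda>v. \<Sum>i\<in>I. D i v)"
  using assms unfolding has_diff_def by (rule has_derivative_sum)

lemma has_diff_const: "has_diff A S (\<lambda>x. c) m (\<lambda>v. 0)"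
  unfolding has_diff_def by (rule has_derivative_const)

lemma has_diff_cis:
  assumes A: "smooth_atlas A" and f: "has_diff A S f m D"
  shows "has_diff A S (\<lambda>x. cis (f x)) m (\<lambda>v. D v *\<^sub>R (\<i> * cis (f m)))"
proof -
  have "(cis has_derivative (\<lambda>v. v *\<^sub>R (\<i> * cis (f m)))) (at (f (chart_inv (ref_chart A m) (snd (ref_chart A m) m))))"
    using has_derivative_cis ref_chart[OF A, of m] by (simp add: chart_inv_left)
  from has_derivative_compose[OF f[unfolded has_diff_def] this] show ?thesis by (simp add: has_diff_def)
qed

lemma smooth_fun_family:
  fixes F :: "'i \<Rightarrow> 'w::topological_space \<Rightarrow> 'b::real_normed_vector"
  assumes B: "smooth_atlas B" and d: "d \<in> B" "w \<in> fst d" "w \<in> V" and I: "finite I"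
    and F: "\<And>i. i \<in> I \<Longrightarrow> smooth_fun_on B V (F i)"
  obtains Q h where "open Q" "snd d w \<in> Q" "\<And>i. i \<in> I \<Longrightarrow> smooth_on Q (h i)"
    "\<And>i z. i \<in> I \<Longrightarrow> z \<in> Q \<Longrightarrow> z \<in> snd d ` (V \<inter> fst d) \<Longrightarrow> h i z = F i (chart_inv d z)"
  by (rule smooth_germ_common[OF I, of "snd d ` (V \<inter> fst d)" "snd d w" "\<lambda>i u. F i (chart_inv d u)"])
    (rule smooth_fun_onD[OF B F d(3,1,2)], assumption, rule that, assumption+)

lemma smooth_fun_on_chart:
  assumes B: "smooth_atlas B" and d: "d \<in> B" and R: "open R" "smooth_on R h"
    and V: "\<And>w. w \<in> V \<Longrightarrow> w \<in> fst d \<and> snd d w \<in> R"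
  shows "smooth_fun_on B V (\<lambda>w. h (snd d w))"
proof (rule smooth_fun_onI[OF B])
  fix w assume w: "w \<in> V"
  have ch: "is_chart d" using B d atlas_chart by blast
  have "smooth_germ (snd d ` (V \<inter> fst d)) (snd d w) h"
    by (rule smooth_germ_smooth_on[OF R(1) _ R(2)]) (use V w in blast)
  then have "chart_germ d V w (\<lambda>u. h (snd d u))"
    by (rule smooth_germ_cong) (auto simp: chart_inv_left[OF ch])
  then show "\<exists>c\<in>B. w \<in> fst c \<and> chart_germ c V w (\<lambda>u. h (snd d u))"
    using d V[OF w] by blast
qed

section \<open>The torus action and the actions\<close>

lemma unit_mult_cnj: "norm z = 1 \<Longrightarrow> cnj z * z = 1"
  by (metis complex_norm_square mult.commute of_real_1 power_one)

lemma torus_norm: "z \<in> torus \<Longrightarrow> norm (z $ \<nu>) = 1"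
  by (simp add: torus_def)

text \<open>The global data with one trivialization \<Phi>. The equation \<open>dim_W\<close> makes
  the linear system square. The distribution \<open>E\<close> is a parameter;
  \<open>action_chartI\<close> ties it to the pseudo-orthogonal one.\<close>

locale torus_structure =
  fixes A :: "('m::topological_space, 'e::euclidean_space) chart set"
    and B :: "('w::topological_space, 'f::euclidean_space) chart set"
    and \<pi> :: "'m \<Rightarrow> 'w"
    and \<alpha> :: "'m \<Rightarrow> 'e \<Rightarrow> real"
    and n s :: nat
    and W' N :: "'w set"
    and \<Phi> :: "'m \<Rightarrow> complex ^ 'k"
    and xbar :: "nat \<Rightarrow> 'w \<Rightarrow> real"
    and E :: "'m \<Rightarrow> 'e set"
  assumes A: "smooth_atlas A" and B: "smooth_atlas B"
    and dim_M: "DIM('e) = 2 * n + 1" and dim_W: "CARD('k) + 2 * s = DIM('f) + 1"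
    and contact: "contact_form A n \<alpha>"
    and proj: "smooth_map_on A B UNIV \<pi>" and submersion: "\<And>m. surj (tangent_map A B \<pi> m)"
    and base: "regular_domain B W'"
    and angles: "angles_over A B \<pi> W' \<Phi>"
    and N: "open N" "W' \<subseteq> N" and xbar: "\<And>a. a \<in> {1..2 * s} \<Longrightarrow> smooth_fun_on B N (xbar a)"
    and independent: "\<And>w c. w \<in> N \<Longrightarrow>
          (\<And>v. (\<Sum>a=1..2 * s. c a * differential B N (xbar a) w v) = 0) \<Longrightarrow>
          \<forall>a\<in>{1..2 * s}. c a = 0"
    and transversal: "\<And>m. m \<in> \<pi> -` N \<Longrightarrow>
          range (\<lambda>c v. \<Sum>a=1..2 * s. c a * differential A (\<pi> -` N) (xbar a \<circ> \<pi>) m v)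
            \<inter> annihilator (E m) = {\<lambda>v. 0}"
begin

lemma one_form: "smooth_one_form A \<alpha>"
  using contact by (simp add: contact_form_def)

lemma proj_open: "open U \<Longrightarrow> open (\<pi> -` U)"
  using proj open_vimage unfolding smooth_map_on_def by blast

lemma thick: "\<pi> m \<in> W' \<Longrightarrow> thick_at A (\<pi> -` W') m"
  using regular_domain_thick_at[OF A B proj submersion base] by blast

lemma pullback_smooth: "smooth_fun_on B V F \<Longrightarrow> smooth_fun_on A (\<pi> -` V) (\<lambda>m. F (\<pi> m))"
  by (rule smooth_fun_on_compose[OF A B smooth_map_on_subset[OF proj]]) auto

section \<open>Inverse trivialization and generators of the torus action\<close>

definition G where "G = inv_into (\<pi> -` W') (\<lambda>m. (\<Phi> m, \<pi> m))"

lemma G_smooth: "smooth_map_on (product_atlas euclidean_atlas B) A (torus \<times> W') G"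
  using angles by (simp add: angles_over_def diffeo_on_def G_def)

lemma Phi_bij: "bij_betw (\<lambda>m. (\<Phi> m, \<pi> m)) (\<pi> -` W') (torus \<times> W')"
  using angles by (simp add: angles_over_def diffeo_on_def)

lemma Phi_torus: "\<pi> m \<in> W' \<Longrightarrow> \<Phi> m \<in> torus"
  using bij_betwE[OF Phi_bij] by auto

lemma Phi_smooth: "smooth_fun_on A (\<pi> -` W') (\<lambda>m. \<Phi> m $ \<nu>)"
  using smooth_map_on_productD[OF A B] angles smooth_fun_on_vec_nth[OF A]
  unfolding angles_over_def diffeo_on_def by blast

lemma Phi_G:
  assumes "z \<in> torus" "w \<in> W'"
  shows "\<Phi> (G (z, w)) = z" "\<pi> (G (z, w)) = w"
  using bij_betw_inv_into_right[OF Phi_bij, of "(z, w)"] assms by (auto simp: G_def)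

lemma G_Phi: "\<pi> m \<in> W' \<Longrightarrow> G (\<Phi> m, \<pi> m) = m"
  using bij_betw_inv_into_left[OF Phi_bij, of m] by (simp add: G_def)

text \<open>\<open>turn\<close>, \<open>curve\<close> and \<open>xi\<close> encode the torus action
  carried over by \<Phi>: \<open>curve m \<nu>\<close> is the orbit of m under the \<nu>-th circle,
  and \<open>xi m \<nu>\<close> its velocity, the coordinate vector of the angle \<nu>. Orbits lie
  in fibres, so \<open>xi\<close> makes sense over the boundary of W' too.\<close>

definition turn :: "'k \<Rightarrow> real \<Rightarrow> complex ^ 'k \<Rightarrow> complex ^ 'k" where
  "turn \<nu> t z = (\<chi> \<mu>. (if \<mu> = \<nu> then cis t else 1) * z $ \<mu>)"

definition curve :: "'m \<Rightarrow> 'k \<Rightarrow> real \<Rightarrow> 'm" where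
  "curve m \<nu> t = G (turn \<nu> t (\<Phi> m), \<pi> m)"

definition xi :: "'m \<Rightarrow> 'k \<Rightarrow> 'e" where
  "xi m \<nu> = vector_derivative (\<lambda>t. snd (ref_chart A m) (curve m \<nu> t)) (at 0)"

lemma turn_torus: "z \<in> torus \<Longrightarrow> turn \<nu> t z \<in> torus"
  by (simp add: torus_def turn_def norm_mult)

lemma curve:
  assumes "\<pi> m \<in> W'"
  shows "\<Phi> (curve m \<nu> t) = turn \<nu> t (\<Phi> m)" "\<pi> (curve m \<nu> t) = \<pi> m" "curve m \<nu> 0 = m"
proof -
  show "\<Phi> (curve m \<nu> t) = turn \<nu> t (\<Phi> m)" "\<pi> (curve m \<nu> t) = \<pi> m"
    using Phi_G[OF turn_torus[OF Phi_torus] assms] assms by (simp_all add: curve_def)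
  have "turn \<nu> 0 (\<Phi> m) = \<Phi> m" by (simp add: turn_def vec_eq_iff)
  then show "curve m \<nu> 0 = m" using G_Phi[OF assms] by (simp add: curve_def)
qed

lemma curve_smooth:
  assumes "\<pi> m \<in> W'"
  shows "smooth_map_on euclidean_atlas A UNIV (curve m \<nu>)"
proof -
  note eu = smooth_atlas_euclidean
  have "smooth_fun_on euclidean_atlas UNIV (\<lambda>t. turn \<nu> t (\<Phi> m))"
  proof (rule smooth_fun_on_vec[OF eu])
    fix \<mu>
    have "smooth_on UNIV cis" by (simp add: smooth_on_def Ck_on_cis)
    then have "smooth_fun_on euclidean_atlas UNIV (\<lambda>t. (if \<mu> = \<nu> then cis t else 1))"
      using smooth_fun_on_euclidean[of cis] smooth_fun_on_const[OF eu] by (cases "\<mu> = \<nu>") auto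
    from smooth_fun_on_mult[OF eu this smooth_fun_on_const[OF eu]]
    show "smooth_fun_on euclidean_atlas UNIV (\<lambda>t. turn \<nu> t (\<Phi> m) $ \<mu>)"
      by (simp add: turn_def)
  qed
  then have "smooth_map_on euclidean_atlas (product_atlas euclidean_atlas B) UNIV (\<lambda>t. (turn \<nu> t (\<Phi> m), \<pi> m))"
    using smooth_map_on_productI[OF eu B _ smooth_fun_on_continuous[OF eu] smooth_map_on_const[OF eu]] by blast
  from smooth_map_on_compose[OF eu smooth_atlas_product[OF eu B] A this G_smooth]
  show ?thesis
    using turn_torus[OF Phi_torus[OF assms]] assms by (auto simp: curve_def[abs_def])
qed

text \<open>Values of differentials on \<open>xi\<close> are computed by following the function
  along the orbit, instead of finding components of \<open>xi\<close>.\<close>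

lemma xi_derivative:
  fixes F :: "'m \<Rightarrow> 'b::real_normed_vector"
  assumes V: "V \<subseteq> W'" "\<pi> m \<in> V" and F: "has_diff A (\<pi> -` V) F m D"
    and h: "((\<lambda>t. F (curve m \<nu> t)) has_vector_derivative h) (at 0)"
  shows "D (xi m \<nu>) = h"
proof -
  let ?c = "ref_chart A m"
  note c = ref_chart[OF A, of m] and eu = smooth_atlas_euclidean
  have m: "\<pi> m \<in> W'" using V by blast
  note cm = curve[OF m] curve_smooth[OF m]
  have R: "(UNIV, id) \<in> euclidean_atlas" by (simp add: euclidean_atlas_def)
  have "smooth_germ UNIV (0::real) (\<lambda>t. snd ?c (curve m \<nu> t))"
    using smooth_map_onD[OF eu A cm(4) UNIV_I R _ c(1), of 0] c cm(3) by (simp add: chart_inv_def inv_id)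
  then have xi: "((\<lambda>t. snd ?c (curve m \<nu> t)) has_vector_derivative xi m \<nu>) (at 0)"
    unfolding xi_def
    by (metis smooth_germ_has_derivative UNIV_I differentiableI vector_derivative_works)
  have "open (curve m \<nu> -` fst ?c)"
    using cm(4) chart_open[OF c(3)] open_vimage unfolding smooth_map_on_def by blast
  moreover have "0 \<in> curve m \<nu> -` fst ?c" using cm(3) c by simp
  ultimately obtain e where e: "e > 0" "ball 0 e \<subseteq> curve m \<nu> -` fst ?c"
    using open_contains_ball by blast
  have "curve m \<nu> t \<in> \<pi> -` V \<inter> fst ?c" if "\<bar>t\<bar> < e" for t
    using subsetD[OF e(2), of t] that cm(2) V by simp
  from has_diff_along_curve[OF A F cm(3) e(1) this xi]
  show ?thesis using h vector_derivative_unique_at by blast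
qed

lemma xi_pullback:
  fixes F :: "'w \<Rightarrow> 'b::real_normed_vector"
  assumes V: "V \<subseteq> W'" "\<pi> m \<in> V" and F: "smooth_fun_on B V F"
  shows "differential A (\<pi> -` V) (\<lambda>m. F (\<pi> m)) m (xi m \<nu>) = 0"
proof (rule xi_derivative[OF V])
  show "has_diff A (\<pi> -` V) (\<lambda>m. F (\<pi> m)) m (differential A (\<pi> -` V) (\<lambda>m. F (\<pi> m)) m)"
    using smooth_has_diff[OF A pullback_smooth[OF F]] V by auto
  show "((\<lambda>t. F (\<pi> (curve m \<nu> t))) has_vector_derivative 0) (at 0)"
    using curve(2)[of m \<nu>] V by auto
qed

text \<open>The section on which all angles of \<Phi> are 0. It turns fibre-constant quantities
  upstairs into functions of the base, such as \<open>T\<close> and \<open>ybar\<close>.\<close>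

definition sec :: "'w \<Rightarrow> 'm" where "sec w = G (1, w)"

lemma one_torus: "(1 :: complex ^ 'k) \<in> torus"
  by (simp add: torus_def)

lemma sec:
  assumes "w \<in> W'"
  shows "\<Phi> (sec w) = 1" "\<pi> (sec w) = w"
  using Phi_G[OF one_torus assms] by (simp_all add: sec_def)

lemma sec_smooth: "smooth_map_on B A W' sec"
proof -
  note eu = smooth_atlas_euclidean
  have "smooth_map_on B (product_atlas euclidean_atlas B) W' (\<lambda>w. (1 :: complex ^ 'k, w))"
    by (rule smooth_map_on_productI[OF B B smooth_fun_on_const[OF B] continuous_on_const smooth_map_on_id[OF B]])
  from smooth_map_on_compose[OF B smooth_atlas_product[OF eu B] A this G_smooth]
  show ?thesis using one_torus by (auto simp: sec_def[abs_def])
qed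

text \<open>The actions are the momenta of the generators \<open>xi\<close> of the torus action, hence independent of the
  local coordinates.\<close>

definition ybar :: "'k \<Rightarrow> 'w \<Rightarrow> real" where
  "ybar \<nu> w = \<alpha> (sec w) (xi (sec w) \<nu>)"

abbreviation d' where "d' \<equiv> differential A (\<pi> -` W')"

text \<open>The transversality and independence hypotheses concern differentials over the open set
  N, the construction those over W'; at points over W' the two agree, and both factor through the
  base.\<close>

lemma xbar_differential:
  assumes "\<pi> m \<in> W'" "a \<in> {1..2 * s}"
  shows "d' (\<lambda>m. xbar a (\<pi> m)) m v =
      differential B N (xbar a) (\<pi> m) (tangent_map A B \<pi> m v)"
    and "differential A (\<pi> -` N) (xbar a \<circ> \<pi>) m v =
      d' (\<lambda>m. xbar a (\<pi> m)) m v"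
proof -
  have m: "\<pi> m \<in> N" using assms N by blast
  have 1: "has_diff A (\<pi> -` N) (\<lambda>m. xbar a (\<pi> m)) m
      (\<lambda>v. differential B N (xbar a) (\<pi> m) (tangent_map A B \<pi> m v))"
    by (rule has_diff_pullback[OF A B proj _ smooth_has_diff[OF B xbar[OF assms(2)] m]]) (use m in simp)
  have 2: "thick_at A (\<pi> -` N) m"
    by (rule thick_at_mono[OF A thick[OF assms(1)] open_UNIV]) (use N in auto)
  show e: "d' (\<lambda>m. xbar a (\<pi> m)) m v =
      differential B N (xbar a) (\<pi> m) (tangent_map A B \<pi> m v)"
    using has_diff_differential[OF A thick[OF assms(1)] has_diff_subset[OF 1]] N by (simp add: vimage_mono)
  show "differential A (\<pi> -` N) (xbar a \<circ> \<pi>) m v =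
      d' (\<lambda>m. xbar a (\<pi> m)) m v"
    using has_diff_differential[OF A 2 1] e by (simp add: o_def)
qed

end

text \<open>One local action-angle system. That the y and x come from a chart of the base enters as
  smoothness of each of them; \<open>translation\<close> ties the local angles to the fixed
  trivialization \<Phi>.\<close>

locale action_chart = torus_structure A B \<pi> \<alpha> n s W' N \<Phi> xbar E
  for A :: "('m::topological_space, 'e::euclidean_space) chart set"
    and B :: "('w::topological_space, 'f::euclidean_space) chart set"
    and \<pi> \<alpha> n s W' N and \<Phi> :: "'m \<Rightarrow> complex ^ 'k" and xbar E +
  fixes V :: "'w set" and \<Theta> :: "'m \<Rightarrow> complex ^ 'k"
    and y :: "'k \<Rightarrow> 'w \<Rightarrow> real" and x g :: "nat \<Rightarrow> 'w \<Rightarrow> real"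
  assumes V: "openin (top_of_set W') V"
    and Theta_angles: "angles_over A B \<pi> V \<Theta>"
    and translation: "differ_by_translation \<pi> V \<Theta> \<Phi>"
    and y_smooth: "\<And>\<nu>. smooth_fun_on B V (y \<nu>)"
    and y_integral: "\<And>\<nu>. first_integral_on A E (\<pi> -` V) (\<lambda>m. y \<nu> (\<pi> m))"
    and x_smooth: "\<And>a. a \<in> {1..2 * s} \<Longrightarrow> smooth_fun_on B V (x a)"
    and g_smooth: "\<And>a. a \<in> {1..2 * s} \<Longrightarrow> smooth_fun_on B V (g a)"
    and form: "\<And>m v. \<pi> m \<in> V \<Longrightarrow> \<alpha> m v =
           (\<Sum>\<nu>\<in>UNIV. y \<nu> (\<pi> m) * d_angle A (\<pi> -` V) (\<lambda>m. \<Theta> m $ \<nu>) m v) +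
           (\<Sum>a=1..2 * s. g a (\<pi> m) * differential A (\<pi> -` V) (\<lambda>m. x a (\<pi> m)) m v)"
begin

abbreviation d where "d \<equiv> differential A (\<pi> -` V)"

lemma V_sub: "V \<subseteq> W'"
  using V openin_imp_subset by blast

lemma V_thick: "\<pi> m \<in> V \<Longrightarrow> thick_at A (\<pi> -` V) m"
proof -
  assume m: "\<pi> m \<in> V"
  obtain U where U: "open U" "V = W' \<inter> U" using V openin_open by metis
  show ?thesis
    by (rule thick_at_mono[OF A thick proj_open[OF U(1)]]) (use m U in auto)
qed

lemma d_local: "\<pi> m \<in> V \<Longrightarrow> d F m = d' F m"
proof -
  assume m: "\<pi> m \<in> V"
  obtain U where U: "open U" "V = W' \<inter> U" using V openin_open by metis
  show ?thesis
    by (rule differential_local[OF A proj_open[OF U(1)]]) (use m U in auto)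
qed

lemma d_has_diff:
  "smooth_fun_on A (\<pi> -` V) F \<Longrightarrow> \<pi> m \<in> V \<Longrightarrow> has_diff A (\<pi> -` V) F m (d F m)"
  using smooth_has_diff[OF A] by auto

lemma has_diff_d: "\<pi> m \<in> V \<Longrightarrow> has_diff A (\<pi> -` V) F m D \<Longrightarrow> d F m = D"
  using has_diff_differential[OF A V_thick] .

lemma Theta_smooth: "smooth_fun_on A (\<pi> -` V) (\<lambda>m. \<Theta> m $ \<nu>)"
  using smooth_map_on_productD[OF A B] Theta_angles smooth_fun_on_vec_nth[OF A]
  unfolding angles_over_def diffeo_on_def by blast

lemma Theta_norm: "\<pi> m \<in> V \<Longrightarrow> norm (\<Theta> m $ \<nu>) = 1"
proof -
  assume "\<pi> m \<in> V"
  then have "\<Theta> m \<in> torus"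
    using Theta_angles unfolding angles_over_def diffeo_on_def by (auto dest!: bij_betwE)
  then show ?thesis by (rule torus_norm)
qed

text \<open>The translation carrying \<Phi> to \<Theta>. \<open>differ_by_translation\<close>
  promises no smoothness; reading the translation off where \<Phi> = 1 shows that it is
  smooth.\<close>

definition T :: "'k \<Rightarrow> 'w \<Rightarrow> complex" where "T \<nu> w = \<Theta> (sec w) $ \<nu>"

lemma T_smooth: "smooth_fun_on B V (T \<nu>)"
  unfolding T_def
  by (rule smooth_fun_on_compose[OF B A smooth_map_on_subset[OF sec_smooth V_sub] Theta_smooth])
    (use sec V_sub in auto)

lemma T_norm: "w \<in> V \<Longrightarrow> norm (T \<nu> w) = 1"
  unfolding T_def by (rule Theta_norm) (use sec V_sub in auto)

lemma Theta_eq: "\<pi> m \<in> V \<Longrightarrow> \<Theta> m $ \<nu> = T \<nu> (\<pi> m) * \<Phi> m $ \<nu>"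
proof -
  assume m: "\<pi> m \<in> V"
  then have w: "\<pi> m \<in> W'" using V_sub by blast
  obtain \<tau> where \<tau>: "\<And>m. \<pi> m \<in> V \<Longrightarrow> \<Phi> m $ \<nu> = \<tau> (\<pi> m) $ \<nu> * \<Theta> m $ \<nu>"
    using translation unfolding differ_by_translation_def by blast
  \<comment> \<open>\<open>differ_by_translation\<close> expresses \<Phi> through \<Theta>; at the
    section, where \<Phi> = 1, this shows that T inverts \<tau>.\<close>
  have 1: "1 = \<tau> (\<pi> m) $ \<nu> * T \<nu> (\<pi> m)"
    using \<tau>[of "sec (\<pi> m)"] sec[OF w] m by (simp add: T_def)
  have "T \<nu> (\<pi> m) * \<Phi> m $ \<nu> = (\<tau> (\<pi> m) $ \<nu> * T \<nu> (\<pi> m)) * \<Theta> m $ \<nu>"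
    using \<tau>[OF m] by simp
  then show ?thesis using 1 by simp
qed

text \<open>The generators are defined by \<Phi>, but \<Theta> is \<Phi> times a factor that is
  constant along the fibre, so both turn at the same rate.\<close>

lemma d_Theta_xi:
  assumes m: "\<pi> m \<in> V"
  shows "d (\<lambda>m. \<Theta> m $ \<mu>) m (xi m \<nu>) = (if \<mu> = \<nu> then \<i> * \<Theta> m $ \<mu> else 0)"
proof (rule xi_derivative[OF V_sub m d_has_diff[OF Theta_smooth m]])
  have w: "\<pi> m \<in> W'" using V_sub m by blast
  have "\<Theta> (curve m \<nu> t) $ \<mu> = (if \<mu> = \<nu> then cis t else 1) * \<Theta> m $ \<mu>" for t
    using m curve[OF w] by (simp add: Theta_eq turn_def)
  moreover have "(cis has_vector_derivative \<i>) (at 0)"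
    using has_derivative_cis[of 0] by (simp add: has_vector_derivative_def)
  ultimately show "((\<lambda>t. \<Theta> (curve m \<nu> t) $ \<mu>) has_vector_derivative (if \<mu> = \<nu> then \<i> * \<Theta> m $ \<mu> else 0)) (at 0)"
    by (auto intro!: derivative_eq_intros)
qed

lemma d_pullback_xi:
  fixes F :: "'w \<Rightarrow> 'b::real_normed_vector"
  shows "\<pi> m \<in> V \<Longrightarrow> smooth_fun_on B V F \<Longrightarrow> d (\<lambda>m. F (\<pi> m)) m (xi m \<nu>) = 0"
  using xi_pullback[OF V_sub] .

text \<open>The angle forms are dual to the generators, and differentials pulled back from the base
  vanish on them.\<close>

lemma alpha_xi:
  assumes m: "\<pi> m \<in> V"
  shows "\<alpha> m (xi m \<nu>) = y \<nu> (\<pi> m)"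
proof -
  have "d_angle A (\<pi> -` V) (\<lambda>m. \<Theta> m $ \<mu>) m (xi m \<nu>) = (if \<mu> = \<nu> then 1 else 0)" for \<mu>
  proof -
    show ?thesis
      using Theta_norm[OF m, of \<mu>]
      by (cases "\<mu> = \<nu>") (simp_all add: d_angle_def d_Theta_xi[OF m] norm_complex_def power2_eq_square)
  qed
  moreover have "g a (\<pi> m) * d (\<lambda>m. x a (\<pi> m)) m (xi m \<nu>) = 0" if "a \<in> {1..2 * s}" for a
    using d_pullback_xi[OF m x_smooth[OF that]] by simp
  ultimately show ?thesis unfolding form[OF m]
    by (simp add: sum.neutral if_distrib[where f = "(*) _"] cong: if_cong)
qed

lemma y_ybar: "w \<in> V \<Longrightarrow> y \<nu> w = ybar \<nu> w"
  using alpha_xi[of "sec w" \<nu>] sec(2)[of w] V_sub by (simp add: ybar_def subset_iff)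

lemma d_cong:
  assumes "\<pi> m \<in> V" "smooth_fun_on A (\<pi> -` V) F" "\<And>m. \<pi> m \<in> V \<Longrightarrow> F m = F' m"
  shows "d F m = d F' m"
  using has_diff_d[OF assms(1) has_diff_transform[OF A d_has_diff[OF assms(2,1)], of F']] assms by simp

text \<open>The angle form of a product is the sum of the angle forms. That of the translation T is
  written with real and imaginary parts, which are real functions on the base with smooth
  extensions; the last two sums together are the pullback of \<beta>.\<close>

lemma form_Phi:
  assumes m: "\<pi> m \<in> V"
  shows "\<alpha> m v =
    (\<Sum>\<nu>\<in>UNIV. y \<nu> (\<pi> m) * d_angle A (\<pi> -` V) (\<lambda>m. \<Phi> m $ \<nu>) m v) +
    (\<Sum>\<nu>\<in>UNIV. y \<nu> (\<pi> m) * (Re (T \<nu> (\<pi> m)) * d (\<lambda>m. Im (T \<nu> (\<pi> m))) m v -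
      Im (T \<nu> (\<pi> m)) * d (\<lambda>m. Re (T \<nu> (\<pi> m))) m v)) +
    (\<Sum>a=1..2 * s. g a (\<pi> m) * d (\<lambda>m. x a (\<pi> m)) m v)"
proof -
  have "d_angle A (\<pi> -` V) (\<lambda>m. \<Theta> m $ \<nu>) m v = d_angle A (\<pi> -` V) (\<lambda>m. \<Phi> m $ \<nu>) m v +
    (Re (T \<nu> (\<pi> m)) * d (\<lambda>m. Im (T \<nu> (\<pi> m))) m v - Im (T \<nu> (\<pi> m)) * d (\<lambda>m. Re (T \<nu> (\<pi> m))) m v)" for \<nu>
  proof -
    let ?T = "\<lambda>m. T \<nu> (\<pi> m)" and ?P = "\<lambda>m. \<Phi> m $ \<nu>"
    have hT: "has_diff A (\<pi> -` V) ?T m (d ?T m)"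
      by (rule d_has_diff[OF pullback_smooth[OF T_smooth] m])
    have hP: "has_diff A (\<pi> -` V) ?P m (d ?P m)"
      by (rule d_has_diff[OF smooth_fun_on_subset[OF Phi_smooth] m]) (use V_sub in auto)
    have re: "d (\<lambda>m. Re (?T m)) m v = Re (d ?T m v)" and im: "d (\<lambda>m. Im (?T m)) m v = Im (d ?T m v)"
      using has_diff_d[OF m has_diff_bounded_linear[OF bounded_linear_Re hT]]
        has_diff_d[OF m has_diff_bounded_linear[OF bounded_linear_Im hT]] by simp_all
    have "d (\<lambda>m. \<Theta> m $ \<nu>) m = d (\<lambda>m. ?T m * ?P m) m"
      by (rule d_cong[OF m Theta_smooth Theta_eq])
    also have "\<dots> = (\<lambda>v. ?T m * d ?P m v + d ?T m v * ?P m)"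
      by (rule has_diff_d[OF m has_diff_bilinear[OF A bounded_bilinear_mult hT hP]])
    finally have dT: "d (\<lambda>m. \<Theta> m $ \<nu>) m v = ?T m * d ?P m v + d ?T m v * ?P m" by simp
    have u: "cnj (?T m) * ?T m = 1" "cnj (?P m) * ?P m = 1"
      using unit_mult_cnj T_norm[OF m] torus_norm[OF Phi_torus] V_sub m by blast+
    have "cnj (\<Theta> m $ \<nu>) * d (\<lambda>m. \<Theta> m $ \<nu>) m v =
      (cnj (?T m) * ?T m) * (cnj (?P m) * d ?P m v) + (cnj (?P m) * ?P m) * (cnj (?T m) * d ?T m v)"
      unfolding dT Theta_eq[OF m] by (simp add: algebra_simps)
    also have "\<dots> = cnj (?P m) * d ?P m v + cnj (?T m) * d ?T m v" unfolding u by simp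
    finally show ?thesis unfolding d_angle_def re im by simp
  qed
  then show ?thesis unfolding form[OF m] by (simp add: distrib_left sum.distrib)
qed

text \<open>Locally d\<alpha> = \<Sum> dy \<and> d\<theta> + \<Sum> dg \<and> dx. Contraction with
  \<Sum> f \<xi> kills all pulled back differentials and takes the \<nu>-th angle form to
  \<open>f \<nu>\<close>, which leaves - \<Sum> f dy.\<close>

lemma ext_deriv_xi:
  assumes m: "\<pi> m \<in> V"
  shows "ext_deriv A \<alpha> m (\<Sum>\<nu>\<in>UNIV. f \<nu> *\<^sub>R xi m \<nu>) v = - (\<Sum>\<nu>\<in>UNIV. f \<nu> * d (\<lambda>m. y \<nu> (\<pi> m)) m v)"
proof -
  let ?z = "\<Sum>\<nu>\<in>UNIV. f \<nu> *\<^sub>R xi m \<nu>"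
  let ?Y = "\<lambda>\<nu> m. y \<nu> (\<pi> m)" and ?R = "\<lambda>\<nu> m. Re (\<Theta> m $ \<nu>)" and ?J = "\<lambda>\<nu> m. Im (\<Theta> m $ \<nu>)"
  \<comment> \<open>An angle is not a real-valued function, so y d\<theta> is rewritten as y Re
    \<Theta> d(Im \<Theta>) - y Im \<Theta> d(Re \<Theta>). The sum type collects these terms and
    the g dx in one finite index set, as \<open>ext_deriv_local_sum\<close> expects.\<close>
  define F where "F = case_sum (case_sum (\<lambda>\<nu> m. ?Y \<nu> m * ?R \<nu> m) (\<lambda>\<nu> m. ?Y \<nu> m * - ?J \<nu> m)) (\<lambda>a m. g a (\<pi> m))"
  define H where "H = case_sum (case_sum ?J ?R) (\<lambda>a m. x a (\<pi> m))"
  let ?I = "(UNIV <+> UNIV) <+> {1..2 * s} :: (('k + 'k) + nat) set"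
  note Ys = pullback_smooth[OF y_smooth]
  have Rs: "smooth_fun_on A (\<pi> -` V) (?R \<nu>)" and Js: "smooth_fun_on A (\<pi> -` V) (?J \<nu>)"
    and Jns: "smooth_fun_on A (\<pi> -` V) (\<lambda>m. - ?J \<nu> m)" for \<nu>
    by (rule smooth_fun_on_linear[OF A Theta_smooth],
        intro bounded_linear_compose[OF bounded_linear_Re] bounded_linear_compose[OF bounded_linear_Im]
          bounded_linear_minus bounded_linear_vec_nth bounded_linear_Re bounded_linear_Im)+
  have Fs: "smooth_fun_on A (\<pi> -` V) (F i)" if "i \<in> ?I" for i
    using that smooth_fun_on_mult[OF A Ys Rs] smooth_fun_on_mult[OF A Ys Jns] pullback_smooth[OF g_smooth]
    by (auto simp: F_def split: sum.split)
  have Hs: "smooth_fun_on A (\<pi> -` V) (H i)" if "i \<in> ?I" for i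
    using that Js Rs pullback_smooth[OF x_smooth] by (auto simp: H_def split: sum.split)
  have sum_I: "(\<Sum>i\<in>?I. h i) = (\<Sum>\<nu>\<in>UNIV. h (Inl (Inl \<nu>)) + h (Inl (Inr \<nu>))) + (\<Sum>a=1..2 * s. h (Inr a))"
    for h :: "('k + 'k) + nat \<Rightarrow> real"
    by (subst sum.Plus; simp) (subst UNIV_Plus_UNIV[symmetric], subst sum.Plus; simp add: sum.distrib)
  have dR: "d (?R \<nu>) m = (\<lambda>v. Re (d (\<lambda>m. \<Theta> m $ \<nu>) m v))"
    and dJ: "d (?J \<nu>) m = (\<lambda>v. Im (d (\<lambda>m. \<Theta> m $ \<nu>) m v))" if "\<pi> m \<in> V" for m \<nu>
    using has_diff_d[OF that has_diff_bounded_linear[OF bounded_linear_Re d_has_diff[OF Theta_smooth that]]]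
      has_diff_d[OF that has_diff_bounded_linear[OF bounded_linear_Im d_has_diff[OF Theta_smooth that]]]
    by simp_all
  have "\<alpha> m' w = (\<Sum>i\<in>?I. F i m' * d (H i) m' w)" if "m' \<in> \<pi> -` V" for m' w
  proof -
    have m': "\<pi> m' \<in> V" using that by simp
    show ?thesis
      unfolding sum_I form[OF m'] d_angle_def
      by (simp add: F_def H_def dR[OF m'] dJ[OF m'] algebra_simps)
  qed
  then have "ext_deriv A \<alpha> m ?z v = (\<Sum>i\<in>?I. d (F i) m ?z * d (H i) m v - d (F i) m v * d (H i) m ?z)"
    by (intro ext_deriv_local_sum[OF A one_form V_thick _ Fs Hs]) (use m in auto)
  also have "\<dots> = (\<Sum>\<nu>\<in>UNIV. - (f \<nu> * d (?Y \<nu>) m v))"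
  proof -
    have lin: "d K m ?z = (\<Sum>\<nu>\<in>UNIV. f \<nu> *\<^sub>R d K m (xi m \<nu>))" if "smooth_fun_on A (\<pi> -` V) K"
      for K :: "'m \<Rightarrow> 'b::real_normed_vector"
      using has_diff_linear[OF d_has_diff[OF that m]] by (simp add: linear_sum linear_scale)
    have pull: "d (\<lambda>m. K (\<pi> m)) m ?z = 0" if "smooth_fun_on B V K" for K :: "'w \<Rightarrow> real"
      unfolding lin[OF pullback_smooth[OF that]] using d_pullback_xi[OF m that] by simp
    have Th: "d (\<lambda>m. \<Theta> m $ \<mu>) m ?z = f \<mu> *\<^sub>R (\<i> * \<Theta> m $ \<mu>)" for \<mu>
    proof -
      have "d (\<lambda>m. \<Theta> m $ \<mu>) m ?z = (\<Sum>\<nu>\<in>UNIV. if \<mu> = \<nu> then f \<nu> *\<^sub>R (\<i> * \<Theta> m $ \<mu>) else 0)"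
        unfolding lin[OF Theta_smooth] d_Theta_xi[OF m] by (intro sum.cong) auto
      then show ?thesis by simp
    qed
    have Rz: "d (?R \<nu>) m ?z = - f \<nu> * ?J \<nu> m" and Jz: "d (?J \<nu>) m ?z = f \<nu> * ?R \<nu> m" for \<nu>
      by (simp_all add: dR[OF m] dJ[OF m] Th)
    have prod: "d (\<lambda>m. ?Y \<nu> m * K m) m = (\<lambda>v. ?Y \<nu> m * d K m v + d (?Y \<nu>) m v * K m)"
      if "smooth_fun_on A (\<pi> -` V) K" for K \<nu>
      by (rule has_diff_d[OF m has_diff_bilinear[OF A bounded_bilinear_mult d_has_diff[OF Ys m] d_has_diff[OF that m]]])
    have neg: "d (\<lambda>m. - ?J \<nu> m) m = (\<lambda>v. - d (?J \<nu>) m v)" for \<nu>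
      by (rule has_diff_d[OF m has_diff_bounded_linear[OF bounded_linear_minus[OF bounded_linear_ident] d_has_diff[OF Js m]]])
    have one: "?R \<nu> m * ?R \<nu> m + ?J \<nu> m * ?J \<nu> m = 1" if "\<pi> m \<in> V" for m \<nu>
      using Theta_norm[OF that, of \<nu>] by (simp add: norm_complex_def power2_eq_square)
    \<comment> \<open>The derivative of the relation \<open>one\<close>, which holds on the whole
      preimage of V. It removes the terms of \<open>tw\<close> that carry y
      undifferentiated.\<close>
    have orth: "?R \<nu> m * d (?R \<nu>) m v + ?J \<nu> m * d (?J \<nu>) m v = 0" for \<nu>
    proof -
      let ?k = "\<lambda>v. (?R \<nu> m * d (?R \<nu>) m v + d (?R \<nu>) m v * ?R \<nu> m) + (?J \<nu> m * d (?J \<nu>) m v + d (?J \<nu>) m v * ?J \<nu> m)"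
      note h = has_diff_bilinear[OF A bounded_bilinear_mult d_has_diff[OF Rs m, of \<nu>] d_has_diff[OF Rs m, of \<nu>]]
        has_diff_bilinear[OF A bounded_bilinear_mult d_has_diff[OF Js m, of \<nu>] d_has_diff[OF Js m, of \<nu>]]
      have "has_diff A (\<pi> -` V) (\<lambda>m. 1 - ?J \<nu> m * ?J \<nu> m) m
        (\<lambda>v. ?R \<nu> m * d (?R \<nu>) m v + d (?R \<nu>) m v * ?R \<nu> m)"
        by (rule has_diff_transform[OF A h(1)]) (use m one in \<open>auto simp: eq_diff_eq\<close>)
      then have "has_diff A (\<pi> -` V) (\<lambda>m. (1 - ?J \<nu> m * ?J \<nu> m) + ?J \<nu> m * ?J \<nu> m) m
        ?k"
        using h(2) unfolding has_diff_def by (rule has_derivative_add)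
      then have "has_diff A (\<pi> -` V) (\<lambda>m. 1 :: real) m
        ?k"
        by simp
      from has_diff_d[OF m this] has_diff_d[OF m has_diff_const[of A _ "1 :: real"]]
      have "?k v = 0"
        by (metis (no_types, lifting))
      then show ?thesis by (simp add: mult.commute)
    qed
    have tw: "(d (\<lambda>m. ?Y \<nu> m * ?R \<nu> m) m ?z * d (?J \<nu>) m v - d (\<lambda>m. ?Y \<nu> m * ?R \<nu> m) m v * d (?J \<nu>) m ?z) +
      (d (\<lambda>m. ?Y \<nu> m * - ?J \<nu> m) m ?z * d (?R \<nu>) m v - d (\<lambda>m. ?Y \<nu> m * - ?J \<nu> m) m v * d (?R \<nu>) m ?z) =
      - (f \<nu> * d (?Y \<nu>) m v)" (is "?L = _") for \<nu>
    proof -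
      have "?L = - f \<nu> * d (?Y \<nu>) m v * (?R \<nu> m * ?R \<nu> m + ?J \<nu> m * ?J \<nu> m) -
        2 * f \<nu> * ?Y \<nu> m * (?R \<nu> m * d (?R \<nu>) m v + ?J \<nu> m * d (?J \<nu>) m v)"
        unfolding prod[OF Rs] prod[OF Jns] neg pull[OF y_smooth] Rz Jz by (simp add: algebra_simps)
      then show ?thesis unfolding orth one[OF m] by simp
    qed
    show ?thesis
      unfolding sum_I F_def H_def sum.case tw by (simp add: pull g_smooth x_smooth)
  qed
  finally show ?thesis by (simp add: sum_negf)
qed

lemma nondegenerate:
  assumes m: "\<pi> m \<in> V" and y0: "(\<Sum>\<nu>\<in>UNIV. y \<nu> (\<pi> m) * f \<nu>) = 0"
    and eq: "\<And>v. (\<Sum>\<nu>\<in>UNIV. f \<nu> * d (\<lambda>m. y \<nu> (\<pi> m)) m v) =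
      (\<Sum>a=1..2 * s. c a * d (\<lambda>m. xbar a (\<pi> m)) m v)"
  shows "\<forall>\<nu>. f \<nu> = 0" "\<forall>a\<in>{1..2 * s}. c a = 0"
proof -
  have w: "\<pi> m \<in> W'" "\<pi> m \<in> N" using V_sub m N by auto
  let ?X = "\<lambda>v. \<Sum>a=1..2 * s. c a * differential A (\<pi> -` N) (xbar a \<circ> \<pi>) m v"
  have X: "?X v = (\<Sum>\<nu>\<in>UNIV. f \<nu> * d (\<lambda>m. y \<nu> (\<pi> m)) m v)" for v
    unfolding eq by (intro sum.cong) (simp_all add: xbar_differential(2)[OF w(1)] d_local[OF m])
  \<comment> \<open>By \<open>X\<close> this combination of the d xbar is \<Sum> f dy, and the y are
    first integrals of E.\<close>
  have "?X \<in> annihilator (E m)"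
    unfolding annihilator_def X
  proof (intro CollectI conjI ballI)
    show "linear (\<lambda>v. \<Sum>\<nu>\<in>UNIV. f \<nu> * d (\<lambda>m. y \<nu> (\<pi> m)) m v)"
      using linear_real_scale(2)[OF has_diff_linear[OF d_has_diff[OF pullback_smooth[OF y_smooth] m]], of 1]
      by (intro linear_compose_sum) simp
    show "(\<Sum>\<nu>\<in>UNIV. f \<nu> * d (\<lambda>m. y \<nu> (\<pi> m)) m v) = 0" if "v \<in> E m" for v
      using y_integral m that unfolding first_integral_on_def by (simp add: sum.neutral)
  qed
  then have "?X = (\<lambda>v. 0)"
    using transversal[of m] w(2) by blast
  then have X0: "?X v = 0" for v by meson
  \<comment> \<open>Independence is assumed on the base; a submersion reaches every tangent vector u
    of the base from some v.\<close>
  have "(\<Sum>a=1..2 * s. c a * differential B N (xbar a) (\<pi> m) u) = 0" for u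
  proof -
    obtain v where "u = tangent_map A B \<pi> m v" using submersion[of m] by (metis surjD)
    then show ?thesis
      using X0[of v] sum.cong[OF refl, of "{1..2 * s}" "\<lambda>a. c a * differential A (\<pi> -` N) (xbar a \<circ> \<pi>) m v"
          "\<lambda>a. c a * differential B N (xbar a) (\<pi> m) u"] xbar_differential[OF w(1), of _ v] by simp
  qed
  then show "\<forall>a\<in>{1..2 * s}. c a = 0" by (rule independent[OF w(2)])
  let ?z = "\<Sum>\<nu>\<in>UNIV. f \<nu> *\<^sub>R xi m \<nu>"
  have lin: "linear (\<alpha> m)" using one_form by (simp add: smooth_one_form_def)
  \<comment> \<open>In the kernel of \<alpha> by \<open>y0\<close>, and of d\<alpha> because \<Sum>
    f dy is now known to vanish.\<close>
  have "?z = 0"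
  proof (rule contact_form_no_kernel[OF A contact dim_M])
    show "\<alpha> m ?z = 0"
      using y0 by (simp add: linear_sum[OF lin] linear_scale[OF lin] alpha_xi[OF m] mult.commute)
    show "ext_deriv A \<alpha> m ?z v = 0" for v
      unfolding ext_deriv_xi[OF m] using X X0 by simp
  qed
  \<comment> \<open>The coefficients are recovered from \<open>?z\<close> by applying the
    differentials of the angles to it.\<close>
  show "\<forall>\<nu>. f \<nu> = 0"
  proof
    fix \<mu>
    have l: "linear (d (\<lambda>m. \<Theta> m $ \<mu>) m)" by (rule has_diff_linear[OF d_has_diff[OF Theta_smooth m]])
    have "0 = d (\<lambda>m. \<Theta> m $ \<mu>) m ?z" using linear_0[OF l] \<open>?z = 0\<close> by simp
    also have "\<dots> = (\<Sum>\<nu>\<in>UNIV. if \<mu> = \<nu> then f \<nu> *\<^sub>R (\<i> * \<Theta> m $ \<mu>) else 0)"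
      unfolding linear_sum[OF l] linear_scale[OF l] d_Theta_xi[OF m] by (intro sum.cong) auto
    finally have "f \<mu> *\<^sub>R (\<i> * \<Theta> m $ \<mu>) = 0" by simp
    moreover have "\<Theta> m $ \<mu> \<noteq> 0" using Theta_norm[OF m, of \<mu>] by auto
    ultimately show "f \<mu> = 0" by simp
  qed
qed

end

section \<open>Solution of the linear system and the new angles\<close>

text \<open>The linear system at w, tested on tangent vectors at every point of the fibre. Nothing
  in it refers to a local chart, so solutions found in different charts can be compared.\<close>

definition (in torus_structure) solves :: "'w \<Rightarrow> ('k \<Rightarrow> real) \<Rightarrow> (nat \<Rightarrow> real) \<Rightarrow> bool" where
  "solves w f c \<longleftrightarrow> (\<Sum>\<nu>\<in>UNIV. ybar \<nu> w * f \<nu>) = 0 \<and> (\<forall>m v. \<pi> m = w \<longrightarrow> \<alpha> m v =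
    (\<Sum>\<nu>\<in>UNIV. ybar \<nu> w * d_angle A (\<pi> -` W') (\<lambda>m. \<Phi> m $ \<nu>) m v) -
    (\<Sum>\<nu>\<in>UNIV. f \<nu> * d' (\<lambda>m. ybar \<nu> (\<pi> m)) m v) +
    (\<Sum>a=1..2 * s. c a * d' (\<lambda>m. xbar a (\<pi> m)) m v))"

context action_chart
begin

lemma d_ybar: "\<pi> m \<in> V \<Longrightarrow> d' (\<lambda>m. ybar \<nu> (\<pi> m)) m = d (\<lambda>m. y \<nu> (\<pi> m)) m"
  using d_cong[OF _ pullback_smooth[OF y_smooth], of m \<nu> "\<lambda>m. ybar \<nu> (\<pi> m)"] y_ybar
  by (simp add: d_local)

text \<open>One point of the fibre, \<open>sec w\<close>, already separates solutions: the
  difference of two satisfies the homogeneous system of \<open>nondegenerate\<close>.\<close>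

lemma solves_unique:
  assumes w: "w \<in> V" and f: "solves w f c" and f': "solves w f' c'"
  shows "f = f'" "\<forall>a\<in>{1..2 * s}. c a = c' a"
proof -
  let ?m = "sec w"
  have m: "\<pi> ?m = w" "\<pi> ?m \<in> V" using w V_sub sec by auto
  have 1: "(\<Sum>\<nu>\<in>UNIV. y \<nu> (\<pi> ?m) * (f \<nu> - f' \<nu>)) = 0"
    using f f' w by (simp add: solves_def m y_ybar right_diff_distrib sum_subtractf)
  have 2: "(\<Sum>\<nu>\<in>UNIV. (f \<nu> - f' \<nu>) * d (\<lambda>m. y \<nu> (\<pi> m)) ?m v) =
      (\<Sum>a=1..2 * s. (c a - c' a) * d (\<lambda>m. xbar a (\<pi> m)) ?m v)" for v
  proof -
    have "- (\<Sum>\<nu>\<in>UNIV. f \<nu> * d (\<lambda>m. y \<nu> (\<pi> m)) ?m v) + (\<Sum>a=1..2 * s. c a * d (\<lambda>m. xbar a (\<pi> m)) ?m v) =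
      - (\<Sum>\<nu>\<in>UNIV. f' \<nu> * d (\<lambda>m. y \<nu> (\<pi> m)) ?m v) + (\<Sum>a=1..2 * s. c' a * d (\<lambda>m. xbar a (\<pi> m)) ?m v)"
      using f[unfolded solves_def, THEN conjunct2, rule_format, OF m(1), of v]
        f'[unfolded solves_def, THEN conjunct2, rule_format, OF m(1), of v]
      unfolding d_ybar[OF m(2)] d_local[OF m(2), symmetric] by linarith
    then show ?thesis by (simp add: left_diff_distrib sum_subtractf)
  qed
  note nd = nondegenerate[OF m(2) 1 2]
  from nd(1) show "f = f'" by auto
  from nd(2) show "\<forall>a\<in>{1..2 * s}. c a = c' a" by simp
qed

text \<open>\<open>smooth_linear_solve\<close> needs an open domain, which V may lack at the
  boundary, so all data are extended first. The extended system coincides with the true one over V,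
  and its regularity at \<open>w0\<close> spreads to a neighbourhood through the pivots.\<close>

lemma local_solution:
  assumes w0: "w0 \<in> V"
  shows "\<exists>V' f c. openin (top_of_set W') V' \<and> w0 \<in> V' \<and> (\<forall>\<nu>. smooth_fun_on B V' (f \<nu>)) \<and>
    (\<forall>a\<in>{1..2 * s}. smooth_fun_on B V' (c a)) \<and>
    (\<forall>w\<in>V'. solves w (\<lambda>\<nu>. f \<nu> w) (\<lambda>a. c a w))"
proof -
  let ?d = "ref_chart B w0"
  note d0 = ref_chart[OF B, of w0]
  let ?P = "snd ?d ` (V \<inter> fst ?d)" and ?z0 = "snd ?d w0"
  have xbarV: "smooth_fun_on B V (xbar a)" if "a \<in> {1..2 * s}" for a
    using smooth_fun_on_subset[OF xbar[OF that]] V_sub N by blast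
  note ReT = smooth_fun_on_linear[OF B T_smooth bounded_linear_Re]
  note ImT = smooth_fun_on_linear[OF B T_smooth bounded_linear_Im]
  obtain Q1 Y where Y: "open Q1" "?z0 \<in> Q1" "\<And>\<nu>. \<nu> \<in> UNIV \<Longrightarrow> smooth_on Q1 (Y \<nu>)"
    "\<And>\<nu> z. \<nu> \<in> UNIV \<Longrightarrow> z \<in> Q1 \<Longrightarrow> z \<in> ?P \<Longrightarrow> Y \<nu> z = y \<nu> (chart_inv ?d z)"
    by (rule smooth_fun_family[OF B d0(1,2) w0 finite, of UNIV "y"]) (rule y_smooth, rule that, assumption+)
  obtain Q2 p where p: "open Q2" "?z0 \<in> Q2" "\<And>\<nu>. \<nu> \<in> UNIV \<Longrightarrow> smooth_on Q2 (p \<nu>)"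
    "\<And>\<nu> z. \<nu> \<in> UNIV \<Longrightarrow> z \<in> Q2 \<Longrightarrow> z \<in> ?P \<Longrightarrow> p \<nu> z = Re (T \<nu> (chart_inv ?d z))"
    by (rule smooth_fun_family[OF B d0(1,2) w0 finite, of UNIV "\<lambda>\<nu> w. Re (T \<nu> w)"]) (rule ReT, rule that, assumption+)
  obtain Q3 q where q: "open Q3" "?z0 \<in> Q3" "\<And>\<nu>. \<nu> \<in> UNIV \<Longrightarrow> smooth_on Q3 (q \<nu>)"
    "\<And>\<nu> z. \<nu> \<in> UNIV \<Longrightarrow> z \<in> Q3 \<Longrightarrow> z \<in> ?P \<Longrightarrow> q \<nu> z = Im (T \<nu> (chart_inv ?d z))"
    by (rule smooth_fun_family[OF B d0(1,2) w0 finite, of UNIV "\<lambda>\<nu> w. Im (T \<nu> w)"]) (rule ImT, rule that, assumption+)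
  obtain Q4 k where k: "open Q4" "?z0 \<in> Q4" "\<And>a. a \<in> {1..2 * s} \<Longrightarrow> smooth_on Q4 (k a)"
    "\<And>a z. a \<in> {1..2 * s} \<Longrightarrow> z \<in> Q4 \<Longrightarrow> z \<in> ?P \<Longrightarrow> k a z = g a (chart_inv ?d z)"
    by (rule smooth_fun_family[OF B d0(1,2) w0 finite_atLeastAtMost, of 1 "2 * s" g]) (rule g_smooth, assumption, rule that, assumption+)
  obtain Q5 X where X: "open Q5" "?z0 \<in> Q5" "\<And>a. a \<in> {1..2 * s} \<Longrightarrow> smooth_on Q5 (X a)"
    "\<And>a z. a \<in> {1..2 * s} \<Longrightarrow> z \<in> Q5 \<Longrightarrow> z \<in> ?P \<Longrightarrow> X a z = x a (chart_inv ?d z)"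
    by (rule smooth_fun_family[OF B d0(1,2) w0 finite_atLeastAtMost, of 1 "2 * s" x]) (rule x_smooth, assumption, rule that, assumption+)
  obtain Q6 Xb where Xb: "open Q6" "?z0 \<in> Q6" "\<And>a. a \<in> {1..2 * s} \<Longrightarrow> smooth_on Q6 (Xb a)"
    "\<And>a z. a \<in> {1..2 * s} \<Longrightarrow> z \<in> Q6 \<Longrightarrow> z \<in> ?P \<Longrightarrow> Xb a z = xbar a (chart_inv ?d z)"
    by (rule smooth_fun_family[OF B d0(1,2) w0 finite_atLeastAtMost, of 1 "2 * s" xbar]) (rule xbarV, assumption, rule that, assumption+)
  define Q where "Q = Q1 \<inter> Q2 \<inter> Q3 \<inter> Q4 \<inter> Q5 \<inter> Q6"
  have Q: "open Q" "?z0 \<in> Q" using Y(1,2) p(1,2) q(1,2) k(1,2) X(1,2) Xb(1,2) by (simp_all add: Q_def open_Int)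
  have sm: "smooth_on Q (Y \<nu>)" "smooth_on Q (p \<nu>)" "smooth_on Q (q \<nu>)" for \<nu>
    using smooth_on_subset[OF Y(1) Q(1) _ Y(3)] smooth_on_subset[OF p(1) Q(1) _ p(3)]
      smooth_on_subset[OF q(1) Q(1) _ q(3)] by (auto simp: Q_def)
  have sma: "smooth_on Q (k a)" "smooth_on Q (X a)" "smooth_on Q (Xb a)" if "a \<in> {1..2 * s}" for a
    using smooth_on_subset[OF k(1) Q(1) _ k(3)[OF that]] smooth_on_subset[OF X(1) Q(1) _ X(3)[OF that]]
      smooth_on_subset[OF Xb(1) Q(1) _ Xb(3)[OF that]] by (auto simp: Q_def)
  let ?D = "\<lambda>h z. frechet_derivative h (at z) :: 'f \<Rightarrow> real"
  have linD: "linear (?D h z)" if "z \<in> Q" "smooth_on Q h" for h z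
    using smooth_on_has_derivative[OF Q(1) that(2,1)] has_derivative_linear by blast
  \<comment> \<open>The derivative of \<pi> in the fixed chart \<open>?d\<close> of the base:
    differentials of pulled back functions are ordinary derivatives of extensions, applied to
    \<open>?\<kappa>\<close>.\<close>
  let ?\<kappa> = "\<lambda>m v. frechet_derivative (\<lambda>u. snd ?d (\<pi> (chart_inv (ref_chart A m) u)))
    (at (snd (ref_chart A m) m)) v"
  have pull: "d (\<lambda>m. F (\<pi> m)) m v = ?D h (snd ?d (\<pi> m)) (?\<kappa> m v)"
    if m: "\<pi> m \<in> V" "\<pi> m \<in> fst ?d" "snd ?d (\<pi> m) \<in> Q" and h: "smooth_on Q h"
      "\<And>z. z \<in> Q \<Longrightarrow> z \<in> ?P \<Longrightarrow> h z = F (chart_inv ?d z)" for F h m v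
    by (rule pullback_differential[OF A B proj m(1) V_thick[OF m(1)] d0(1) m(2) Q(1) m(3) h])
  \<comment> \<open>Rows: \<open>None\<close> is the normalization, \<open>Some b\<close> the
    component of the covector equation along b. Columns: \<open>Inl \<nu>\<close> is the correction
    of the \<nu>-th angle, \<open>Inr a\<close> the coefficient of the a-th d xbar.\<close>
  define a where "a j i z = (case j of
      None \<Rightarrow> (case i of Inl \<nu> \<Rightarrow> Y \<nu> z | Inr a \<Rightarrow> 0)
    | Some b \<Rightarrow> (case i of Inl \<nu> \<Rightarrow> (- 1) * ?D (Y \<nu>) z b | Inr a \<Rightarrow> ?D (Xb a) z b))"
    for j :: "'f option" and i :: "'k + nat" and z
  \<comment> \<open>The right side in base coordinates: the angle forms of the translations weighted
    by y, plus \<Sum> g dx.\<close>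
  define \<beta> where "\<beta> z u = (\<Sum>\<nu>\<in>UNIV. Y \<nu> z * (p \<nu> z * ?D (q \<nu>) z u + (- 1) * (q \<nu> z * ?D (p \<nu>) z u))) +
    (\<Sum>a=1..2 * s. k a z * ?D (X a) z u)" for z u
  define b where "b j z = (case j of None \<Rightarrow> 0 | Some b \<Rightarrow> \<beta> z b)" for j :: "'f option" and z
  let ?I = "UNIV <+> {1..2 * s} :: ('k + nat) set" and ?J = "insert None (Some ` (Basis :: 'f set))"
  have sum_I: "(\<Sum>i\<in>?I. h i) = (\<Sum>\<nu>\<in>UNIV. h (Inl \<nu>)) + (\<Sum>a=1..2 * s. h (Inr a))"
    for h :: "'k + nat \<Rightarrow> real"
    by (subst sum.Plus) simp_all
  have linear_sol: "linear (\<lambda>u. - (\<Sum>\<nu>\<in>UNIV. f \<nu> * ?D (Y \<nu>) z u) + (\<Sum>a=1..2 * s. c a * ?D (Xb a) z u))"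
    if "z \<in> Q" for z f c
    by (intro linear_compose_add linear_compose_neg linear_compose_sum ballI linear_real_scale_left linD that sm sma)
  have linear_\<beta>: "linear (\<beta> z)" if "z \<in> Q" for z
    unfolding \<beta>_def
    by (intro linear_compose_add linear_compose_sum ballI linear_real_scale_left linD that sm sma)
  \<comment> \<open>Back from components to covectors: linear forms that agree on the basis are
    equal.\<close>
  have sys: "(\<Sum>\<nu>\<in>UNIV. Y \<nu> z * h (Inl \<nu>)) = 0 \<and>
      (\<forall>u. - (\<Sum>\<nu>\<in>UNIV. h (Inl \<nu>) * ?D (Y \<nu>) z u) + (\<Sum>a=1..2 * s. h (Inr a) * ?D (Xb a) z u) = r u)"
    if z: "z \<in> Q" and r: "linear r"
      and eq: "\<And>j. j \<in> ?J \<Longrightarrow> (\<Sum>i\<in>?I. a j i z * h i) = (case j of None \<Rightarrow> 0 | Some b \<Rightarrow> r b)"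
    for z r and h :: "'k + nat \<Rightarrow> real"
  proof
    show "(\<Sum>\<nu>\<in>UNIV. Y \<nu> z * h (Inl \<nu>)) = 0"
      using eq[of None] unfolding sum_I by (simp add: a_def)
    have "(\<lambda>u. - (\<Sum>\<nu>\<in>UNIV. h (Inl \<nu>) * ?D (Y \<nu>) z u) + (\<Sum>a=1..2 * s. h (Inr a) * ?D (Xb a) z u)) = r"
    proof (rule linear_eq_stdbasis[OF linear_sol[OF z] r])
      fix b :: 'f assume "b \<in> Basis"
      then show "- (\<Sum>\<nu>\<in>UNIV. h (Inl \<nu>) * ?D (Y \<nu>) z b) + (\<Sum>a=1..2 * s. h (Inr a) * ?D (Xb a) z b) = r b"
        using eq[of "Some b"] unfolding sum_I by (simp add: a_def sum_negf mult.commute)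
    qed
    then show "\<forall>u. - (\<Sum>\<nu>\<in>UNIV. h (Inl \<nu>) * ?D (Y \<nu>) z u) +
        (\<Sum>a=1..2 * s. h (Inr a) * ?D (Xb a) z u) = r u" by meson
  qed
  have "\<exists>R sol. open R \<and> ?z0 \<in> R \<and> R \<subseteq> Q \<and> (\<forall>i\<in>?I. smooth_on R (sol i)) \<and>
    (\<forall>z\<in>R. \<forall>j\<in>?J. (\<Sum>i\<in>?I. a j i z * sol i z) = b j z)"
  proof (rule smooth_linear_solve[OF _ _ _ Q])
    show "finite ?I" "finite ?J" by auto
    have "card ?J = DIM('f) + 1" by (subst card_insert_disjoint) (auto simp: card_image)
    moreover have "card ?I = CARD('k) + 2 * s" by (subst card_Plus) auto
    ultimately show "card ?J = card ?I" using dim_W by simp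
    show "smooth_on Q (a j i)" if "j \<in> ?J" "i \<in> ?I" for j i
    proof -
      have 1: "smooth_on Q (\<lambda>z. (- 1) * ?D (Y \<nu>) z u)" for \<nu> u
        by (intro smooth_on_mult smooth_on_const Q(1) smooth_on_frechet_derivative sm)
      have 2: "smooth_on Q (\<lambda>z. ?D (Xb a) z u)" if "a \<in> {1..2 * s}" for a u
        by (intro smooth_on_frechet_derivative sma that)
      show ?thesis
        using \<open>i \<in> ?I\<close> 1 2 sm(1) smooth_on_const[OF Q(1)]
        by (cases j; cases i) (auto simp: a_def[abs_def])
    qed
    show "smooth_on Q (b j)" if "j \<in> ?J" for j
    proof -
      have "smooth_on Q (\<lambda>z. \<beta> z u)" for u
        unfolding \<beta>_def
        by (intro smooth_on_add smooth_on_sum smooth_on_mult smooth_on_const Q(1)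
            smooth_on_frechet_derivative sm sma)
      then show ?thesis using smooth_on_const[OF Q(1)] by (cases j) (simp_all add: b_def[abs_def])
    qed
    \<comment> \<open>Regularity at \<open>?z0\<close>: a homogeneous solution, read through
      \<open>?\<kappa>\<close> at \<open>sec w0\<close>, satisfies the hypotheses of
      \<open>nondegenerate\<close>.\<close>
    fix h :: "'k + nat \<Rightarrow> real"
    assume h: "\<And>j. j \<in> ?J \<Longrightarrow> (\<Sum>i\<in>?I. a j i ?z0 * h i) = 0"
    have "(\<Sum>i\<in>?I. a j i ?z0 * h i) = (case j of None \<Rightarrow> 0 | Some b \<Rightarrow> (\<lambda>b. 0) b)" if "j \<in> ?J" for j
      using h[OF that] by (simp split: option.split)
    from sys[OF Q(2) linear_zero this]
    have h': "(\<Sum>\<nu>\<in>UNIV. Y \<nu> ?z0 * h (Inl \<nu>)) = 0"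
      "\<And>u. (\<Sum>\<nu>\<in>UNIV. h (Inl \<nu>) * ?D (Y \<nu>) ?z0 u) = (\<Sum>a=1..2 * s. h (Inr a) * ?D (Xb a) ?z0 u)"
      by (simp_all add: algebra_simps)
    let ?m = "sec w0"
    have m: "\<pi> ?m = w0" "\<pi> ?m \<in> V" using w0 V_sub sec by auto
    have zP: "?z0 \<in> ?P" using w0 d0 by auto
    have "Y \<nu> ?z0 = y \<nu> w0" for \<nu>
      using Y(4)[OF UNIV_I Y(2) zP] by (simp add: chart_inv_left[OF d0(3,2)])
    then have 1: "(\<Sum>\<nu>\<in>UNIV. y \<nu> (\<pi> ?m) * h (Inl \<nu>)) = 0" using h'(1) by (simp add: m)
    have "d (\<lambda>m. y \<nu> (\<pi> m)) ?m v = ?D (Y \<nu>) ?z0 (?\<kappa> ?m v)" for \<nu> v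
      using pull[OF m(2) _ _ sm(1)[of \<nu>], of "y \<nu>"] Y(4) Q d0 by (simp add: m Q_def)
    moreover have "d (\<lambda>m. xbar a (\<pi> m)) ?m v = ?D (Xb a) ?z0 (?\<kappa> ?m v)" if "a \<in> {1..2 * s}" for a v
      using pull[OF m(2) _ _ sma(3)[OF that], of "xbar a"] Xb(4)[OF that] Q d0 by (simp add: m Q_def)
    ultimately have 2: "(\<Sum>\<nu>\<in>UNIV. h (Inl \<nu>) * d (\<lambda>m. y \<nu> (\<pi> m)) ?m v) =
      (\<Sum>a=1..2 * s. h (Inr a) * d (\<lambda>m. xbar a (\<pi> m)) ?m v)" for v
      using h'(2)[of "?\<kappa> ?m v"] by simp
    show "\<forall>i\<in>?I. h i = 0"
      using nondegenerate[OF m(2) 1 2] by auto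
  qed
  then obtain R sol where R: "open R" "?z0 \<in> R" "R \<subseteq> Q" "\<forall>i\<in>?I. smooth_on R (sol i)"
    "\<forall>z\<in>R. \<forall>j\<in>?J. (\<Sum>i\<in>?I. a j i z * sol i z) = b j z" by (elim exE conjE) (rule that)
  let ?V = "V \<inter> (fst ?d \<inter> snd ?d -` R)"
  have "solves w (\<lambda>\<nu>. sol (Inl \<nu>) (snd ?d w)) (\<lambda>a. sol (Inr a) (snd ?d w))" if w: "w \<in> ?V" for w
    unfolding solves_def
  proof (intro conjI allI impI)
    let ?z = "snd ?d w"
    have z: "?z \<in> Q" "?z \<in> ?P" using w R(3) by auto
    have "(\<Sum>i\<in>?I. a j i ?z * sol i ?z) = (case j of None \<Rightarrow> 0 | Some b \<Rightarrow> \<beta> ?z b)" if "j \<in> ?J" for j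
      using bspec[OF bspec[OF R(5)] that, of ?z] w by (simp add: b_def)
    note sys = sys[OF z(1) linear_\<beta>[OF z(1)] this]
    have inv: "chart_inv ?d ?z = w" using w by (simp add: chart_inv_left[OF d0(3)])
    have val: "Y \<nu> ?z = y \<nu> w" "p \<nu> ?z = Re (T \<nu> w)" "q \<nu> ?z = Im (T \<nu> w)" for \<nu>
      using Y(4)[of \<nu> ?z] p(4)[of \<nu> ?z] q(4)[of \<nu> ?z] z by (simp_all add: Q_def inv)
    have vala: "k a ?z = g a w" if "a \<in> {1..2 * s}" for a
      using k(4)[OF that, of ?z] z by (simp add: Q_def inv)
    show "(\<Sum>\<nu>\<in>UNIV. ybar \<nu> w * sol (Inl \<nu>) ?z) = 0"
      using conjunct1[OF sys] w by (simp add: val y_ybar)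
    fix m v assume m: "\<pi> m = w"
    have mV: "\<pi> m \<in> V" "\<pi> m \<in> fst ?d" "snd ?d (\<pi> m) \<in> Q" using w m z by auto
    have pull': "d (\<lambda>m. F (\<pi> m)) m v = ?D h ?z (?\<kappa> m v)"
      if "smooth_on Q h" "\<And>z. z \<in> Q \<Longrightarrow> z \<in> ?P \<Longrightarrow> h z = F (chart_inv ?d z)" for F h
      using pull[OF mV that] unfolding m .
    have dv: "d (\<lambda>m. y \<nu> (\<pi> m)) m v = ?D (Y \<nu>) ?z (?\<kappa> m v)"
      "d (\<lambda>m. Re (T \<nu> (\<pi> m))) m v = ?D (p \<nu>) ?z (?\<kappa> m v)"
      "d (\<lambda>m. Im (T \<nu> (\<pi> m))) m v = ?D (q \<nu>) ?z (?\<kappa> m v)" for \<nu>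
      using pull'[OF sm(1)[of \<nu>], of "y \<nu>"] pull'[OF sm(2)[of \<nu>], of "\<lambda>w. Re (T \<nu> w)"]
        pull'[OF sm(3)[of \<nu>], of "\<lambda>w. Im (T \<nu> w)"] Y(4) p(4) q(4) by (simp_all add: Q_def)
    have dva: "d (\<lambda>m. x a (\<pi> m)) m v = ?D (X a) ?z (?\<kappa> m v)"
      "d (\<lambda>m. xbar a (\<pi> m)) m v = ?D (Xb a) ?z (?\<kappa> m v)" if "a \<in> {1..2 * s}" for a
      using pull'[OF sma(2)[OF that], of "x a"] pull'[OF sma(3)[OF that], of "xbar a"]
        X(4)[OF that] Xb(4)[OF that] by (simp_all add: Q_def)
    \<comment> \<open>Over V the values and derivatives of the extensions are the true ones, so the
      covector equation at \<open>?z\<close>, applied to \<open>?\<kappa> m v\<close>, turns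
      \<open>form_Phi\<close> into the required formula.\<close>
    have "\<alpha> m v = (\<Sum>\<nu>\<in>UNIV. y \<nu> w * d_angle A (\<pi> -` V) (\<lambda>m. \<Phi> m $ \<nu>) m v) + \<beta> ?z (?\<kappa> m v)"
      unfolding form_Phi[OF mV(1)] \<beta>_def m val dv by (simp add: dva vala)
    also have "\<beta> ?z (?\<kappa> m v) = - (\<Sum>\<nu>\<in>UNIV. sol (Inl \<nu>) ?z * d (\<lambda>m. y \<nu> (\<pi> m)) m v) +
        (\<Sum>a=1..2 * s. sol (Inr a) ?z * d (\<lambda>m. xbar a (\<pi> m)) m v)"
      unfolding dv using conjunct2[OF sys, rule_format, of "?\<kappa> m v"] by (simp add: dva)
    finally show "\<alpha> m v =
      (\<Sum>\<nu>\<in>UNIV. ybar \<nu> w * d_angle A (\<pi> -` W') (\<lambda>m. \<Phi> m $ \<nu>) m v) -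
      (\<Sum>\<nu>\<in>UNIV. sol (Inl \<nu>) ?z * d' (\<lambda>m. ybar \<nu> (\<pi> m)) m v) +
      (\<Sum>a=1..2 * s. sol (Inr a) ?z * d' (\<lambda>m. xbar a (\<pi> m)) m v)"
      using w by (simp add: d_ybar[OF mV(1)] d_local[OF mV(1)] d_angle_def y_ybar)
  qed
  moreover have "openin (top_of_set W') ?V"
    by (rule openin_Int_open[OF V chart_preimage_open[OF d0(3) R(1)]])
  moreover have "smooth_fun_on B ?V (\<lambda>w. sol i (snd ?d w))" if "i \<in> ?I" for i
    by (rule smooth_fun_on_chart[OF B d0(1) R(1) bspec[OF R(4) that]]) auto
  moreover have "w0 \<in> ?V" using w0 d0 R by auto
  ultimately show ?thesis
    by (intro exI[of _ ?V] exI[of _ "\<lambda>\<nu> w. sol (Inl \<nu>) (snd ?d w)"]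
        exI[of _ "\<lambda>a w. sol (Inr a) (snd ?d w)"]) auto
qed

end

section \<open>New angles, and gluing of the local solutions\<close>

context torus_structure
begin

definition rotate :: "('w \<Rightarrow> 'k \<Rightarrow> real) \<Rightarrow> complex ^ 'k \<Rightarrow> 'w \<Rightarrow> complex ^ 'k" where
  "rotate f z w = (\<chi> \<nu>. cis (f w \<nu>) * z $ \<nu>)"

lemma rotate_torus: "z \<in> torus \<Longrightarrow> rotate f z w \<in> torus"
  by (simp add: torus_def rotate_def norm_mult)

lemma rotate_smooth:
  fixes A' :: "('q::topological_space, 'r::euclidean_space) chart set"
  assumes A': "smooth_atlas A'" and f: "\<And>\<nu>. smooth_fun_on A' X (\<lambda>x. f (p x) \<nu>)"
    and z: "\<And>\<nu>. smooth_fun_on A' X (\<lambda>x. z x $ \<nu>)"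
  shows "smooth_fun_on A' X (\<lambda>x. rotate f (z x) (p x))"
  by (rule smooth_fun_on_vec[OF A'])
    (use smooth_fun_on_mult[OF A' smooth_fun_on_cis[OF A' f] z] in \<open>simp add: rotate_def\<close>)

text \<open>Adding functions of the base to the angles is undone by subtracting them, so the inverse
  \<open>?K\<close> is the old inverse after a rotation by -f and stays smooth.\<close>

lemma angles_over_rotate:
  assumes f: "\<And>\<nu>. smooth_fun_on B W' (\<lambda>w. f w \<nu>)"
  shows "angles_over A B \<pi> W' (\<lambda>m. rotate f (\<Phi> m) (\<pi> m))"
proof -
  let ?h = "\<lambda>m. (rotate f (\<Phi> m) (\<pi> m), \<pi> m)"
  let ?K = "\<lambda>q. G (rotate (\<lambda>w \<nu>. - f w \<nu>) (fst q) (snd q), snd q)"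
  let ?PB = "product_atlas euclidean_atlas B :: ((complex ^ 'k) \<times> 'w, (complex ^ 'k) \<times> 'f) chart set"
  have PB: "smooth_atlas ?PB" by (rule smooth_atlas_product[OF smooth_atlas_euclidean B])
  have rot: "rotate f (rotate (\<lambda>w \<nu>. - f w \<nu>) z w) w = z" "rotate (\<lambda>w \<nu>. - f w \<nu>) (rotate f z w) w = z" for z w
    by (simp_all add: rotate_def vec_eq_iff cis_mult flip: mult.assoc)
  have K: "\<Phi> (?K (z, w)) = rotate (\<lambda>w \<nu>. - f w \<nu>) z w" "\<pi> (?K (z, w)) = w" if "z \<in> torus" "w \<in> W'" for z w
    using Phi_G[OF rotate_torus that(2)] that by simp_all
  have KK: "?h (?K q) = q" if "q \<in> torus \<times> W'" for q
    using that K by (cases q) (auto simp: rot)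
  have bij: "bij_betw ?h (\<pi> -` W') (torus \<times> W')"
  proof (rule bij_betw_byWitness[where f' = ?K])
    show "\<forall>m\<in>\<pi> -` W'. ?K (?h m) = m" using G_Phi by (simp add: rot)
    show "\<forall>q\<in>torus \<times> W'. ?h (?K q) = q" using KK by blast
    show "?h ` (\<pi> -` W') \<subseteq> torus \<times> W'" using rotate_torus Phi_torus by auto
    show "?K ` (torus \<times> W') \<subseteq> \<pi> -` W'" using K(2) by auto
  qed
  have "smooth_fun_on A (\<pi> -` W') (\<lambda>m. rotate f (\<Phi> m) (\<pi> m))"
    by (rule rotate_smooth[OF A pullback_smooth[OF f] Phi_smooth])
  then have 1: "smooth_map_on A ?PB (\<pi> -` W') ?h"
    using smooth_map_on_productI[OF A B _ smooth_fun_on_continuous[OF A] smooth_map_on_subset[OF proj]] by blast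
  note fs = smooth_map_on_product_fst[OF B, of "torus \<times> W' :: ((complex ^ 'k) \<times> 'w) set"]
  have neg: "smooth_fun_on B W' (\<lambda>w. - f w \<nu>)" for \<nu>
    by (rule smooth_fun_on_linear[OF B f bounded_linear_minus[OF bounded_linear_ident]])
  have "smooth_fun_on ?PB (torus \<times> W') (\<lambda>q. rotate (\<lambda>w \<nu>. - f w \<nu>) (fst q) (snd q))"
    by (rule rotate_smooth[OF PB smooth_fun_on_compose[OF PB B fs(2) neg] smooth_fun_on_vec_nth[OF PB fs(1)]]) auto
  then have "smooth_map_on ?PB ?PB (torus \<times> W') (\<lambda>q. (rotate (\<lambda>w \<nu>. - f w \<nu>) (fst q) (snd q), snd q))"
    using smooth_map_on_productI[OF PB B _ smooth_fun_on_continuous[OF PB] fs(2)] by blast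
  from smooth_map_on_compose[OF PB PB A this G_smooth]
  have "smooth_map_on ?PB A (torus \<times> W') ?K" using rotate_torus by force
  then have "smooth_map_on ?PB A (torus \<times> W') (inv_into (\<pi> -` W') ?h)"
  proof (rule smooth_map_on_cong)
    fix q :: "(complex ^ 'k) \<times> 'w"
    assume q: "q \<in> torus \<times> W'"
    have "?K q \<in> \<pi> -` W'" using q K(2) by (cases q) auto
    from inv_into_f_f[OF bij_betw_imp_inj_on[OF bij] this]
    show "?K q = inv_into (\<pi> -` W') ?h q" unfolding KK[OF q] by simp
  qed
  then show ?thesis unfolding angles_over_def diffeo_on_def using bij 1 by blast
qed

text \<open>All factors have modulus 1, so in the product of the conjugate and the differential the
  factor \<open>cis\<close> contributes \<i> df and cancels elsewhere.\<close>

lemma d_angle_rotate: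
  assumes f: "\<And>\<nu>. smooth_fun_on B W' (\<lambda>w. f w \<nu>)" and m: "\<pi> m \<in> W'"
  shows "d_angle A (\<pi> -` W') (\<lambda>m. rotate f (\<Phi> m) (\<pi> m) $ \<nu>) m v =
    d_angle A (\<pi> -` W') (\<lambda>m. \<Phi> m $ \<nu>) m v + d' (\<lambda>m. f (\<pi> m) \<nu>) m v"
proof -
  let ?P = "\<Phi> m $ \<nu>" and ?e = "cis (f (\<pi> m) \<nu>)"
  have hP: "has_diff A (\<pi> -` W') (\<lambda>m. \<Phi> m $ \<nu>) m (d' (\<lambda>m. \<Phi> m $ \<nu>) m)"
    using smooth_has_diff[OF A Phi_smooth] m by simp
  have hf: "has_diff A (\<pi> -` W') (\<lambda>m. f (\<pi> m) \<nu>) m (d' (\<lambda>m. f (\<pi> m) \<nu>) m)"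
    using smooth_has_diff[OF A pullback_smooth[OF f]] m by simp
  have "d' (\<lambda>m. rotate f (\<Phi> m) (\<pi> m) $ \<nu>) m v =
      ?e * d' (\<lambda>m. \<Phi> m $ \<nu>) m v + (d' (\<lambda>m. f (\<pi> m) \<nu>) m v *\<^sub>R (\<i> * ?e)) * ?P"
    using has_diff_differential[OF A thick[OF m]
        has_diff_bilinear[OF A bounded_bilinear_mult has_diff_cis[OF A hf] hP]]
    by (simp add: rotate_def)
  then have "cnj (rotate f (\<Phi> m) (\<pi> m) $ \<nu>) * d' (\<lambda>m. rotate f (\<Phi> m) (\<pi> m) $ \<nu>) m v =
    (cnj ?e * ?e) * (cnj ?P * d' (\<lambda>m. \<Phi> m $ \<nu>) m v) +
    (cnj ?e * ?e) * (cnj ?P * ?P) * (\<i> * of_real (d' (\<lambda>m. f (\<pi> m) \<nu>) m v))"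
    by (simp add: rotate_def scaleR_conv_of_real algebra_simps)
  also have "\<dots> = cnj ?P * d' (\<lambda>m. \<Phi> m $ \<nu>) m v + \<i> * of_real (d' (\<lambda>m. f (\<pi> m) \<nu>) m v)"
    using unit_mult_cnj[of ?e] unit_mult_cnj[OF torus_norm[OF Phi_torus[OF m]], of \<nu>] by simp
  finally show ?thesis unfolding d_angle_def by simp
qed

end

text \<open>All covering charts share the trivialization \<Phi>, so their local systems are
  instances of the same \<open>solves\<close>.\<close>

locale covered_torus_structure = torus_structure +
  assumes cover: "\<And>w. w \<in> W' \<Longrightarrow> \<exists>V \<Theta> y x g. w \<in> V \<and> action_chart A B \<pi> \<alpha> n s W' N \<Phi> xbar E V \<Theta> y x g"
begin

text \<open>The values are chosen point by point, without regard to smoothness; uniqueness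
  identifies them with the smooth local solution near each point. Coefficients with index outside
  \<open>{1..2 * s}\<close> stay arbitrary.\<close>

lemma global_solution:
  obtains f c where "\<And>\<nu>. smooth_fun_on B W' (\<lambda>w. f w \<nu>)"
    "\<And>a. a \<in> {1..2 * s} \<Longrightarrow> smooth_fun_on B W' (\<lambda>w. c w a)" "\<And>w. w \<in> W' \<Longrightarrow> solves w (f w) (c w)"
proof -
  have sol: "\<exists>V' f c. openin (top_of_set W') V' \<and> w \<in> V' \<and> (\<forall>\<nu>. smooth_fun_on B V' (f \<nu>)) \<and>
    (\<forall>a\<in>{1..2 * s}. smooth_fun_on B V' (c a)) \<and> (\<forall>w\<in>V'. solves w (\<lambda>\<nu>. f \<nu> w) (\<lambda>a. c a w))"
    if "w \<in> W'" for w
  proof -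
    obtain V \<Theta> y x g where V: "w \<in> V" "action_chart A B \<pi> \<alpha> n s W' N \<Phi> xbar E V \<Theta> y x g"
      using cover[OF \<open>w \<in> W'\<close>] by blast
    show ?thesis by (rule action_chart.local_solution[OF V(2,1)])
  qed
  have "\<exists>f c. solves w f c" if "w \<in> W'" for w using sol[OF that] by blast
  then obtain f c where fc: "\<And>w. w \<in> W' \<Longrightarrow> solves w (f w) (c w)" by metis
  have unique: "f' = f w" "\<forall>a\<in>{1..2 * s}. c' a = c w a" if "w \<in> W'" "solves w f' c'" for w f' c'
  proof -
    obtain V \<Theta> y x g where V: "w \<in> V" "action_chart A B \<pi> \<alpha> n s W' N \<Phi> xbar E V \<Theta> y x g"
      using cover[OF \<open>w \<in> W'\<close>] by blast
    from action_chart.solves_unique[OF V(2,1) that(2) fc[OF that(1)]]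
    show "f' = f w" "\<forall>a\<in>{1..2 * s}. c' a = c w a" by auto
  qed
  have fs: "smooth_fun_on B W' (\<lambda>w. f w \<nu>)" for \<nu>
  proof (rule smooth_fun_on_local[OF B])
    fix w assume "w \<in> W'"
    then obtain V' f' c' where V': "openin (top_of_set W') V'" "w \<in> V'" "smooth_fun_on B V' (f' \<nu>)"
      "\<And>w. w \<in> V' \<Longrightarrow> solves w (\<lambda>\<nu>. f' \<nu> w) (\<lambda>a. c' a w)" using sol by metis
    have "f' \<nu> w = f w \<nu>" if "w \<in> V'" for w
      using unique(1)[OF _ V'(4)[OF that]] openin_imp_subset[OF V'(1)] that by (metis subsetD)
    then show "\<exists>T. openin (top_of_set W') T \<and> w \<in> T \<and> smooth_fun_on B T (\<lambda>w. f w \<nu>)"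
      using V' smooth_fun_on_cong[OF V'(3), of "\<lambda>w. f w \<nu>"] by blast
  qed
  have cs: "smooth_fun_on B W' (\<lambda>w. c w a)" if a: "a \<in> {1..2 * s}" for a
  proof (rule smooth_fun_on_local[OF B])
    fix w assume "w \<in> W'"
    then obtain V' f' c' where V': "openin (top_of_set W') V'" "w \<in> V'" "smooth_fun_on B V' (c' a)"
      "\<And>w. w \<in> V' \<Longrightarrow> solves w (\<lambda>\<nu>. f' \<nu> w) (\<lambda>a. c' a w)" using sol a by metis
    have "c' a w = c w a" if "w \<in> V'" for w
      using unique(2)[OF _ V'(4)[OF that]] openin_imp_subset[OF V'(1)] that a by blast
    then show "\<exists>T. openin (top_of_set W') T \<and> w \<in> T \<and> smooth_fun_on B T (\<lambda>w. c w a)"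
      using V' smooth_fun_on_cong[OF V'(3), of "\<lambda>w. c w a"] by blast
  qed
  show thesis by (rule that[OF fs cs fc])
qed

lemma ybar_smooth: "smooth_fun_on B W' (ybar \<nu>)"
proof (rule smooth_fun_on_local[OF B])
  fix w assume "w \<in> W'"
  then obtain V \<Theta> y x g where loc: "w \<in> V" "action_chart A B \<pi> \<alpha> n s W' N \<Phi> xbar E V \<Theta> y x g"
    using cover by blast
  interpret action_chart A B \<pi> \<alpha> n s W' N \<Phi> xbar E V \<Theta> y x g by (rule loc(2))
  have "smooth_fun_on B V (ybar \<nu>)" by (rule smooth_fun_on_cong[OF y_smooth y_ybar])
  then show "\<exists>T. openin (top_of_set W') T \<and> w \<in> T \<and> smooth_fun_on B T (ybar \<nu>)"
    using V loc(1) by blast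
qed

lemma ybar_integral:
  assumes m: "\<pi> m \<in> W'" and v: "v \<in> E m"
  shows "d' (\<lambda>m. ybar \<nu> (\<pi> m)) m v = 0"
proof -
  obtain V \<Theta> y x g where loc: "\<pi> m \<in> V" "action_chart A B \<pi> \<alpha> n s W' N \<Phi> xbar E V \<Theta> y x g"
    using cover[OF m] by blast
  interpret action_chart A B \<pi> \<alpha> n s W' N \<Phi> xbar E V \<Theta> y x g by (rule loc(2))
  show ?thesis
    unfolding d_ybar[OF loc(1)] using y_integral loc(1) v unfolding first_integral_on_def by simp
qed

lemma exact_correction:
  assumes f: "\<And>\<nu>. smooth_fun_on B W' (\<lambda>w. f w \<nu>)" and fc: "\<And>w. w \<in> W' \<Longrightarrow> solves w (f w) (c w)"
    and m: "\<pi> m \<in> W'"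
  shows "(\<Sum>\<nu>\<in>UNIV. ybar \<nu> (\<pi> m) * d' (\<lambda>m. f (\<pi> m) \<nu>) m v) =
    - (\<Sum>\<nu>\<in>UNIV. f (\<pi> m) \<nu> * d' (\<lambda>m. ybar \<nu> (\<pi> m)) m v)"
proof -
  let ?k = "\<lambda>v. \<Sum>\<nu>\<in>UNIV. ybar \<nu> (\<pi> m) * d' (\<lambda>m. f (\<pi> m) \<nu>) m v + d' (\<lambda>m. ybar \<nu> (\<pi> m)) m v * f (\<pi> m) \<nu>"
  have hy: "has_diff A (\<pi> -` W') (\<lambda>m. ybar \<nu> (\<pi> m)) m (d' (\<lambda>m. ybar \<nu> (\<pi> m)) m)" for \<nu>
    using smooth_has_diff[OF A pullback_smooth[OF ybar_smooth]] m by simp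
  have hf: "has_diff A (\<pi> -` W') (\<lambda>m. f (\<pi> m) \<nu>) m (d' (\<lambda>m. f (\<pi> m) \<nu>) m)" for \<nu>
    using smooth_has_diff[OF A pullback_smooth[OF f]] m by simp
  have "has_diff A (\<pi> -` W') (\<lambda>m. \<Sum>\<nu>\<in>UNIV. ybar \<nu> (\<pi> m) * f (\<pi> m) \<nu>) m
    ?k"
    by (intro has_diff_sum has_diff_bilinear[OF A bounded_bilinear_mult hy hf])
  \<comment> \<open>The normalization holds at all points over W', so the function that was
    differentiated is zero there.\<close>
  then have "has_diff A (\<pi> -` W') (\<lambda>m. 0) m
    ?k"
    by (rule has_diff_transform[OF A]) (use fc m in \<open>auto simp: solves_def\<close>)
  from has_diff_differential[OF A thick[OF m] this] has_diff_differential[OF A thick[OF m] has_diff_const]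
  have "?k = (\<lambda>v. 0)"
    by metis
  from fun_cong[OF this, of v] show ?thesis by (simp add: sum.distrib mult.commute)
qed

end

text \<open>The dependent action \<open>y j\<close> is smooth by an explicit clause; the other y and
  all x are smooth as components of a chart of the maximal atlas.\<close>

lemma (in torus_structure) action_chartI:
  assumes E: "E = pseudo_orthogonal A \<alpha> (vertical A B \<pi>)" and V: "openin (top_of_set W') V"
    and chart: "action_angle_chart A B \<pi> \<alpha> s V \<Theta>" and trans: "differ_by_translation \<pi> V \<Theta> \<Phi>"
  shows "\<exists>y x g. action_chart A B \<pi> \<alpha> n s W' N \<Phi> xbar E V \<Theta> y x g"
proof -
  obtain j y x g c b where c: "c \<in> maximal_atlas B" "V \<subseteq> fst c"
    and b: "\<forall>w\<in>V. (\<forall>\<nu>\<in>UNIV - {j}. y \<nu> w = snd c w \<bullet> b (Inl \<nu>)) \<and> (\<forall>a\<in>{1..2 * s}. x a w = snd c w \<bullet> b (Inr a))"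
    and yj: "smooth_fun_on B V (y j)"
    and fi: "\<forall>\<nu>. first_integral_on A (pseudo_orthogonal A \<alpha> (vertical A B \<pi>)) (\<pi> -` V) (y \<nu> \<circ> \<pi>)"
    and g: "\<forall>a\<in>{1..2 * s}. smooth_fun_on B V (g a)"
    and form: "\<forall>m\<in>\<pi> -` V. \<forall>v. \<alpha> m v =
           (\<Sum>\<nu>\<in>UNIV. y \<nu> (\<pi> m) * d_angle A (\<pi> -` V) (\<lambda>m. \<Theta> m $ \<nu>) m v) +
           (\<Sum>a=1..2 * s. g a (\<pi> m) * differential A (\<pi> -` V) (x a \<circ> \<pi>) m v)"
    using conjunct2[OF chart[unfolded action_angle_chart_def]] by (elim exE conjE bexE) (rule that)
  have comp: "smooth_fun_on B V (\<lambda>w. snd c w \<bullet> u)" for u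
    by (rule smooth_fun_on_linear[OF B smooth_fun_on_subset[OF maximal_chart_smooth[OF B c(1)] c(2)]
          bounded_linear_inner_left])
  have "action_chart A B \<pi> \<alpha> n s W' N \<Phi> xbar E V \<Theta> y x g"
  proof
    show "openin (top_of_set W') V" "differ_by_translation \<pi> V \<Theta> \<Phi>" by (fact V trans)+
    show "angles_over A B \<pi> V \<Theta>" using chart by (simp add: action_angle_chart_def)
    show "smooth_fun_on B V (y \<nu>)" for \<nu>
      using yj smooth_fun_on_cong[OF comp] b by (cases "\<nu> = j") auto
    show "smooth_fun_on B V (x a)" if "a \<in> {1..2 * s}" for a
      using smooth_fun_on_cong[OF comp] b that by auto
  qed (use fi g form E in \<open>auto simp: o_def\<close>)
  then show ?thesis by blast
qed

theorem theorem6: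
  fixes A :: "('m::{t2_space, second_countable_topology}, 'e::euclidean_space) chart set"
    and B :: "('w::{t2_space, second_countable_topology}, 'f::euclidean_space) chart set"
    and \<pi> :: "'m \<Rightarrow> 'w"
    and \<alpha> :: "'m \<Rightarrow> 'e \<Rightarrow> real"
    and \<X> :: "('m \<Rightarrow> 'e) set"
    and n p r s :: nat
    and W' N :: "'w set"
    and \<C> :: "('w set \<times> ('m \<Rightarrow> complex ^ 'k)) set"
    and xbar :: "nat \<Rightarrow> 'w \<Rightarrow> real"
    and E :: "'m \<Rightarrow> 'e set"
  assumes M: "smooth_atlas A" "DIM('e) = 2 * n + 1" "connected (UNIV :: 'm set)"
    and W: "smooth_atlas B" "DIM('f) = p" "p \<ge> n"
    and dims: "r + p = 2 * n" "s + r = n" "CARD('k) = r + 1"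
    and contact: "contact_form A n \<alpha>"
    and fibration: "proper_submersion A B \<pi>" "\<And>w. connected (\<pi> -` {w})"
    and preisotropic: "complete_preisotropic_Reeb A B \<pi> \<alpha> \<X>"
    and E_def: "E = pseudo_orthogonal A \<alpha> (vertical A B \<pi>)"
    and W': "connected W'" "compact W'" "regular_domain B W'"
    and trivial: "principal_torus_bundle A B \<pi> \<alpha> s W' \<C>" "trivial_torus_bundle A B \<pi> W' \<C>"
    and xbar_smooth: "open N" "W' \<subseteq> N" "\<And>a. a \<in> {1..2 * s} \<Longrightarrow> smooth_fun_on B N (xbar a)"
    and xbar_independent: "\<And>w c. w \<in> N \<Longrightarrow>
          (\<And>v. (\<Sum>a=1..2 * s. c a * differential B N (xbar a) w v) = 0) \<Longrightarrow>
          \<forall>a\<in>{1..2 * s}. c a = 0"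
    and xbar_transversal: "\<And>m. m \<in> \<pi> -` N \<Longrightarrow>
          range (\<lambda>c v. \<Sum>a=1..2 * s. c a * differential A (\<pi> -` N) (xbar a \<circ> \<pi>) m v)
            \<inter> annihilator (E m) = {\<lambda>v. 0}"
  shows "\<exists>(\<Theta> :: 'm \<Rightarrow> complex ^ 'k) (y :: 'k \<Rightarrow> 'm \<Rightarrow> real) (gbar :: nat \<Rightarrow> 'w \<Rightarrow> real).
           angles_over A B \<pi> W' \<Theta> \<and>
           (\<forall>\<nu>. first_integral_on A E (\<pi> -` W') (y \<nu>)) \<and>
           (\<forall>\<nu>. \<forall>m\<in>\<pi> -` W'. \<forall>m'\<in>\<pi> -` W'. \<pi> m = \<pi> m' \<longrightarrow> y \<nu> m = y \<nu> m') \<and>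
           (\<forall>a\<in>{1..2 * s}. smooth_fun_on B W' (gbar a)) \<and>
           (\<forall>m\<in>\<pi> -` W'. \<forall>v. \<alpha> m v =
              (\<Sum>\<nu>\<in>UNIV. y \<nu> m * d_angle A (\<pi> -` W') (\<lambda>m. \<Theta> m $ \<nu>) m v) +
              (\<Sum>a=1..2 * s. gbar a (\<pi> m) *
                 differential B N (xbar a) (\<pi> m) (tangent_map A B \<pi> m v)))"
proof -
  obtain \<Phi> where \<Phi>: "angles_over A B \<pi> W' \<Phi>" "\<forall>(V, \<Theta>)\<in>\<C>. differ_by_translation \<pi> V \<Theta> \<Phi>"
    using trivial(2) unfolding trivial_torus_bundle_def by blast
  interpret torus_structure A B \<pi> \<alpha> n s W' N \<Phi> xbar E
  proof
    \<comment> \<open>From r + p = 2 n and s + r = n follows r + 2 s = p.\<close>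
    show "CARD('k) + 2 * s = DIM('f) + 1" using dims W(2) by linarith
    show "smooth_map_on A B UNIV \<pi>" "surj (tangent_map A B \<pi> m)" for m
      using fibration(1) by (simp_all add: proper_submersion_def)
  qed (fact M(1) W(1) M(2) contact W'(3) \<Phi>(1) xbar_smooth xbar_independent xbar_transversal)+
  interpret covered_torus_structure A B \<pi> \<alpha> n s W' N \<Phi> xbar E
  proof
    fix w assume "w \<in> W'"
    then obtain V \<Theta> where V: "w \<in> V" "(V, \<Theta>) \<in> \<C>"
      using trivial(1) unfolding principal_torus_bundle_def by blast
    then have loc: "openin (top_of_set W') V" "action_angle_chart A B \<pi> \<alpha> s V \<Theta>"
      "differ_by_translation \<pi> V \<Theta> \<Phi>"
      using trivial(1) \<Phi>(2) unfolding principal_torus_bundle_def by auto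
    from action_chartI[OF E_def this] V(1)
    show "\<exists>V \<Theta> y x g. w \<in> V \<and> action_chart A B \<pi> \<alpha> n s W' N \<Phi> xbar E V \<Theta> y x g"
      by (intro exI[of _ V] exI[of _ \<Theta>]) simp
  qed
  obtain f c where fs: "\<And>\<nu>. smooth_fun_on B W' (\<lambda>w. f w \<nu>)"
    and cs: "\<And>a. a \<in> {1..2 * s} \<Longrightarrow> smooth_fun_on B W' (\<lambda>w. c w a)"
    and fc: "\<And>w. w \<in> W' \<Longrightarrow> solves w (f w) (c w)"
    by (rule global_solution) (rule that)
  show ?thesis
  proof (intro exI conjI allI ballI impI)
    show "angles_over A B \<pi> W' (\<lambda>m. rotate f (\<Phi> m) (\<pi> m))" by (rule angles_over_rotate[OF fs])
    show "first_integral_on A E (\<pi> -` W') (\<lambda>m. ybar \<nu> (\<pi> m))" for \<nu>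
      using pullback_smooth[OF ybar_smooth] ybar_integral by (auto simp: first_integral_on_def)
    show "ybar \<nu> (\<pi> m) = ybar \<nu> (\<pi> m')" if "\<pi> m = \<pi> m'" for \<nu> m m' using that by simp
    show "smooth_fun_on B W' ((\<lambda>a w. c w a) a)" if "a \<in> {1..2 * s}" for a using cs[OF that] by simp
    fix m v assume "m \<in> \<pi> -` W'"
    then have m: "\<pi> m \<in> W'" by simp
    have "\<alpha> m v = (\<Sum>\<nu>\<in>UNIV. ybar \<nu> (\<pi> m) * d_angle A (\<pi> -` W') (\<lambda>m. \<Phi> m $ \<nu>) m v) -
      (\<Sum>\<nu>\<in>UNIV. f (\<pi> m) \<nu> * d' (\<lambda>m. ybar \<nu> (\<pi> m)) m v) +
      (\<Sum>a=1..2 * s. c (\<pi> m) a * d' (\<lambda>m. xbar a (\<pi> m)) m v)"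
      using fc[OF m] unfolding solves_def by blast
    \<comment> \<open>Replacing the angles by their rotations adds \<Sum> y df, which equals -
      \<Sum> f dy by \<open>exact_correction\<close>.\<close>
    also have "\<dots> = (\<Sum>\<nu>\<in>UNIV. ybar \<nu> (\<pi> m) * d_angle A (\<pi> -` W') (\<lambda>m. rotate f (\<Phi> m) (\<pi> m) $ \<nu>) m v) +
      (\<Sum>a=1..2 * s. c (\<pi> m) a * differential B N (xbar a) (\<pi> m) (tangent_map A B \<pi> m v))"
      unfolding d_angle_rotate[OF fs m] using exact_correction[OF fs fc m, of v] xbar_differential(1)[OF m]
      by (simp add: distrib_left sum.distrib)
    finally show "\<alpha> m v =
      (\<Sum>\<nu>\<in>UNIV. ybar \<nu> (\<pi> m) * d_angle A (\<pi> -` W') (\<lambda>m. rotate f (\<Phi> m) (\<pi> m) $ \<nu>) m v) +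
      (\<Sum>a=1..2 * s. (\<lambda>a w. c w a) a (\<pi> m) * differential B N (xbar a) (\<pi> m) (tangent_map A B \<pi> m v))" .
  qed
qed

end
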